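(* Let $W$ be a Weyl group of rank $2$ of type $A_2$, $B_2$ or $G_2$, let $\mathfrak{h}$ be the corresponding (complex, $2$-dimensional) Cartan subalgebra, and let $W$ act diagonally on $\mathfrak{h}\oplus\mathfrak{h}^*$. Then $$\dim_{\mathbb{C}} HP_0\big((\mathfrak{h}\oplus \mathfrak{h}^* )/W\big)=\dim_{\mathbb{C}} HH_0\big(A_2(\mathbb{C})^W\big),$$ and this common dimension equals $1$ in type $A_2$, $2$ in type $B_2$, and $3$ in type $G_2$.
   Context: Let $\mathfrak{g}$ be a complex simple Lie algebra of rank $l$ (here $l=2$), $\mathfrak{h}$ a Cartan subalgebra and $W$ its Weyl group. The space $V=\mathfrak{h}\oplus\mathfrak{h}^*$ carries its canonical $W$-invariant symplectic form, so $S=\mathbb{C}[V]$ is a Poisson algebra on which $W$ acts by Poisson automorphisms, and the invariant algebra $S^W=\mathbb{C}[V/W]$ is a Poisson subalgebra. In degree zero, Poisson homology is $HP_0(V/W)=S^W/\{S^W,S^W\}$, where $\{S^W,S^W\}$ is the linear span of all Poisson brackets of elements of $S^W$. $A_l(\mathbb{C})$ is the Weyl algebra of rank $l$, i.e. the algebra generated by $V$ with commutators given by the symplectic form (polynomial differential operators on $\mathfrak{h}$), with the induced action of $W$ by algebra automorphisms; $A_l(\mathbb{C})^W$ is the algebra of invariants. For an associative algebra $B$, $HH_0(B)=B/[B,B]$, where $[B,B]$ is the linear span of the commutators. *)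

theory Defs
  imports
    "HOL-Analysis.Analysis"
    "HOL-Library.Poly_Mapping"
    "HOL-Library.Function_Algebras"
    "HOL-Algebra.Module"
begin

section \<open>Quotients of vector spaces and their dimension\<close>

definition complex_ring :: "complex ring" where
  "complex_ring = \<lparr>carrier = UNIV, mult = (*), one = 1, zero = 0, add = (+)\<rparr>"

text \<open>The quotient \<open>U / N\<close> of linear subspaces \<open>N \<subseteq> U\<close>, whose elements are the cosets \<open>u + N\<close>.
  The record type of modules extends that of rings; its multiplicative fields are irrelevant
  for modules and left undefined. Adding \<open>N\<close> in the scalar multiplication matters only for the
  scalar 0.\<close>

definition quotient_space ::
  "(complex \<Rightarrow> 'a \<Rightarrow> 'a) \<Rightarrow> 'a::ab_group_add set \<Rightarrow> 'a set \<Rightarrow> (complex, 'a set) module" where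
  "quotient_space scl U N =
    \<lparr>carrier = (\<lambda>u. (+) u ` N) ` U,
     mult = undefined, one = undefined,
     zero = N,
     add = (\<lambda>X Y. {x + y | x y. x \<in> X \<and> y \<in> Y}),
     smult = (\<lambda>c X. {scl c x + y | x y. x \<in> X \<and> y \<in> N})\<rparr>"

lemma module_quotient_space:
  assumes "vector_space scl" "module.subspace scl U" "module.subspace scl N" "N \<subseteq> U"
  shows "Module.module complex_ring (quotient_space scl U N)"
proof -
  interpret vector_space scl by fact
  let ?co = "\<lambda>u. (+) u ` N"
  have N0: "0 \<in> N" and Nadd: "\<And>x y. x \<in> N \<Longrightarrow> y \<in> N \<Longrightarrow> x + y \<in> N"
    and Nneg: "\<And>x. x \<in> N \<Longrightarrow> - x \<in> N" and Nscl: "\<And>c x. x \<in> N \<Longrightarrow> scl c x \<in> N"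
    using assms(3) by (auto simp: subspace_0 subspace_add subspace_neg subspace_scale)
  have add: "{x + y |x y. x \<in> ?co u \<and> y \<in> ?co v} = ?co (u + v)" for u v
  proof (intro equalityI subsetI)
    fix z assume "z \<in> {x + y |x y. x \<in> ?co u \<and> y \<in> ?co v}"
    then obtain m n where "m \<in> N" "n \<in> N" "z = (u + m) + (v + n)" by auto
    then have "z = (u + v) + (m + n)" "m + n \<in> N" by (auto simp: Nadd algebra_simps)
    then show "z \<in> ?co (u + v)" by blast
  next
    fix z assume "z \<in> ?co (u + v)"
    then obtain m where "m \<in> N" "z = (u + m) + (v + 0)" by (auto simp: algebra_simps)
    then show "z \<in> {x + y |x y. x \<in> ?co u \<and> y \<in> ?co v}" using N0 by blast
  qed
  have smul: "{scl c x + y |x y. x \<in> ?co u \<and> y \<in> N} = ?co (scl c u)" for c u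
  proof (intro equalityI subsetI)
    fix z assume "z \<in> {scl c x + y |x y. x \<in> ?co u \<and> y \<in> N}"
    then obtain m n where "m \<in> N" "n \<in> N" "z = scl c (u + m) + n" by auto
    then have "z = scl c u + (scl c m + n)" "scl c m + n \<in> N"
      by (auto simp: Nadd Nscl scale_right_distrib algebra_simps)
    then show "z \<in> ?co (scl c u)" by blast
  next
    fix z assume "z \<in> ?co (scl c u)"
    then obtain m where "m \<in> N" "z = scl c (u + 0) + m" by auto
    then show "z \<in> {scl c x + y |x y. x \<in> ?co u \<and> y \<in> N}" using N0 by blast
  qed
  define co where "co u = (+) u ` N" for u
  let ?Q = "quotient_space scl U N"
  have car: "carrier ?Q = co ` U" and zero: "\<zero>\<^bsub>?Q\<^esub> = co 0"
    and addQ: "\<And>u v. co u \<oplus>\<^bsub>?Q\<^esub> co v = co (u + v)"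
    and smulQ: "\<And>c u. c \<odot>\<^bsub>?Q\<^esub> co u = co (scl c u)"
    unfolding co_def using add smul by (simp_all add: quotient_space_def)
  note sub = assms(2)
  note U = subspace_0[OF sub] subspace_add[OF sub] subspace_neg[OF sub] subspace_scale[OF sub]
  show ?thesis
  proof (rule moduleI)
    show "cring complex_ring"
      by (rule cringI[OF abelian_groupI comm_monoidI])
        (auto simp: complex_ring_def algebra_simps intro: exI[of _ "- x" for x])
    show "abelian_group ?Q"
    proof (rule abelian_groupI)
      fix X assume "X \<in> carrier ?Q"
      then obtain u where u: "u \<in> U" "X = co u" by (auto simp: car)
      then have "co (- u) \<oplus>\<^bsub>?Q\<^esub> X = \<zero>\<^bsub>?Q\<^esub>" "co (- u) \<in> carrier ?Q"
        using U by (auto simp: addQ zero car)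
      then show "\<exists>Y\<in>carrier ?Q. Y \<oplus>\<^bsub>?Q\<^esub> X = \<zero>\<^bsub>?Q\<^esub>" by blast
    qed (auto simp: car zero addQ add_ac U)
  qed (auto simp: car addQ smulQ complex_ring_def scale_right_distrib scale_left_distrib U)
qed

definition is_finite_basis :: "(complex, 'a) module \<Rightarrow> 'a set \<Rightarrow> bool" where
  "is_finite_basis M B \<longleftrightarrow>
    finite B \<and> B \<subseteq> carrier M \<and>
    (\<forall>x\<in>carrier M. \<exists>!c. c \<in> B \<rightarrow>\<^sub>E UNIV \<and> x = (\<Oplus>\<^bsub>M\<^esub>b\<in>B. c b \<odot>\<^bsub>M\<^esub> b))"

text \<open>As for the library function \<open>dim\<close>, the value is 0 if there is no finite basis.\<close>

definition vs_dim :: "(complex, 'a) module \<Rightarrow> nat" where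
  "vs_dim M = (if \<exists>B. is_finite_basis M B then card (SOME B. is_finite_basis M B) else 0)"


section \<open>Polynomials\<close>

type_synonym 'v cpoly = "('v \<Rightarrow>\<^sub>0 nat) \<Rightarrow>\<^sub>0 complex"

definition cscale :: "complex \<Rightarrow> 'v cpoly \<Rightarrow> 'v cpoly" where
  "cscale c p = Poly_Mapping.single 0 c * p"

definition Var :: "'v \<Rightarrow> 'v cpoly" where
  "Var v = Poly_Mapping.single (Poly_Mapping.single v 1) 1"

definition pderivative :: "'v \<Rightarrow> 'v cpoly \<Rightarrow> 'v cpoly" where
  "pderivative v p =
    (\<Sum>m\<in>Poly_Mapping.keys p.
       Poly_Mapping.single (m - Poly_Mapping.single v 1)
         (of_nat (Poly_Mapping.lookup m v) * Poly_Mapping.lookup p m))"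

definition poly_subst :: "('v \<Rightarrow> 'w cpoly) \<Rightarrow> 'v cpoly \<Rightarrow> 'w cpoly" where
  "poly_subst \<sigma> p =
    (\<Sum>m\<in>Poly_Mapping.keys p.
       cscale (Poly_Mapping.lookup p m)
         (\<Prod>v\<in>Poly_Mapping.keys m. \<sigma> v ^ Poly_Mapping.lookup m v))"

interpretation cpoly: vector_space "cscale :: complex \<Rightarrow> 'v cpoly \<Rightarrow> 'v cpoly"
  by unfold_locales
    (simp_all add: cscale_def distrib_left distrib_right mult_single single_add
      mult.assoc[symmetric])


section \<open>Weyl groups of rank two\<close>

datatype rank2_type = A2 | B2 | G2

definition cartan_matrix :: "rank2_type \<Rightarrow> int^2^2" where
  "cartan_matrix X =
    (case X of
       A2 \<Rightarrow> vector [vector [2, -1], vector [-1, 2]]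
     | B2 \<Rightarrow> vector [vector [2, -2], vector [-1, 2]]
     | G2 \<Rightarrow> vector [vector [2, -1], vector [-3, 2]])"

text \<open>The dual of \<open>\<complex>\<^sup>n\<close> is identified with \<open>\<complex>\<^sup>n\<close> through the following bilinear pairing
  (the library inner product on \<open>\<complex>\<^sup>n\<close> is real-valued and not \<open>\<complex>\<close>-bilinear).\<close>

definition pairing :: "complex^'n \<Rightarrow> complex^'n \<Rightarrow> complex" where
  "pairing \<xi> v = (\<Sum>i\<in>UNIV. \<xi> $ i * v $ i)"

text \<open>\<open>\<alpha> j\<close> are the simple roots (linear forms on the Cartan subalgebra) and
  \<open>\<alpha>v i\<close> the simple coroots (vectors in it).\<close>

definition realizes_cartan :: "rank2_type \<Rightarrow> (2 \<Rightarrow> complex^2) \<Rightarrow> (2 \<Rightarrow> complex^2) \<Rightarrow> bool" where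
  "realizes_cartan X \<alpha> \<alpha>v \<longleftrightarrow>
    (\<forall>i j. pairing (\<alpha> j) (\<alpha>v i) = of_int (cartan_matrix X $ i $ j))"

text \<open>The matrix of \<open>u \<mapsto> u - \<langle>\<xi>, u\<rangle> v\<close>.\<close>

definition reflection :: "complex^'n \<Rightarrow> complex^'n \<Rightarrow> complex^'n^'n" where
  "reflection \<xi> v = (\<chi> i j. (if i = j then 1 else 0) - v $ i * \<xi> $ j)"

lemma reflection_mult_vec: "reflection \<xi> v *v u = u - pairing \<xi> u *s v"
proof -
  have "(\<Sum>j\<in>UNIV. ((if i = j then 1 else 0) - v $ i * \<xi> $ j) * u $ j) =
      (\<Sum>j\<in>UNIV. if i = j then u $ j else 0) - (\<Sum>j\<in>UNIV. \<xi> $ j * u $ j) * v $ i" for i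
    unfolding sum_distrib_right sum_subtractf[symmetric]
    by (rule sum.cong) (auto simp: algebra_simps)
  then show ?thesis
    by (simp add: reflection_def pairing_def matrix_vector_mult_def vec_eq_iff)
qed

lemma reflection_involution:
  assumes "pairing \<xi> v = 2"
  shows "reflection \<xi> v ** reflection \<xi> v = mat 1"
proof -
  have "pairing \<xi> (u - c *s v) = pairing \<xi> u - c * pairing \<xi> v" for u c
    by (simp add: pairing_def right_diff_distrib sum_subtractf sum_distrib_left
        mult.left_commute)
  then have "pairing \<xi> (u - pairing \<xi> u *s v) = - pairing \<xi> u" for u
    using assms by simp
  then show ?thesis
    by (simp add: matrix_eq reflection_mult_vec flip: matrix_vector_mul_assoc)
qed

text \<open>Simple reflections are involutions, so the submonoid they generate is a group.\<close>

inductive_set weyl_group :: "(2 \<Rightarrow> complex^2) \<Rightarrow> (2 \<Rightarrow> complex^2) \<Rightarrow> (complex^2^2) set"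
  for \<alpha> \<alpha>v where
  one: "mat 1 \<in> weyl_group \<alpha> \<alpha>v"
| refl: "w \<in> weyl_group \<alpha> \<alpha>v \<Longrightarrow> reflection (\<alpha> i) (\<alpha>v i) ** w \<in> weyl_group \<alpha> \<alpha>v"


section \<open>The Poisson algebra \<open>\<complex>[\<hh> \<oplus> \<hh>\<^sup>*]\<close>\<close>

text \<open>With \<open>\<hh> = \<complex>\<^sup>n\<close>, the variables \<open>Inl i\<close> are the coordinates on \<open>\<hh>\<close> and \<open>Inr i\<close> the dual
  coordinates on \<open>\<hh>\<^sup>*\<close>.\<close>

definition poisson_bracket ::
  "('n::finite + 'n) cpoly \<Rightarrow> ('n + 'n) cpoly \<Rightarrow> ('n + 'n) cpoly" where
  "poisson_bracket f g =
    (\<Sum>i\<in>UNIV. pderivative (Inl i) f * pderivative (Inr i) g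
             - pderivative (Inr i) f * pderivative (Inl i) g)"

text \<open>\<open>(g \<cdot> f)(v, \<xi>) = f (g\<^sup>-\<^sup>1 v, \<xi> \<circ> g)\<close>.\<close>

definition act_double :: "complex^'n^'n \<Rightarrow> ('n::finite + 'n) cpoly \<Rightarrow> ('n + 'n) cpoly" where
  "act_double g =
    poly_subst (case_sum
      (\<lambda>i. \<Sum>j\<in>UNIV. cscale (matrix_inv g $ i $ j) (Var (Inl j)))
      (\<lambda>i. \<Sum>j\<in>UNIV. cscale (g $ j $ i) (Var (Inr j))))"

definition invariant_polys :: "(complex^'n^'n) set \<Rightarrow> ('n::finite + 'n) cpoly set" where
  "invariant_polys W = {f. \<forall>g\<in>W. act_double g f = f}"

definition HP0 :: "(complex^'n^'n) set \<Rightarrow> (complex, ('n::finite + 'n) cpoly set) module" where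
  "HP0 W =
    quotient_space cscale (invariant_polys W)
      (cpoly.span
        {poisson_bracket f g | f g. f \<in> invariant_polys W \<and> g \<in> invariant_polys W})"


section \<open>The Weyl algebra\<close>

type_synonym 'n pop = "'n cpoly \<Rightarrow> 'n cpoly"

text \<open>Polynomial differential operators on \<open>\<complex>\<^sup>n\<close>, with composition as multiplication.\<close>

inductive_set weyl_algebra :: "'n::finite pop set" where
  scalar: "cscale c \<in> weyl_algebra"
| coordinate: "(\<lambda>p. Var i * p) \<in> weyl_algebra"
| partial: "pderivative i \<in> weyl_algebra"
| sum: "D \<in> weyl_algebra \<Longrightarrow> E \<in> weyl_algebra \<Longrightarrow> (\<lambda>p. D p + E p) \<in> weyl_algebra"
| comp: "D \<in> weyl_algebra \<Longrightarrow> E \<in> weyl_algebra \<Longrightarrow> D \<circ> E \<in> weyl_algebra"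

definition op_scale :: "complex \<Rightarrow> 'n pop \<Rightarrow> 'n pop" where
  "op_scale c D = (\<lambda>p. cscale c (D p))"

text \<open>Operators are added pointwise; the pointwise product of \<open>Function_Algebras\<close> plays no role.\<close>

interpretation pop: vector_space "op_scale :: complex \<Rightarrow> 'n pop \<Rightarrow> 'n pop"
  by unfold_locales
    (simp_all add: op_scale_def fun_eq_iff cpoly.scale_right_distrib cpoly.scale_left_distrib)

text \<open>\<open>(g \<cdot> p)(v) = p (g\<^sup>-\<^sup>1 v)\<close>.\<close>

definition act_poly :: "complex^'n^'n \<Rightarrow> 'n::finite cpoly \<Rightarrow> 'n cpoly" where
  "act_poly g = poly_subst (\<lambda>i. \<Sum>j\<in>UNIV. cscale (matrix_inv g $ i $ j) (Var j))"

text \<open>Conjugation is the algebra automorphism extending the action on the generators: it sends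
  multiplication by a linear form \<open>\<xi>\<close> to multiplication by \<open>\<xi> \<circ> g\<^sup>-\<^sup>1\<close>, and the derivative
  along \<open>v\<close> to the derivative along \<open>g v\<close>.\<close>

definition act_op :: "complex^'n^'n \<Rightarrow> 'n::finite pop \<Rightarrow> 'n pop" where
  "act_op g D = act_poly g \<circ> D \<circ> act_poly (matrix_inv g)"

definition invariant_ops :: "(complex^'n^'n) set \<Rightarrow> 'n::finite pop set" where
  "invariant_ops W = {D \<in> weyl_algebra. \<forall>g\<in>W. act_op g D = D}"

definition HH0 :: "(complex^'n^'n) set \<Rightarrow> (complex, 'n::finite pop set) module" where
  "HH0 W =
    quotient_space op_scale (invariant_ops W)
      (pop.span
        {(\<lambda>p. D (E p) - E (D p)) | D E. D \<in> invariant_ops W \<and> E \<in> invariant_ops W})"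

end

theory Submission
  imports Defs
begin

text \<open>In suitable linear coordinates \<open>z, w\<close> of \<open>\<hh>\<close>, with dual coordinates \<open>p, q\<close>, the group \<open>W\<close> is
  the dihedral group of order \<open>2 m\<close>, \<open>m = 3, 4, 6\<close>, generated by the exchange of \<open>z\<close> and \<open>w\<close> and by
  \<open>z \<mapsto> \<zeta> z, w \<mapsto> \<zeta>\<^sup>-\<^sup>1 w\<close>. The invariants \<open>z w, z p + w q, p q\<close> span a copy of \<open>sl\<^sub>2\<close>, and brackets
  with them reduce every invariant to a combination of \<open>e\<^sub>k = (z p)\<^sup>k + (w q)\<^sup>k\<close> with \<open>k\<close> even. As
  \<open>{z\<^sup>m + w\<^sup>m, (z p)\<^sup>j p\<^sup>m + (w q)\<^sup>j q\<^sup>m}\<close> is a nonzero multiple of \<open>e\<close> with index \<open>j + m - 1\<close>, only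
  the \<open>e\<^sub>k\<close> with \<open>k < m - 1\<close> are needed: one, two or three of them. All this respects
  degrees, so that normal ordering, which turns commutators into Poisson brackets up to terms of lower
  degree, carries the spanning set over to the Weyl algebra. There the \<open>e\<^sub>k\<close> are independent modulo
  commutators, because the traces twisted by the nontrivial rotations separate them; and a homogeneous
  relation modulo Poisson brackets would give a relation modulo commutators.\<close>

section \<open>Codimension\<close>

text \<open>The grouping behind the computation is \<open>z, q\<close> against \<open>w, p\<close>.
  Bracketing with that sl2 acts on each pair as on the standard plane, and a rotation multiplies the
  first pair by a root of unity and the second by its inverse. So the sl2 preserves the degrees in
  the two pairs, and these degrees alone decide invariance under rotations. By Clebsch-Gordan the
  tensor product of two symmetric powers of the plane has no sl2-coinvariants unless the powers
  agree, and then a line of them, spanned by the class of \<open>(z p)^k\<close>. Exchanging the two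
  factors multiplies that class by (-1)^k, which is why only even k survive symmetrization. The
  upper and lower bounds meet because floor(m / 2) counts both the even k < m - 1 and the nontrivial
  rotations up to inversion. The obstacle is that each quotient lacks one tool: a grading is at hand
  only on the Poisson side, traces only on the side of the Weyl algebra. So each side borrows one of
  its two bounds from the other.\<close>

definition has_codim :: "(complex \<Rightarrow> 'a \<Rightarrow> 'a) \<Rightarrow> 'a::ab_group_add set \<Rightarrow> 'a set \<Rightarrow> nat \<Rightarrow> bool" where
  "has_codim scl U N k \<longleftrightarrow>
    (\<exists>B. finite B \<and> card B = k \<and> B \<subseteq> U \<and> U \<subseteq> module.span scl (N \<union> B) \<and>
      (\<forall>c. (\<Sum>b\<in>B. scl (c b) b) \<in> N \<longrightarrow> (\<forall>b\<in>B. c b = 0)))"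

section \<open>Linear algebra modulo a subspace\<close>

context vector_space
begin

text \<open>Steinitz exchange modulo \<open>N\<close>, which may have infinite dimension. Only
  finitely many elements of \<open>N\<close> enter when \<open>B\<close> is expressed through
  \<open>N\<close> and \<open>B'\<close>. A basis \<open>C\<close> of their span is independent
  together with \<open>B\<close>, and the exchange lemma for \<open>C \<union> B\<close> inside the
  span of \<open>C \<union> B'\<close> gives the claim after cancelling
  \<open>card C\<close>.\<close>

lemma card_le_if_independent_mod:
  assumes N: "subspace N" and fin: "finite B" "finite B'"
    and ind: "\<And>c. (\<Sum>b\<in>B. scale (c b) b) \<in> N \<Longrightarrow> \<forall>b\<in>B. c b = 0"
    and span: "B \<subseteq> span (N \<union> B')"
  shows "card B \<le> card B'"
proof -
  have "\<exists>t. finite t \<and> t \<subseteq> N \<union> B' \<and> b \<in> span t" if b: "b \<in> B" for b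
  proof -
    have "b \<in> span (N \<union> B')" using b span by blast
    then obtain t r where t: "finite t" "t \<subseteq> N \<union> B'" "b = (\<Sum>a\<in>t. scale (r a) a)"
      by (auto simp: span_explicit)
    have "(\<Sum>a\<in>t. scale (r a) a) \<in> span t"
      by (intro span_sum span_scale span_base)
    then show ?thesis using t by blast
  qed
  then obtain t where t: "\<And>b. b \<in> B \<Longrightarrow> finite (t b) \<and> t b \<subseteq> N \<union> B' \<and> b \<in> span (t b)"
    by metis
  define F where "F = (\<Union>b\<in>B. t b) \<inter> N"
  have F: "finite F" "F \<subseteq> N" using fin t by (auto simp: F_def)
  obtain C where C: "C \<subseteq> F" "independent C" "F \<subseteq> span C"
    using maximal_independent_subset by metis
  have finC: "finite C" using C F finite_subset by blast
  have CN: "C \<subseteq> N" using C F by blast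
  have "t b \<subseteq> span (C \<union> B')" if "b \<in> B" for b
  proof
    fix x assume x: "x \<in> t b"
    show "x \<in> span (C \<union> B')"
    proof (cases "x \<in> N")
      case True
      then have "x \<in> span C" using x that C by (auto simp: F_def)
      then show ?thesis by (meson Un_upper1 span_mono subsetD)
    next
      case False
      then show ?thesis using x t[OF that] by (auto intro: span_base)
    qed
  qed
  then have "span (t b) \<subseteq> span (C \<union> B')" if "b \<in> B" for b
    using that by (simp add: span_minimal)
  then have sub: "C \<union> B \<subseteq> span (C \<union> B')"
    using t by (auto intro: span_base)
  have disj: "C \<inter> B = {}"
  proof (rule ccontr)
    assume "C \<inter> B \<noteq> {}"
    then obtain b where b: "b \<in> B" "b \<in> N" using CN by blast
    have "(\<Sum>x\<in>B. scale (if x = b then 1 else 0) x) = (\<Sum>x\<in>B. if x = b then x else 0)"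
      by (rule sum.cong) auto
    also have "\<dots> = b" using b fin by simp
    finally show False using ind[of "\<lambda>x. if x = b then 1 else 0"] b by auto
  qed
  have "independent (C \<union> B)"
  proof (rule independent_if_scalars_zero)
    fix f x assume f: "(\<Sum>x\<in>C \<union> B. scale (f x) x) = 0" and x: "x \<in> C \<union> B"
    have 0: "(\<Sum>x\<in>C. scale (f x) x) + (\<Sum>x\<in>B. scale (f x) x) = 0"
      using f by (simp add: sum.union_disjoint finC fin disj)
    have "(\<Sum>x\<in>C. scale (f x) x) \<in> N"
      using CN N by (intro subspace_sum subspace_scale) auto
    moreover have "(\<Sum>x\<in>B. scale (f x) x) = - (\<Sum>x\<in>C. scale (f x) x)"
      using 0 by (simp add: eq_neg_iff_add_eq_0 add.commute)
    ultimately have fB: "\<forall>b\<in>B. f b = 0"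
      using ind N subspace_neg by metis
    then have "(\<Sum>x\<in>C. scale (f x) x) = 0" using 0 by simp
    then have "\<forall>b\<in>C. f b = 0"
      using C(2) finC independentD by blast
    then show "f x = 0" using fB x by blast
  qed (use finC fin in auto)
  then have "card (C \<union> B) \<le> card (C \<union> B')"
    using independent_span_bound[OF _ _ sub] finC fin by blast
  also have "\<dots> \<le> card C + card B'" by (rule card_Un_le)
  finally show ?thesis by (simp add: card_Un_disjoint finC fin disj)
qed

lemma span_Un_subspace_finite:
  assumes "subspace N" "finite B"
  shows "x \<in> span (N \<union> B) \<longleftrightarrow> (\<exists>c. x - (\<Sum>b\<in>B. scale (c b) b) \<in> N)"
proof -
  have N: "span N = N" using assms(1) by (simp add: span_eq_iff)
  show ?thesis
    unfolding span_Un N span_finite[OF assms(2)]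
    by (auto simp: image_iff intro: exI[of _ "x - y" for y])
      (metis add.commute add_diff_cancel_left' diff_add_cancel)+
qed

text \<open>Coefficients are indexed by \<open>K\<close> and not by its image, so that no
  injectivity of \<open>e\<close> has to be known when a relation among the \<open>e k\<close> is
  written down.\<close>

lemma ex_coefficients_if_in_span_Un:
  assumes N: "subspace N" and K: "finite K" and x: "x \<in> span (N \<union> e ` K)"
  shows "\<exists>c. x - (\<Sum>k\<in>K. scale (c k) (e k)) \<in> N"
proof -
  let ?V = "{x. \<exists>c. x - (\<Sum>k\<in>K. scale (c k) (e k)) \<in> N}"
  have "subspace ?V"
  proof (rule subspaceI; clarsimp)
    have "0 - (\<Sum>k\<in>K. scale 0 (e k)) \<in> N" using subspace_0[OF N] by simp
    then show "\<exists>c. - (\<Sum>k\<in>K. scale (c k) (e k)) \<in> N"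
      by (intro exI[of _ "\<lambda>_. 0"]) simp
  next
    fix x y c d
    assume "x - (\<Sum>k\<in>K. scale (c k) (e k)) \<in> N" "y - (\<Sum>k\<in>K. scale (d k) (e k)) \<in> N"
    from subspace_add[OF N this]
    have "x + y - (\<Sum>k\<in>K. scale (c k + d k) (e k)) \<in> N"
      by (simp add: scale_left_distrib sum.distrib algebra_simps)
    then show "\<exists>c. x + y - (\<Sum>k\<in>K. scale (c k) (e k)) \<in> N"
      by (intro exI[of _ "\<lambda>k. c k + d k"])
  next
    fix a x c
    assume "x - (\<Sum>k\<in>K. scale (c k) (e k)) \<in> N"
    from subspace_scale[OF N this, of a]
    have "scale a x - (\<Sum>k\<in>K. scale (a * c k) (e k)) \<in> N"
      by (simp add: scale_right_diff_distrib scale_sum_right)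
    then show "\<exists>c. scale a x - (\<Sum>k\<in>K. scale (c k) (e k)) \<in> N"
      by (intro exI[of _ "\<lambda>k. a * c k"])
  qed
  moreover have "n \<in> ?V" if "n \<in> N" for n
    using that by (intro CollectI exI[of _ "\<lambda>_. 0"]) simp
  moreover have "e k \<in> ?V" if "k \<in> K" for k
  proof -
    have "(\<Sum>l\<in>K. scale (if l = k then 1 else 0) (e l)) = (\<Sum>l\<in>K. if l = k then e l else 0)"
      by (rule sum.cong) auto
    also have "\<dots> = e k" using that K by simp
    finally have "e k - (\<Sum>l\<in>K. scale (if l = k then 1 else 0) (e l)) \<in> N"
      using subspace_0[OF N] by simp
    then show ?thesis by (intro CollectI exI[of _ "\<lambda>l. if l = k then 1 else 0"])
  qed
  ultimately have "span (N \<union> e ` K) \<subseteq> ?V" by (intro span_minimal) auto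
  then show ?thesis using x by blast
qed

end

section \<open>The dimension of a quotient, computed on representatives\<close>

lemma add_quotient_space:
  assumes "vector_space scl" "module.subspace scl N"
  shows "(+) u ` N \<oplus>\<^bsub>quotient_space scl U N\<^esub> (+) v ` N = (+) (u + v) ` N"
proof -
  interpret vector_space scl by fact
  show ?thesis
  proof (intro equalityI subsetI)
    fix z assume "z \<in> (+) u ` N \<oplus>\<^bsub>quotient_space scl U N\<^esub> (+) v ` N"
    then obtain m n where "m \<in> N" "n \<in> N" "z = (u + m) + (v + n)"
      by (auto simp: quotient_space_def)
    then have "z = (u + v) + (m + n)" "m + n \<in> N"
      using assms(2) by (auto simp: subspace_add algebra_simps)
    then show "z \<in> (+) (u + v) ` N" by blast
  next
    fix z assume "z \<in> (+) (u + v) ` N"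
    then obtain m where "m \<in> N" "z = (u + m) + (v + 0)" by (auto simp: algebra_simps)
    moreover have "v + 0 \<in> (+) v ` N" using subspace_0[OF assms(2)] by blast
    moreover have "u + m \<in> (+) u ` N" using \<open>m \<in> N\<close> by blast
    ultimately have "\<exists>x y. z = x + y \<and> x \<in> (+) u ` N \<and> y \<in> (+) v ` N"
      by (intro exI[of _ "u + m"] exI[of _ "v + 0"] conjI)
    then show "z \<in> (+) u ` N \<oplus>\<^bsub>quotient_space scl U N\<^esub> (+) v ` N"
      by (simp add: quotient_space_def)
  qed
qed

lemma smult_quotient_space:
  assumes "vector_space scl" "module.subspace scl N"
  shows "c \<odot>\<^bsub>quotient_space scl U N\<^esub> (+) u ` N = (+) (scl c u) ` N"
proof -
  interpret vector_space scl by fact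
  show ?thesis
  proof (intro equalityI subsetI)
    fix z assume "z \<in> c \<odot>\<^bsub>quotient_space scl U N\<^esub> (+) u ` N"
    then obtain m n where "m \<in> N" "n \<in> N" "z = scl c (u + m) + n"
      by (auto simp: quotient_space_def)
    then have "z = scl c u + (scl c m + n)" "scl c m + n \<in> N"
      using assms(2) by (auto simp: subspace_add subspace_scale scale_right_distrib algebra_simps)
    then show "z \<in> (+) (scl c u) ` N" by blast
  next
    fix z assume "z \<in> (+) (scl c u) ` N"
    then obtain m where m: "m \<in> N" "z = scl c (u + 0) + m" by auto
    moreover have "u + 0 \<in> (+) u ` N" using subspace_0[OF assms(2)] by blast
    ultimately have "\<exists>x y. z = scl c x + y \<and> x \<in> (+) u ` N \<and> y \<in> N"
      by (intro exI[of _ "u + 0"] exI[of _ m] conjI)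
    then show "z \<in> c \<odot>\<^bsub>quotient_space scl U N\<^esub> (+) u ` N"
      by (simp add: quotient_space_def)
  qed
qed

lemma vs_dim_quotient_space:
  assumes vs: "vector_space scl" and U: "module.subspace scl U" and N: "module.subspace scl N"
    and NU: "N \<subseteq> U" and codim: "has_codim scl U N k"
  shows "vs_dim (quotient_space scl U N) = k"
proof -
  interpret vector_space scl by fact
  define M where "M = quotient_space scl U N"
  define co where "co u = (+) u ` N" for u
  interpret M: Module.module complex_ring M
    unfolding M_def by (rule module_quotient_space[OF vs U N NU])
  have car: "carrier M = co ` U" and zero: "\<zero>\<^bsub>M\<^esub> = co 0"
    by (auto simp: M_def co_def quotient_space_def)
  have add: "co u \<oplus>\<^bsub>M\<^esub> co v = co (u + v)" and smul: "c \<odot>\<^bsub>M\<^esub> co u = co (scl c u)" for u v c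
    unfolding M_def co_def by (simp_all only: add_quotient_space[OF vs N] smult_quotient_space[OF vs N])
  have co_eq: "co u = co v \<longleftrightarrow> u - v \<in> N" for u v
  proof
    assume "co u = co v"
    moreover have "u + 0 \<in> co u" unfolding co_def using subspace_0[OF N] by blast
    ultimately show "u - v \<in> N" by (auto simp: co_def)
  next
    assume uv: "u - v \<in> N"
    show "co u = co v"
    proof (intro equalityI subsetI)
      fix z assume "z \<in> co u"
      then have "z - v \<in> N" using uv subspace_add[OF N, of "u - v" "z - u"] by (auto simp: co_def)
      then have "z = v + (z - v)" "z - v \<in> N" by auto
      then show "z \<in> co v" unfolding co_def by blast
    next
      fix z assume "z \<in> co v"
      then have "z - u \<in> N" using uv subspace_diff[OF N, of "z - v" "u - v"] by (auto simp: co_def)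
      then have "z = u + (z - u)" "z - u \<in> N" by auto
      then show "z \<in> co u" unfolding co_def by blast
    qed
  qed
  \<comment> \<open>Sums in the quotient are computed on representatives \<open>r\<close>. This
    turns being a basis of cosets into a statement about \<open>U\<close> and \<open>N\<close>
    alone.\<close>
  have finsum: "(\<Oplus>\<^bsub>M\<^esub>X\<in>A. c X \<odot>\<^bsub>M\<^esub> X) = co (\<Sum>X\<in>A. scl (c X) (r X))"
    if "finite A" "\<And>X. X \<in> A \<Longrightarrow> r X \<in> U \<and> X = co (r X)" for A c r
    using that
  proof (induction A rule: finite_induct)
    case empty
    then show ?case by (simp add: zero)
  next
    case (insert X A)
    have mem: "c Y \<odot>\<^bsub>M\<^esub> Y = co (scl (c Y) (r Y))" "co (scl (c Y) (r Y)) \<in> carrier M"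
      if "Y \<in> insert X A" for Y
    proof -
      show "c Y \<odot>\<^bsub>M\<^esub> Y = co (scl (c Y) (r Y))"
        using insert.prems[OF that] smul[of "c Y" "r Y"] by simp
      show "co (scl (c Y) (r Y)) \<in> carrier M"
        using insert.prems[OF that] subspace_scale[OF U] by (auto simp: car)
    qed
    have "(\<Oplus>\<^bsub>M\<^esub>Y\<in>insert X A. c Y \<odot>\<^bsub>M\<^esub> Y) = c X \<odot>\<^bsub>M\<^esub> X \<oplus>\<^bsub>M\<^esub> (\<Oplus>\<^bsub>M\<^esub>Y\<in>A. c Y \<odot>\<^bsub>M\<^esub> Y)"
      using insert.hyps mem by (intro M.finsum_insert) auto
    also have "\<dots> = co (scl (c X) (r X)) \<oplus>\<^bsub>M\<^esub> co (\<Sum>Y\<in>A. scl (c Y) (r Y))"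
      using insert.IH insert.prems mem by simp
    finally show ?case using insert.hyps by (simp add: add)
  qed
  have basis_iff: "is_finite_basis M A \<longleftrightarrow>
      (\<forall>u\<in>U. \<exists>!c. c \<in> A \<rightarrow>\<^sub>E UNIV \<and> u - (\<Sum>X\<in>A. scl (c X) (r X)) \<in> N)"
    if A: "finite A" "\<And>X. X \<in> A \<Longrightarrow> r X \<in> U \<and> X = co (r X)" for A r
  proof -
    have "A \<subseteq> carrier M" using A(2) unfolding car by blast
    then have "is_finite_basis M A \<longleftrightarrow>
      (\<forall>u\<in>U. \<exists>!c. c \<in> A \<rightarrow>\<^sub>E UNIV \<and> co u = (\<Oplus>\<^bsub>M\<^esub>X\<in>A. c X \<odot>\<^bsub>M\<^esub> X))"
      using A(1) by (simp add: is_finite_basis_def car)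
    then show ?thesis by (simp add: finsum[OF A] co_eq)
  qed
  from codim obtain B where B: "finite B" "card B = k" "B \<subseteq> U" "U \<subseteq> span (N \<union> B)"
    and ind: "\<And>c. (\<Sum>b\<in>B. scl (c b) b) \<in> N \<Longrightarrow> \<forall>b\<in>B. c b = 0"
    unfolding has_codim_def by blast
  \<comment> \<open>\<open>vs_dim\<close> picks an arbitrary finite basis, so the cardinality is
    needed for all of them and not only for the image of \<open>B\<close>.\<close>
  have card: "card A = k" if A: "is_finite_basis M A" for A
  proof -
    have fin: "finite A" and sub: "A \<subseteq> carrier M" using A by (auto simp: is_finite_basis_def)
    then have "\<forall>X\<in>A. \<exists>u. u \<in> U \<and> X = co u" by (auto simp: car)
    then obtain r where r: "\<And>X. X \<in> A \<Longrightarrow> r X \<in> U \<and> X = co (r X)" by metis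
    have inj: "inj_on r A" by (metis inj_onI r)
    have ex1: "\<exists>!c. c \<in> A \<rightarrow>\<^sub>E UNIV \<and> u - (\<Sum>X\<in>A. scl (c X) (r X)) \<in> N" if "u \<in> U" for u
      using A basis_iff[OF fin r] that by blast
    have span: "U \<subseteq> span (N \<union> r ` A)"
    proof
      fix u assume "u \<in> U"
      then obtain c where c: "u - (\<Sum>X\<in>A. scl (c X) (r X)) \<in> N" using ex1 by blast
      have "(\<Sum>X\<in>A. scl (c X) (r X)) \<in> span (N \<union> r ` A)"
        by (intro span_sum span_scale span_base) simp
      moreover have "u - (\<Sum>X\<in>A. scl (c X) (r X)) \<in> span (N \<union> r ` A)"
        using c by (auto intro: span_base)
      ultimately have "(\<Sum>X\<in>A. scl (c X) (r X)) + (u - (\<Sum>X\<in>A. scl (c X) (r X))) \<in> span (N \<union> r ` A)"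
        by (rule span_add)
      then show "u \<in> span (N \<union> r ` A)" by simp
    qed
    have indA: "\<forall>b\<in>r ` A. c b = 0" if c: "(\<Sum>b\<in>r ` A. scl (c b) b) \<in> N" for c
    proof -
      \<comment> \<open>Coordinates of 0 are unique, and both the negated relation and the zero
        family are coordinates of 0. The restrictions make them extensional, as
        \<open>is_finite_basis\<close> demands.\<close>
      let ?c = "\<lambda>X\<in>A. - c (r X)" and ?z = "\<lambda>X\<in>A. (0::complex)"
      have "(\<Sum>X\<in>A. scl (c (r X)) (r X)) \<in> N"
        using c by (simp add: sum.reindex[OF inj])
      moreover have "(\<Sum>X\<in>A. scl (?c X) (r X)) = - (\<Sum>X\<in>A. scl (c (r X)) (r X))"
        by (simp add: sum_negf)
      ultimately have "0 - (\<Sum>X\<in>A. scl (?c X) (r X)) \<in> N" by simp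
      moreover have "0 - (\<Sum>X\<in>A. scl (?z X) (r X)) \<in> N"
        using subspace_0[OF N] by simp
      moreover have "?c \<in> A \<rightarrow>\<^sub>E UNIV" "?z \<in> A \<rightarrow>\<^sub>E UNIV" by auto
      ultimately have "?c = ?z" using ex1[OF subspace_0[OF U]] by blast
      then have "- c (r X) = 0" if "X \<in> A" for X using that by (metis restrict_apply')
      then show ?thesis by auto
    qed
    have "card B \<le> card (r ` A)"
      using card_le_if_independent_mod[OF N B(1) finite_imageI[OF fin] ind] span B(3) by blast
    moreover have "card (r ` A) \<le> card B"
      using card_le_if_independent_mod[OF N finite_imageI[OF fin] B(1) indA] r B(4) by blast
    ultimately show ?thesis using card_image[OF inj] B(2) by simp
  qed
  have "is_finite_basis M (co ` B)"
  proof -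
    have inj: "inj_on co B"
    proof (rule inj_onI, rule ccontr)
      fix x y assume xy: "x \<in> B" "y \<in> B" "co x = co y" "x \<noteq> y"
      let ?c = "\<lambda>b. if b = x then 1 else if b = y then - 1 else (0::complex)"
      have "(\<Sum>b\<in>B. scl (?c b) b) = (\<Sum>b\<in>{x, y}. scl (?c b) b)"
        using xy B(1) by (intro sum.mono_neutral_right) auto
      also have "\<dots> = x - y" using xy(4) by simp
      finally have "(\<Sum>b\<in>B. scl (?c b) b) \<in> N" using xy(3) co_eq by simp
      from ind[OF this] show False using xy(1) by auto
    qed
    define r where "r = the_inv_into B co"
    have r: "r X \<in> U \<and> X = co (r X)" if "X \<in> co ` B" for X
      using that B(3) inj by (auto simp: r_def the_inv_into_f_f)
    have r_co: "r (co b) = b" if "b \<in> B" for b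
      using that inj by (simp add: r_def the_inv_into_f_f)
    have sum_r: "(\<Sum>X\<in>co ` B. scl (c X) (r X)) = (\<Sum>b\<in>B. scl (c (co b)) b)" for c
      by (simp add: sum.reindex[OF inj] r_co)
    have "\<forall>u\<in>U. \<exists>!c. c \<in> co ` B \<rightarrow>\<^sub>E UNIV \<and> u - (\<Sum>X\<in>co ` B. scl (c X) (r X)) \<in> N"
    proof
      fix u assume u: "u \<in> U"
      then obtain c where c: "u - (\<Sum>b\<in>B. scl (c b) b) \<in> N"
        using B(4) span_Un_subspace_finite[OF N B(1)] by blast
      show "\<exists>!c. c \<in> co ` B \<rightarrow>\<^sub>E UNIV \<and> u - (\<Sum>X\<in>co ` B. scl (c X) (r X)) \<in> N"
      proof (rule ex_ex1I)
        have "(\<Sum>b\<in>B. scl (restrict (c \<circ> r) (co ` B) (co b)) b) = (\<Sum>b\<in>B. scl (c b) b)"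
          by (rule sum.cong) (auto simp: r_co)
        then show "\<exists>c. c \<in> co ` B \<rightarrow>\<^sub>E UNIV \<and> u - (\<Sum>X\<in>co ` B. scl (c X) (r X)) \<in> N"
          using c by (intro exI[of _ "restrict (c \<circ> r) (co ` B)"]) (auto simp: sum_r)
      next
        fix c d
        assume c: "c \<in> co ` B \<rightarrow>\<^sub>E UNIV \<and> u - (\<Sum>X\<in>co ` B. scl (c X) (r X)) \<in> N"
          and d: "d \<in> co ` B \<rightarrow>\<^sub>E UNIV \<and> u - (\<Sum>X\<in>co ` B. scl (d X) (r X)) \<in> N"
        have diff: "(u - (\<Sum>b\<in>B. scl (d (co b)) b)) - (u - (\<Sum>b\<in>B. scl (c (co b)) b)) \<in> N"
          by (rule subspace_diff[OF N]) (use c d in \<open>simp_all add: sum_r\<close>)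
        have "(\<Sum>b\<in>B. scl (c (co b) - d (co b)) b) \<in> N"
          using diff by (simp add: scale_left_diff_distrib sum_subtractf)
        then have "\<forall>b\<in>B. c (co b) = d (co b)" using ind[of "\<lambda>b. c (co b) - d (co b)"] by auto
        then show "c = d" by (intro PiE_ext[OF conjunct1[OF c] conjunct1[OF d]]) auto
      qed
    qed
    then show ?thesis using basis_iff[of "co ` B" r] B(1) r by simp
  qed
  then have "\<exists>A. is_finite_basis M A" by blast
  then show ?thesis
    using card[OF someI_ex] by (simp add: vs_dim_def M_def)
qed

text \<open>Independence over the indices already makes \<open>e\<close> injective: a coincidence
  \<open>e k = e l\<close> would be a relation with coefficients 1 and -1. Hence the codimension is
  the number of indices.\<close>

lemma has_codimI:
  assumes vs: "vector_space scl" and K: "finite K" and U: "e ` K \<subseteq> U"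
    and span: "U \<subseteq> module.span scl (N \<union> e ` K)" and 0: "0 \<in> N"
    and ind: "\<And>c. (\<Sum>k\<in>K. scl (c k) (e k)) \<in> N \<Longrightarrow> \<forall>k\<in>K. c k = 0"
  shows "has_codim scl U N (card K)"
proof -
  interpret vector_space scl by fact
  have inj: "inj_on e K"
  proof (rule inj_onI, rule ccontr)
    fix k l assume kl: "k \<in> K" "l \<in> K" "e k = e l" "k \<noteq> l"
    let ?c = "\<lambda>b. if b = k then 1 else if b = l then - 1 else (0::complex)"
    have "(\<Sum>b\<in>K. scl (?c b) (e b)) = (\<Sum>b\<in>{k, l}. scl (?c b) (e b))"
      using kl K by (intro sum.mono_neutral_right) auto
    also have "\<dots> = 0" using kl by simp
    finally have "(\<Sum>b\<in>K. scl (?c b) (e b)) \<in> N" using 0 by simp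
    from ind[OF this] show False using kl(1) by auto
  qed
  show ?thesis unfolding has_codim_def
  proof (intro exI[of _ "e ` K"] conjI allI impI)
    fix c assume "(\<Sum>b\<in>e ` K. scl (c b) b) \<in> N"
    then have "(\<Sum>k\<in>K. scl (c (e k)) (e k)) \<in> N" by (simp add: sum.reindex[OF inj])
    from ind[OF this] show "\<forall>b\<in>e ` K. c b = 0" by simp
  qed (use K U span in \<open>simp_all add: card_image[OF inj]\<close>)
qed

text \<open>Because \<open>has_codim\<close> speaks of representatives and not of cosets, it travels
  along injective linear maps. This serves both the change of coordinates and the passage from
  symbols to operators.\<close>

lemma has_codim_image:
  assumes "vector_space scl" "vector_space scl'"
    and lin: "Vector_Spaces.linear scl scl' \<Psi>" and inj: "inj \<Psi>" and codim: "has_codim scl U N k"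
  shows "has_codim scl' (\<Psi> ` U) (\<Psi> ` N) k"
proof -
  interpret a: vector_space scl by fact
  interpret b: vector_space scl' by fact
  interpret Vector_Spaces.linear scl scl' \<Psi> by fact
  from codim obtain B where B: "finite B" "card B = k" "B \<subseteq> U" "U \<subseteq> a.span (N \<union> B)"
    and ind: "\<And>c. (\<Sum>b\<in>B. scl (c b) b) \<in> N \<Longrightarrow> \<forall>b\<in>B. c b = 0"
    unfolding has_codim_def by blast
  have inj': "inj_on \<Psi> A" for A using inj by (rule inj_on_subset) simp
  show ?thesis unfolding has_codim_def
  proof (intro exI[of _ "\<Psi> ` B"] conjI allI impI)
    show "finite (\<Psi> ` B)" "\<Psi> ` B \<subseteq> \<Psi> ` U" using B by auto
    show "card (\<Psi> ` B) = k" using B(2) card_image[OF inj'] by simp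
    have "\<Psi> ` a.span (N \<union> B) = b.span (\<Psi> ` N \<union> \<Psi> ` B)"
      by (simp add: span_image[symmetric] image_Un)
    then show "\<Psi> ` U \<subseteq> b.span (\<Psi> ` N \<union> \<Psi> ` B)" using B(4) by auto
    fix c assume "(\<Sum>b\<in>\<Psi> ` B. scl' (c b) b) \<in> \<Psi> ` N"
    then have "\<Psi> (\<Sum>b\<in>B. scl (c (\<Psi> b)) b) \<in> \<Psi> ` N"
      by (simp add: sum.reindex[OF inj'] sum scale)
    then have "(\<Sum>b\<in>B. scl (c (\<Psi> b)) b) \<in> N"
      using inj by (simp add: inj_image_mem_iff)
    from ind[OF this] show "\<forall>b\<in>\<Psi> ` B. c b = 0" by simp
  qed
qed

section \<open>Polynomials\<close>

abbreviation mon :: "('v \<Rightarrow>\<^sub>0 nat) \<Rightarrow> 'v cpoly" where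
  "mon m \<equiv> Poly_Mapping.single m 1"

definition mdeg :: "('v::finite \<Rightarrow>\<^sub>0 nat) \<Rightarrow> nat" where
  "mdeg m = (\<Sum>v\<in>UNIV. Poly_Mapping.lookup m v)"

lemma mdeg_add: "mdeg (m + n) = mdeg m + mdeg n"
  by (simp add: mdeg_def lookup_add sum.distrib)

lemma mdeg_single: "mdeg (Poly_Mapping.single v k) = k"
  by (simp add: mdeg_def lookup_single when_def)

lemma mdeg_zero [simp]: "mdeg 0 = 0"
  by (simp add: mdeg_def)

lemma minus_single_add:
  fixes m :: "'v \<Rightarrow>\<^sub>0 nat"
  assumes "Poly_Mapping.lookup m v \<noteq> 0"
  shows "m - Poly_Mapping.single v 1 + Poly_Mapping.single v 1 = m"
  using assms by (intro poly_mapping_eqI) (auto simp: lookup_add lookup_minus lookup_single when_def)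

lemma exponent_induct [case_names zero add]:
  fixes m :: "'v::finite \<Rightarrow>\<^sub>0 nat"
  assumes zero: "P 0" and add: "\<And>m v. P m \<Longrightarrow> P (m + Poly_Mapping.single v 1)"
  shows "P m"
proof (induction "mdeg m" arbitrary: m rule: less_induct)
  case less
  show ?case
  proof (cases "m = 0")
    case False
    then obtain v where v: "Poly_Mapping.lookup m v \<noteq> 0"
      by (metis lookup_zero poly_mapping_eqI)
    define n where "n = m - Poly_Mapping.single v 1"
    have "m = n + Poly_Mapping.single v 1"
      using minus_single_add[OF v] by (simp add: n_def)
    moreover from this have "mdeg n < mdeg m"
      by (simp add: mdeg_add mdeg_single)
    ultimately show ?thesis using less add by metis
  qed (simp add: zero)
qed

lemma single_eq_cscale: "Poly_Mapping.single m c = cscale c (mon m)"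
  by (simp add: cscale_def mult_single)

lemma lookup_cscale [simp]: "Poly_Mapping.lookup (cscale c p) m = c * Poly_Mapping.lookup p m"
  unfolding cscale_def mult_map_scale_conv_mult[symmetric]
  by (simp add: Poly_Mapping.map.rep_eq when_def)

lemma keys_cscale: "Poly_Mapping.keys (cscale c p) \<subseteq> Poly_Mapping.keys p"
  by (auto simp: in_keys_iff)

lemma cscale_mult_left: "cscale c p * q = cscale c (p * q)"
  by (simp add: cscale_def mult.assoc)

lemma cscale_mult_right: "p * cscale c q = cscale c (p * q)"
  by (simp add: cscale_def mult.left_commute)

lemmas cscale_mult = cscale_mult_left cscale_mult_right

lemma mon_mult: "mon m * mon n = mon (m + n)"
  by (simp add: mult_single)

lemma mon_zero: "mon 0 = 1"
  by simp

lemma mon_add_single: "mon (m + Poly_Mapping.single v 1) = Var v * mon m"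
  by (simp add: Var_def mult_single add.commute)

lemma cpoly_eq_sum_mon:
  "p = (\<Sum>m\<in>Poly_Mapping.keys p. cscale (Poly_Mapping.lookup p m) (mon m))"
proof (rule poly_mapping_eqI)
  fix k
  show "Poly_Mapping.lookup p k =
      Poly_Mapping.lookup (\<Sum>m\<in>Poly_Mapping.keys p. cscale (Poly_Mapping.lookup p m) (mon m)) k"
  proof (cases "k \<in> Poly_Mapping.keys p")
    case True
    have "(\<Sum>m\<in>Poly_Mapping.keys p. Poly_Mapping.lookup p m * Poly_Mapping.lookup (mon m) k) =
        (\<Sum>m\<in>Poly_Mapping.keys p. if m = k then Poly_Mapping.lookup p m else 0)"
      by (rule sum.cong) (auto simp: lookup_single when_def)
    then show ?thesis using True by (simp add: lookup_sum)
  next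
    case False
    then have "(\<Sum>m\<in>Poly_Mapping.keys p. Poly_Mapping.lookup p m * Poly_Mapping.lookup (mon m) k) = 0"
      by (intro sum.neutral) (auto simp: lookup_single when_def)
    then show ?thesis using False by (simp add: lookup_sum in_keys_iff)
  qed
qed

lemma cpoly_in_subspace:
  assumes "cpoly.subspace V" "\<And>m. m \<in> Poly_Mapping.keys p \<Longrightarrow> mon m \<in> V"
  shows "p \<in> V"
  by (subst cpoly_eq_sum_mon)
    (intro cpoly.subspace_sum cpoly.subspace_scale assms)

lemma cpoly_monomial_induct [case_names add scale mon]:
  assumes "\<And>p q. P p \<Longrightarrow> P q \<Longrightarrow> P (p + q)" "\<And>c p. P p \<Longrightarrow> P (cscale c p)" "\<And>m. P (mon m)"
  shows "P p"
proof -
  have "P 0" using assms(2)[OF assms(3), of 0] by simp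
  then have "cpoly.subspace (Collect P)"
    by (auto simp: cpoly.subspace_def assms)
  from cpoly_in_subspace[OF this] show ?thesis using assms(3) by auto
qed

text \<open>Building up by one variable at a time suits maps that obey a product rule; the monomial
  induction before it suits maps known only to be linear.\<close>

lemma cpoly_induct [case_names add scale one Var]:
  fixes p :: "'v::finite cpoly"
  assumes "\<And>p q. P p \<Longrightarrow> P q \<Longrightarrow> P (p + q)" "\<And>c p. P p \<Longrightarrow> P (cscale c p)"
    "P 1" "\<And>v p. P p \<Longrightarrow> P (Var v * p)"
  shows "P p"
proof (induction p rule: cpoly_monomial_induct)
  case (mon m)
  show ?case
    by (induction m rule: exponent_induct) (simp_all only: mon_zero assms mon_add_single)
qed (use assms in auto)

text \<open>Derivatives, substitutions, normal ordering and traces are all sums over the support of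
  a polynomial. Supports do not add, so additivity in the coefficient, with value 0 at 0, has to
  absorb cancellation.\<close>

lemma sum_keys_add:
  fixes F :: "('v \<Rightarrow>\<^sub>0 nat) \<Rightarrow> complex \<Rightarrow> 'b::comm_monoid_add"
  assumes "\<And>m. F m 0 = 0" "\<And>m a b. F m (a + b) = F m a + F m b"
  shows "(\<Sum>m\<in>Poly_Mapping.keys (p + q). F m (Poly_Mapping.lookup (p + q) m)) =
    (\<Sum>m\<in>Poly_Mapping.keys p. F m (Poly_Mapping.lookup p m)) +
    (\<Sum>m\<in>Poly_Mapping.keys q. F m (Poly_Mapping.lookup q m))"
  using setsum_keys_plus_distrib[of F p q] assms by auto

lemma sum_keys_cscale:
  fixes F :: "('v \<Rightarrow>\<^sub>0 nat) \<Rightarrow> complex \<Rightarrow> 'b::comm_monoid_add"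
  assumes "\<And>m. F m 0 = 0"
  shows "(\<Sum>m\<in>Poly_Mapping.keys (cscale c p). F m (Poly_Mapping.lookup (cscale c p) m)) =
    (\<Sum>m\<in>Poly_Mapping.keys p. F m (c * Poly_Mapping.lookup p m))"
  by (rule sum.mono_neutral_cong_left[OF _ keys_cscale]) (auto simp: in_keys_iff assms)

section \<open>Partial derivatives\<close>

lemma pderivative_add: "pderivative v (p + q) = pderivative v p + pderivative v q"
  unfolding pderivative_def by (rule sum_keys_add) (auto simp: algebra_simps single_add)

lemma pderivative_cscale: "pderivative v (cscale c p) = cscale c (pderivative v p)"
proof -
  have "pderivative v (cscale c p) =
      (\<Sum>m\<in>Poly_Mapping.keys p. Poly_Mapping.single (m - Poly_Mapping.single v 1)
         (of_nat (Poly_Mapping.lookup m v) * (c * Poly_Mapping.lookup p m)))"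
    unfolding pderivative_def by (rule sum_keys_cscale) auto
  also have "\<dots> = cscale c (pderivative v p)"
    by (simp add: pderivative_def sum_distrib_left cscale_def mult_single mult.left_commute)
  finally show ?thesis .
qed

lemma pderivative_zero [simp]: "pderivative v 0 = 0"
  by (simp add: pderivative_def)

lemma pderivative_mon:
  "pderivative v (mon m) =
    cscale (of_nat (Poly_Mapping.lookup m v)) (mon (m - Poly_Mapping.single v 1))"
  by (simp add: pderivative_def flip: single_eq_cscale)

lemma pderivative_one [simp]: "pderivative v 1 = 0"
  using pderivative_mon[of v 0] by simp

lemma pderivative_Var_mult_mon:
  "pderivative v (Var u * mon m) =
    (if u = v then mon m else 0) + Var u * pderivative v (mon m)"
proof -
  let ?u = "Poly_Mapping.single u (1::nat)" and ?v = "Poly_Mapping.single v (1::nat)"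
  have L: "pderivative v (Var u * mon m) =
      cscale (of_nat (Poly_Mapping.lookup (m + ?u) v)) (mon (m + ?u - ?v))"
    unfolding mon_add_single[symmetric] pderivative_mon ..
  have R: "Var u * pderivative v (mon m) =
      cscale (of_nat (Poly_Mapping.lookup m v)) (mon (m - ?v + ?u))"
    unfolding pderivative_mon cscale_mult mon_add_single ..
  show ?thesis
  proof (cases "Poly_Mapping.lookup m v = 0")
    \<comment> \<open>If \<open>v\<close> does not occur in \<open>m\<close>, the truncated
      difference \<open>m - ?v\<close> is the wrong exponent, but its coefficient is 0.\<close>
    case True
    then have "m + ?v - ?v = m" by simp
    then show ?thesis unfolding L R
      using True by (auto simp: lookup_add lookup_single when_def)
  next
    case False
    have "m + ?u - ?v = m - ?v + ?u"
      using False by (intro poly_mapping_eqI) (auto simp: lookup_add lookup_minus lookup_single when_def)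
    moreover have "m - ?v + ?u = m" if "u = v"
      using minus_single_add[OF False] that by simp
    ultimately show ?thesis unfolding L R
      by (auto simp: lookup_add lookup_single when_def cpoly.scale_left_distrib)
  qed
qed

lemma pderivative_Var_mult:
  "pderivative v (Var u * p) = (if u = v then p else 0) + Var u * pderivative v p"
  by (induction p rule: cpoly_monomial_induct)
    (auto simp: pderivative_Var_mult_mon distrib_left pderivative_add pderivative_cscale
      cscale_mult cpoly.scale_right_distrib)

lemma pderivative_Var: "pderivative v (Var u) = (if u = v then 1 else 0)"
  using pderivative_Var_mult[of v u 1] by simp

lemma pderivative_mult:
  fixes p q :: "'v::finite cpoly"
  shows "pderivative v (p * q) = pderivative v p * q + p * pderivative v q"
proof (induction p rule: cpoly_induct)
  case (Var u p)
  then show ?case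
    by (simp add: pderivative_Var_mult mult.assoc distrib_left distrib_right)
qed (simp_all add: distrib_right pderivative_add pderivative_cscale cscale_mult
      cpoly.scale_right_distrib)

lemma pderivative_commute:
  fixes p :: "'v::finite cpoly"
  shows "pderivative u (pderivative v p) = pderivative v (pderivative u p)"
  by (induction p rule: cpoly_induct)
    (auto simp: pderivative_add pderivative_cscale pderivative_Var_mult)

lemma pderivative_sum: "pderivative v (\<Sum>i\<in>I. f i) = (\<Sum>i\<in>I. pderivative v (f i))"
  by (induction I rule: infinite_finite_induct) (simp_all add: pderivative_add)

lemma pderivative_power:
  fixes p :: "'v::finite cpoly"
  shows "pderivative v (p ^ n) = cscale (of_nat n) (p ^ (n - 1) * pderivative v p)"
proof (induction n)
  case (Suc n)
  have "p * (p ^ (n - 1) * pderivative v p) = (if n = 0 then 0 else p ^ n * pderivative v p) \<or> n = 0"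
    by (cases n) simp_all
  then have "p * cscale (of_nat n) (p ^ (n - 1) * pderivative v p) =
      cscale (of_nat n) (p ^ n * pderivative v p)"
    by (cases "n = 0") (simp_all add: cscale_mult)
  then show ?case
    by (simp add: pderivative_mult Suc cpoly.scale_left_distrib mult.commute)
qed simp

lemma mon_eq_prod: "mon m = (\<Prod>v\<in>UNIV. Var v ^ Poly_Mapping.lookup m v)" for m :: "'v::finite \<Rightarrow>\<^sub>0 nat"
proof (induction m rule: exponent_induct)
  case (add m v)
  have "(\<Prod>u\<in>UNIV. Var u ^ Poly_Mapping.lookup (m + Poly_Mapping.single v 1) u) =
      (\<Prod>u\<in>UNIV. Var u ^ Poly_Mapping.lookup m u * (if u = v then Var u else 1))"
    by (rule prod.cong) (auto simp: lookup_add lookup_single when_def)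
  also have "\<dots> = mon m * Var v"
    by (simp add: prod.distrib add.IH)
  finally show ?case by (simp only: mon_add_single mult.commute)
qed simp

subsection \<open>Substitution\<close>

lemma poly_subst_add: "poly_subst \<sigma> (p + q) = poly_subst \<sigma> p + poly_subst \<sigma> q"
  unfolding poly_subst_def by (rule sum_keys_add) (auto simp: cpoly.scale_left_distrib)

lemma poly_subst_cscale: "poly_subst \<sigma> (cscale c p) = cscale c (poly_subst \<sigma> p)"
proof -
  have "poly_subst \<sigma> (cscale c p) =
      (\<Sum>m\<in>Poly_Mapping.keys p. cscale (c * Poly_Mapping.lookup p m)
         (\<Prod>v\<in>Poly_Mapping.keys m. \<sigma> v ^ Poly_Mapping.lookup m v))"
    unfolding poly_subst_def by (rule sum_keys_cscale) auto
  then show ?thesis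
    by (simp add: poly_subst_def cpoly.scale_sum_right)
qed

lemma poly_subst_mon:
  fixes m :: "'v::finite \<Rightarrow>\<^sub>0 nat"
  shows "poly_subst \<sigma> (mon m) = (\<Prod>v\<in>UNIV. \<sigma> v ^ Poly_Mapping.lookup m v)"
proof -
  have "(\<Prod>v\<in>Poly_Mapping.keys m. \<sigma> v ^ Poly_Mapping.lookup m v) =
      (\<Prod>v\<in>UNIV. \<sigma> v ^ Poly_Mapping.lookup m v)"
    by (rule prod.mono_neutral_left) (auto simp: in_keys_iff)
  then show ?thesis by (simp add: poly_subst_def)
qed

lemma poly_subst_one [simp]: "poly_subst \<sigma> 1 = 1"
  by (simp add: poly_subst_def)

lemma poly_subst_zero [simp]: "poly_subst \<sigma> 0 = 0"
  by (simp add: poly_subst_def)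

lemma poly_subst_mult:
  fixes p q :: "'v::finite cpoly"
  shows "poly_subst \<sigma> (p * q) = poly_subst \<sigma> p * poly_subst \<sigma> q"
proof (induction p rule: cpoly_monomial_induct)
  case (mon m)
  show ?case
  proof (induction q rule: cpoly_monomial_induct)
    case (mon n)
    show ?case
      by (simp add: mon_mult poly_subst_mon lookup_add power_add prod.distrib)
  qed (simp_all add: distrib_left poly_subst_add poly_subst_cscale cscale_mult)
qed (simp_all add: distrib_right poly_subst_add poly_subst_cscale cscale_mult)

lemma poly_subst_Var [simp]:
  fixes v :: "'v::finite"
  shows "poly_subst \<sigma> (Var v) = \<sigma> v"
proof -
  have "(\<Prod>u\<in>UNIV. \<sigma> u ^ Poly_Mapping.lookup (Poly_Mapping.single v 1) u) =
      (\<Prod>u\<in>UNIV. if u = v then \<sigma> u else 1)"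
    by (rule prod.cong) (auto simp: lookup_single when_def)
  then show ?thesis by (simp add: Var_def poly_subst_mon)
qed

lemma poly_subst_sum: "poly_subst \<sigma> (\<Sum>i\<in>I. f i) = (\<Sum>i\<in>I. poly_subst \<sigma> (f i))"
  by (induction I rule: infinite_finite_induct) (simp_all add: poly_subst_add)

lemma poly_subst_diff: "poly_subst \<sigma> (p - q) = poly_subst \<sigma> p - poly_subst \<sigma> q"
  by (metis add_diff_cancel_right' diff_add_cancel poly_subst_add)

lemma poly_subst_power:
  fixes p :: "'v::finite cpoly"
  shows "poly_subst \<sigma> (p ^ n) = poly_subst \<sigma> p ^ n"
  by (induction n) (simp_all add: poly_subst_mult)

subsection \<open>Degree\<close>

text \<open>The bound is an integer so that \<open>d - 1\<close> and \<open>i + j - 4\<close> are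
  honest subtractions; a negative bound leaves only the zero polynomial.\<close>

definition pdeg_le :: "int \<Rightarrow> 'v::finite cpoly set" where
  "pdeg_le d = {p. \<forall>m\<in>Poly_Mapping.keys p. int (mdeg m) \<le> d}"

lemma subspace_pdeg_le: "cpoly.subspace (pdeg_le d)"
  using keys_add keys_cscale
  by (fastforce simp: cpoly.subspace_def pdeg_le_def)

lemmas pdeg_le_add = cpoly.subspace_add[OF subspace_pdeg_le]
  and pdeg_le_diff = cpoly.subspace_diff[OF subspace_pdeg_le]
  and pdeg_le_cscale = cpoly.subspace_scale[OF subspace_pdeg_le]
  and pdeg_le_sum = cpoly.subspace_sum[OF subspace_pdeg_le]
  and pdeg_le_0 = cpoly.subspace_0[OF subspace_pdeg_le]

lemma pdeg_le_mono: "d \<le> e \<Longrightarrow> p \<in> pdeg_le d \<Longrightarrow> p \<in> pdeg_le e"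
  by (force simp: pdeg_le_def)

lemma mon_pdeg_le: "mon m \<in> pdeg_le (int (mdeg m))"
  by (simp add: pdeg_le_def)

lemma pdeg_le_neg:
  assumes "d < 0" "p \<in> pdeg_le d"
  shows "p = 0"
proof -
  have "Poly_Mapping.keys p = {}" using assms by (force simp: pdeg_le_def)
  then show ?thesis by (simp add: poly_mapping_eq_iff fun_eq_iff in_keys_iff[symmetric])
qed

lemma pdeg_le_mult:
  assumes "p \<in> pdeg_le d" "q \<in> pdeg_le e"
  shows "p * q \<in> pdeg_le (d + e)"
proof -
  have "int (mdeg (a + b)) \<le> d + e" if "a \<in> Poly_Mapping.keys p" "b \<in> Poly_Mapping.keys q" for a b
    using assms that by (auto simp: pdeg_le_def mdeg_add intro: add_mono)
  then show ?thesis using keys_mult[of p q] by (auto simp: pdeg_le_def)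
qed

lemma one_pdeg_le: "1 \<in> pdeg_le 0"
  by (simp add: pdeg_le_def)

lemma Var_pdeg_le: "Var v \<in> pdeg_le 1"
  by (simp add: pdeg_le_def Var_def mdeg_single)

lemma power_pdeg_le: "p \<in> pdeg_le d \<Longrightarrow> p ^ n \<in> pdeg_le (int n * d)"
  by (induction n) (auto simp: one_pdeg_le distrib_right dest: pdeg_le_mult)

lemma Var_power_pdeg_le: "Var v ^ n \<in> pdeg_le (int n)"
  using power_pdeg_le[OF Var_pdeg_le] by simp

lemma pdeg_le_in_subspace:
  assumes "cpoly.subspace V" "p \<in> pdeg_le d" "\<And>m. int (mdeg m) \<le> d \<Longrightarrow> mon m \<in> V"
  shows "p \<in> V"
  by (rule cpoly_in_subspace[OF assms(1)], rule assms(3)) (use assms(2) in \<open>simp add: pdeg_le_def\<close>)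

lemma pderivative_pdeg_le:
  assumes "p \<in> pdeg_le d"
  shows "pderivative v p \<in> pdeg_le (d - 1)"
proof -
  have "pderivative v (mon m) \<in> pdeg_le (d - 1)" if "int (mdeg m) \<le> d" for m
  proof (cases "Poly_Mapping.lookup m v = 0")
    case False
    have "mdeg m = mdeg (m - Poly_Mapping.single v 1) + 1"
      using arg_cong[OF minus_single_add[OF False], of mdeg] by (simp add: mdeg_add mdeg_single)
    then have "mon (m - Poly_Mapping.single v 1) \<in> pdeg_le (d - 1)"
      using that by (simp add: pdeg_le_def)
    then show ?thesis unfolding pderivative_mon by (rule pdeg_le_cscale)
  qed (simp add: pderivative_mon pdeg_le_0)
  moreover have "cpoly.subspace {p. pderivative v p \<in> pdeg_le (d - 1)}"
    by (auto simp: cpoly.subspace_def pderivative_add pderivative_cscale pdeg_le_0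
        intro: pdeg_le_add pdeg_le_cscale)
  ultimately have "p \<in> {p. pderivative v p \<in> pdeg_le (d - 1)}"
    by (intro pdeg_le_in_subspace[OF _ assms]) auto
  then show ?thesis by simp
qed

lemma constant_if_pderivatives_zero:
  assumes "\<And>v. pderivative v p = 0"
  shows "\<exists>c. p = cscale c 1"
proof -
  have "m = 0" if m: "m \<in> Poly_Mapping.keys p" for m
  proof (rule ccontr)
    assume "m \<noteq> 0"
    then obtain v where v: "Poly_Mapping.lookup m v \<noteq> 0"
      by (metis lookup_zero poly_mapping_eqI)
    let ?v = "Poly_Mapping.single v (1::nat)"
    have "Poly_Mapping.lookup (pderivative v p) (m - ?v) =
        (\<Sum>n\<in>Poly_Mapping.keys p. (of_nat (Poly_Mapping.lookup n v) * Poly_Mapping.lookup p n)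
          when n - ?v = m - ?v)"
      by (simp add: pderivative_def lookup_sum lookup_single)
    \<comment> \<open>Truncated subtraction could send several exponents to \<open>m - ?v\<close>.
      Those without \<open>v\<close> carry the factor 0, and on the others subtracting
      \<open>?v\<close> is injective, so only \<open>n = m\<close> contributes.\<close>
    also have "\<dots> = (\<Sum>n\<in>Poly_Mapping.keys p. if n = m then of_nat (Poly_Mapping.lookup n v) * Poly_Mapping.lookup p n else 0)"
    proof (rule sum.cong)
      fix n assume "n \<in> Poly_Mapping.keys p"
      have "n = m" if "n - ?v = m - ?v" "Poly_Mapping.lookup n v \<noteq> 0"
        using minus_single_add[OF that(2)] minus_single_add[OF v] that(1) by metis
      then show "((of_nat (Poly_Mapping.lookup n v) * Poly_Mapping.lookup p n) when n - ?v = m - ?v) =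
          (if n = m then of_nat (Poly_Mapping.lookup n v) * Poly_Mapping.lookup p n else 0)"
        by (cases "Poly_Mapping.lookup n v = 0") (auto simp: when_def)
    qed simp
    also have "\<dots> = of_nat (Poly_Mapping.lookup m v) * Poly_Mapping.lookup p m"
      using m by simp
    finally show False using assms[of v] v m by (simp add: in_keys_iff)
  qed
  then have "Poly_Mapping.keys p \<subseteq> {0}" by auto
  then have "p = (\<Sum>m\<in>{0}. cscale (Poly_Mapping.lookup p m) (mon m))"
    by (subst cpoly_eq_sum_mon) (rule sum.mono_neutral_left, auto simp: in_keys_iff)
  then show ?thesis by auto
qed

section \<open>The Poisson bracket and the group action\<close>

lemma poisson_bracket_add_left: "poisson_bracket (f + f') g = poisson_bracket f g + poisson_bracket f' g"
  unfolding poisson_bracket_def sum.distrib[symmetric]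
  by (rule sum.cong) (auto simp: pderivative_add algebra_simps)

lemma poisson_bracket_add_right: "poisson_bracket f (g + g') = poisson_bracket f g + poisson_bracket f g'"
  unfolding poisson_bracket_def sum.distrib[symmetric]
  by (rule sum.cong) (auto simp: pderivative_add algebra_simps)

lemma poisson_bracket_cscale_left: "poisson_bracket (cscale c f) g = cscale c (poisson_bracket f g)"
  by (simp add: poisson_bracket_def cpoly.scale_sum_right pderivative_cscale cscale_mult
      cpoly.scale_right_diff_distrib)

lemma poisson_bracket_cscale_right: "poisson_bracket f (cscale c g) = cscale c (poisson_bracket f g)"
  by (simp add: poisson_bracket_def cpoly.scale_sum_right pderivative_cscale cscale_mult
      cpoly.scale_right_diff_distrib)

lemma poisson_bracket_antisym: "poisson_bracket g f = - poisson_bracket f g"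
  by (simp add: poisson_bracket_def sum_negf[symmetric] mult.commute)

lemma poisson_bracket_mult_left:
  "poisson_bracket (f * f') g = f * poisson_bracket f' g + f' * poisson_bracket f g"
  unfolding poisson_bracket_def sum_distrib_left sum.distrib[symmetric]
  by (rule sum.cong) (auto simp: pderivative_mult algebra_simps)

lemma poisson_bracket_mult_right:
  "poisson_bracket f (g * g') = g * poisson_bracket f g' + g' * poisson_bracket f g"
  unfolding poisson_bracket_def sum_distrib_left sum.distrib[symmetric]
  by (rule sum.cong) (auto simp: pderivative_mult algebra_simps)

lemma poisson_bracket_zero_left [simp]: "poisson_bracket 0 g = 0"
  by (simp add: poisson_bracket_def)

lemma poisson_bracket_zero_right [simp]: "poisson_bracket f 0 = 0"
  by (simp add: poisson_bracket_def)

lemma poisson_bracket_one_left [simp]: "poisson_bracket 1 g = 0"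
  by (simp add: poisson_bracket_def)

lemma poisson_bracket_one_right [simp]: "poisson_bracket f 1 = 0"
  by (simp add: poisson_bracket_def)

lemma poisson_bracket_sum_left:
  "poisson_bracket (\<Sum>i\<in>I. f i) g = (\<Sum>i\<in>I. poisson_bracket (f i) g)"
  by (induction I rule: infinite_finite_induct) (simp_all add: poisson_bracket_add_left)

lemma poisson_bracket_sum_right:
  "poisson_bracket f (\<Sum>i\<in>I. g i) = (\<Sum>i\<in>I. poisson_bracket f (g i))"
  by (induction I rule: infinite_finite_induct) (simp_all add: poisson_bracket_add_right)

lemma poisson_bracket_Var:
  "poisson_bracket (Var (Inl i)) (Var (Inl j)) = 0"
  "poisson_bracket (Var (Inr i)) (Var (Inr j)) = 0"
  "poisson_bracket (Var (Inl i)) (Var (Inr j)) = (if i = j then 1 else 0)"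
  "poisson_bracket (Var (Inr i)) (Var (Inl j)) = (if i = j then - 1 else 0)"
proof -
  have *: "(\<Sum>k\<in>UNIV. (if i = k then 1 else 0) * (if j = k then 1 else (0::('a + 'a) cpoly))) = (if i = j then 1 else 0)"
    for i j :: 'a
  proof -
    have "(\<Sum>k\<in>UNIV. (if i = k then 1 else 0) * (if j = k then 1 else (0::('a + 'a) cpoly))) =
        (\<Sum>k\<in>UNIV. if i = k then if j = k then 1 else 0 else 0)"
      by (rule sum.cong) auto
    then show ?thesis by (simp add: eq_commute)
  qed
  show "poisson_bracket (Var (Inl i)) (Var (Inr j)) = (if i = j then 1 else 0)"
    "poisson_bracket (Var (Inr i)) (Var (Inl j)) = (if i = j then - 1 else 0)"
    using *[of i j] by (simp_all add: poisson_bracket_def pderivative_Var sum_negf)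
qed (simp_all add: poisson_bracket_def pderivative_Var)

section \<open>Linear substitutions in positions and momenta\<close>

lemma matrix_inv_unique:
  fixes A B :: "'a::semiring_1^'n^'n"
  assumes "A ** B = mat 1" "B ** A = mat 1"
  shows "matrix_inv A = B"
proof -
  have "A ** matrix_inv A = mat 1 \<and> matrix_inv A ** A = mat 1"
    unfolding matrix_inv_def by (rule someI_ex) (use assms in blast)
  then show ?thesis by (metis assms(2) matrix_mul_assoc matrix_mul_lid matrix_mul_rid)
qed

lemma matrix_inv_inverse:
  fixes A :: "'a::semiring_1^'n^'n"
  assumes "invertible A"
  shows "A ** matrix_inv A = mat 1" "matrix_inv A ** A = mat 1"
proof -
  have "A ** matrix_inv A = mat 1 \<and> matrix_inv A ** A = mat 1"
    unfolding matrix_inv_def by (rule someI_ex) (use assms in \<open>simp add: invertible_def\<close>)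
  then show "A ** matrix_inv A = mat 1" "matrix_inv A ** A = mat 1" by auto
qed

lemma matrix_inv_involutive:
  fixes A :: "'a::semiring_1^'n^'n"
  shows "invertible A \<Longrightarrow> matrix_inv (matrix_inv A) = A"
  by (simp add: matrix_inv_inverse matrix_inv_unique)

lemma invertible_matrix_inv:
  fixes A :: "'a::semiring_1^'n^'n"
  shows "invertible A \<Longrightarrow> invertible (matrix_inv A)"
  using matrix_inv_inverse invertible_def by metis

lemma matrix_inv_mult:
  fixes A B :: "'a::semiring_1^'n^'n"
  assumes "invertible A" "invertible B"
  shows "matrix_inv (A ** B) = matrix_inv B ** matrix_inv A"
proof (rule matrix_inv_unique)
  have "A ** B ** (matrix_inv B ** matrix_inv A) = A ** (B ** matrix_inv B) ** matrix_inv A"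
    by (simp add: matrix_mul_assoc)
  then show "A ** B ** (matrix_inv B ** matrix_inv A) = mat 1"
    by (simp add: matrix_inv_inverse assms)
  have "matrix_inv B ** matrix_inv A ** (A ** B) = matrix_inv B ** (matrix_inv A ** A) ** B"
    by (simp add: matrix_mul_assoc)
  then show "matrix_inv B ** matrix_inv A ** (A ** B) = mat 1"
    by (simp add: matrix_inv_inverse assms)
qed

lemma act_double_Var:
  "act_double g (Var (Inl i)) = (\<Sum>j\<in>UNIV. cscale (matrix_inv g $ i $ j) (Var (Inl j)))"
  "act_double g (Var (Inr i)) = (\<Sum>j\<in>UNIV. cscale (g $ j $ i) (Var (Inr j)))"
  by (simp_all add: act_double_def)

lemma act_double_add: "act_double g (f + f') = act_double g f + act_double g f'"
  by (simp add: act_double_def poly_subst_add)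

lemma act_double_cscale: "act_double g (cscale c f) = cscale c (act_double g f)"
  by (simp add: act_double_def poly_subst_cscale)

lemma act_double_one [simp]: "act_double g 1 = 1"
  by (simp add: act_double_def)

lemma act_double_zero [simp]: "act_double g 0 = 0"
  by (simp add: act_double_def)

lemma act_double_mult: "act_double g (f * f') = act_double g f * act_double g f'"
  by (simp add: act_double_def poly_subst_mult)

lemma act_double_power: "act_double g (f ^ n) = act_double g f ^ n"
  by (simp add: act_double_def poly_subst_power)

lemma act_double_sum: "act_double g (\<Sum>i\<in>I. f i) = (\<Sum>i\<in>I. act_double g (f i))"
  by (simp add: act_double_def poly_subst_sum)

lemma act_double_diff: "act_double g (f - f') = act_double g f - act_double g f'"
  by (simp add: act_double_def poly_subst_diff)

lemma linear_act_double: "Vector_Spaces.linear cscale cscale (act_double g)"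
  by unfold_locales (simp_all add: act_double_add act_double_cscale)

lemma act_double_matrix_mult:
  assumes "invertible g" "invertible h"
  shows "act_double (g ** h) f = act_double g (act_double h f)"
proof (induction f rule: cpoly_induct)
  case (Var v f)
  have "act_double (g ** h) (Var v) = act_double g (act_double h (Var v))"
  proof (cases v)
    case (Inl i)
    have "(\<Sum>j\<in>UNIV. \<Sum>k\<in>UNIV. cscale (matrix_inv h $ i $ k * matrix_inv g $ k $ j) (Var (Inl j))) =
      (\<Sum>k\<in>UNIV. \<Sum>j\<in>UNIV. cscale (matrix_inv h $ i $ k * matrix_inv g $ k $ j) (Var (Inl j)))"
      by (rule sum.swap)
    moreover have "matrix_inv (g ** h) $ i $ j = (\<Sum>k\<in>UNIV. matrix_inv h $ i $ k * matrix_inv g $ k $ j)" for j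
      unfolding matrix_inv_mult[OF assms] by (simp add: matrix_matrix_mult_def)
    ultimately show ?thesis unfolding Inl
      by (simp add: act_double_Var act_double_sum act_double_cscale
          cpoly.scale_sum_left cpoly.scale_sum_right)
  next
    case (Inr i)
    have "(\<Sum>j\<in>UNIV. \<Sum>k\<in>UNIV. cscale (g $ j $ k * h $ k $ i) (Var (Inr j))) =
      (\<Sum>k\<in>UNIV. \<Sum>j\<in>UNIV. cscale (h $ k $ i * g $ j $ k) (Var (Inr j)))"
      by (subst sum.swap) (simp add: mult.commute)
    then show ?thesis unfolding Inr
      by (simp add: act_double_Var act_double_sum act_double_cscale
          matrix_matrix_mult_def cpoly.scale_sum_left cpoly.scale_sum_right)
  qed
  then show ?case by (simp add: act_double_mult Var)
qed (simp_all add: act_double_add act_double_cscale)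

lemma sum_if_cscale:
  fixes x :: "'n::finite \<Rightarrow> 'v cpoly"
  shows "(\<Sum>j\<in>UNIV. cscale (if i = j then 1 else 0) (x j)) = x i"
    and "(\<Sum>j\<in>UNIV. cscale (if j = i then 1 else 0) (x j)) = x i"
proof -
  have "(\<Sum>j\<in>UNIV. cscale (if i = j then 1 else 0) (x j)) = (\<Sum>j\<in>UNIV. if i = j then x j else 0)"
    by (rule sum.cong) auto
  then show "(\<Sum>j\<in>UNIV. cscale (if i = j then 1 else 0) (x j)) = x i" by simp
  then show "(\<Sum>j\<in>UNIV. cscale (if j = i then 1 else 0) (x j)) = x i" by (simp add: eq_commute)
qed

lemma act_double_mat_1: "act_double (mat 1) f = f"
proof -
  have inv: "matrix_inv (mat 1) = (mat 1 :: complex^'n^'n)"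
    by (rule matrix_inv_unique) auto
  show ?thesis
  proof (induction f rule: cpoly_induct)
    case (Var v f)
    have "act_double (mat 1) (Var v) = Var v"
      by (cases v) (simp_all add: act_double_Var inv, simp_all add: mat_def sum_if_cscale)
    then show ?case by (simp add: act_double_mult Var)
  qed (simp_all add: act_double_add act_double_cscale)
qed

lemma act_double_inverse:
  assumes "invertible g"
  shows "act_double (matrix_inv g) (act_double g f) = f" "act_double g (act_double (matrix_inv g) f) = f"
  using assms
  by (simp_all add: act_double_matrix_mult[symmetric] invertible_matrix_inv matrix_inv_inverse
      act_double_mat_1)

lemma inj_act_double: "invertible g \<Longrightarrow> inj (act_double g)"
  by (metis act_double_inverse(1) injI)

text \<open>Positions are transformed by the inverse and momenta by the transpose, so the canonical
  brackets of the variables are preserved. Both sides obey the product rule in each argument, and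
  the variables generate.\<close>

lemma act_double_poisson_bracket:
  assumes "invertible g"
  shows "act_double g (poisson_bracket f h) = poisson_bracket (act_double g f) (act_double g h)"
proof -
  have inv: "(\<Sum>k\<in>UNIV. matrix_inv g $ i $ k * g $ k $ j) = (if i = j then 1 else 0)" for i j
    using matrix_inv_inverse(2)[OF assms] by (simp add: matrix_matrix_mult_def mat_def vec_eq_iff)
  have gen: "poisson_bracket (act_double g (Var (Inl i))) (act_double g (Var (Inr j))) =
      (if i = j then 1 else 0)" for i j
  proof -
    have "poisson_bracket (act_double g (Var (Inl i))) (act_double g (Var (Inr j))) =
      (\<Sum>l\<in>UNIV. \<Sum>k\<in>UNIV. cscale (g $ l $ j * matrix_inv g $ i $ k) (if k = l then 1 else 0))"
      by (simp add: act_double_Var poisson_bracket_sum_left poisson_bracket_sum_right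
          poisson_bracket_cscale_left poisson_bracket_cscale_right poisson_bracket_Var
          cpoly.scale_sum_right)
    also have "\<dots> = (\<Sum>l\<in>UNIV. \<Sum>k\<in>UNIV. if k = l then cscale (matrix_inv g $ i $ l * g $ l $ j) 1 else 0)"
      by (intro sum.cong) (auto simp: mult.commute)
    also have "\<dots> = cscale (\<Sum>l\<in>UNIV. matrix_inv g $ i $ l * g $ l $ j) 1"
      by (simp add: cpoly.scale_sum_left)
    finally show ?thesis by (simp add: inv)
  qed
  have gen': "act_double g (poisson_bracket (Var u) (Var v)) =
      poisson_bracket (act_double g (Var u)) (act_double g (Var v))" for u v
  proof (cases u; cases v)
    fix i j assume "u = Inl i" "v = Inl j"
    then show ?thesis
      by (simp add: poisson_bracket_Var act_double_Var poisson_bracket_sum_left poisson_bracket_sum_right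
          poisson_bracket_cscale_left poisson_bracket_cscale_right)
  next
    fix i j assume "u = Inr i" "v = Inr j"
    then show ?thesis
      by (simp add: poisson_bracket_Var act_double_Var poisson_bracket_sum_left poisson_bracket_sum_right
          poisson_bracket_cscale_left poisson_bracket_cscale_right)
  next
    fix i j assume "u = Inl i" "v = Inr j"
    then show ?thesis by (simp add: gen poisson_bracket_Var)
  next
    fix i j assume uv: "u = Inr i" "v = Inl j"
    have "poisson_bracket (act_double g (Var u)) (act_double g (Var v)) = - (if j = i then 1 else 0)"
      unfolding uv by (subst poisson_bracket_antisym) (simp add: gen)
    moreover have "act_double g (- 1 :: ('a + 'a) cpoly) = - 1"
      using act_double_diff[of g 0 1] by simp
    ultimately show ?thesis by (auto simp: uv poisson_bracket_Var)
  qed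
  have Var_left: "act_double g (poisson_bracket (Var u) h) =
      poisson_bracket (act_double g (Var u)) (act_double g h)" for u h
    by (induction h rule: cpoly_induct)
      (simp_all add: poisson_bracket_add_right poisson_bracket_cscale_right act_double_add
        act_double_cscale poisson_bracket_mult_right act_double_mult gen')
  show ?thesis
    by (induction f rule: cpoly_induct)
      (simp_all add: poisson_bracket_add_left poisson_bracket_cscale_left act_double_add
        act_double_cscale poisson_bracket_mult_left act_double_mult Var_left)
qed

lemma subspace_invariant_polys: "cpoly.subspace (invariant_polys W)"
  by (auto simp: cpoly.subspace_def invariant_polys_def act_double_add act_double_cscale)

text \<open>The bracket is a parameter because \<open>poisson_bracket\<close> and
  \<open>star_commutator\<close> undergo the same change of coordinates and the same codimension
  argument.\<close>

definition bracket_span ::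
  "(('n::finite + 'n) cpoly \<Rightarrow> ('n + 'n) cpoly \<Rightarrow> ('n + 'n) cpoly) \<Rightarrow> (complex^'n^'n) set \<Rightarrow>
    ('n + 'n) cpoly set" where
  "bracket_span \<beta> W =
    cpoly.span {\<beta> f g | f g. f \<in> invariant_polys W \<and> g \<in> invariant_polys W}"

lemma act_double_image_invariant_polys:
  assumes h: "invertible h" and W: "\<And>g. g \<in> W \<Longrightarrow> invertible g"
  shows "act_double h ` invariant_polys W = invariant_polys ((\<lambda>g. h ** g ** matrix_inv h) ` W)"
proof -
  have conj: "act_double (h ** g ** matrix_inv h) f =
      act_double h (act_double g (act_double (matrix_inv h) f))" if "g \<in> W" for g f
    using h W[OF that] by (simp add: act_double_matrix_mult invertible_mult invertible_matrix_inv)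
  show ?thesis
  proof (intro equalityI subsetI)
    fix f assume "f \<in> act_double h ` invariant_polys W"
    then show "f \<in> invariant_polys ((\<lambda>g. h ** g ** matrix_inv h) ` W)"
      by (auto simp: invariant_polys_def conj act_double_inverse[OF h])
  next
    fix f assume f: "f \<in> invariant_polys ((\<lambda>g. h ** g ** matrix_inv h) ` W)"
    have "act_double g (act_double (matrix_inv h) f) = act_double (matrix_inv h) f" if "g \<in> W" for g
      using f conj[OF that, of f] act_double_inverse[OF h] that
      by (auto simp: invariant_polys_def) metis
    then have "act_double (matrix_inv h) f \<in> invariant_polys W"
      by (simp add: invariant_polys_def)
    then show "f \<in> act_double h ` invariant_polys W"
      using act_double_inverse(2)[OF h] by (metis image_eqI)
  qed
qed

lemma act_double_image_bracket_span:
  assumes h: "invertible h" and W: "\<And>g. g \<in> W \<Longrightarrow> invertible g"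
    and \<beta>: "\<And>f g. act_double h (\<beta> f g) = \<beta> (act_double h f) (act_double h g)"
  shows "act_double h ` bracket_span \<beta> W = bracket_span \<beta> ((\<lambda>g. h ** g ** matrix_inv h) ` W)"
proof -
  interpret Vector_Spaces.linear cscale cscale "act_double h"
    by (rule linear_act_double)
  have "act_double h ` {\<beta> f g | f g. f \<in> invariant_polys W \<and> g \<in> invariant_polys W} =
      {\<beta> f g | f g. f \<in> act_double h ` invariant_polys W \<and> g \<in> act_double h ` invariant_polys W}"
    by (auto simp: \<beta> image_iff) (metis \<beta>)+
  then show ?thesis
    unfolding bracket_span_def
    by (simp add: span_image[symmetric] act_double_image_invariant_polys[OF h W])
qed

section \<open>Normal ordering\<close>

definition coord_mon :: "((2 + 2) \<Rightarrow>\<^sub>0 nat) \<Rightarrow> 2 cpoly" where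
  "coord_mon m = Var 1 ^ Poly_Mapping.lookup m (Inl 1) * Var 2 ^ Poly_Mapping.lookup m (Inl 2)"

definition deriv_mon :: "((2 + 2) \<Rightarrow>\<^sub>0 nat) \<Rightarrow> 2 cpoly \<Rightarrow> 2 cpoly" where
  "deriv_mon m p =
    (pderivative 1 ^^ Poly_Mapping.lookup m (Inr 1)) ((pderivative 2 ^^ Poly_Mapping.lookup m (Inr 2)) p)"

text \<open>Keeping coordinates to the left of derivatives yields a linear bijection from
  polynomials onto differential operators. It is not multiplicative; \<open>star\<close> measures by
  how much.\<close>

definition normal_order :: "(2 + 2) cpoly \<Rightarrow> 2 pop" where
  "normal_order f p =
    (\<Sum>m\<in>Poly_Mapping.keys f. cscale (Poly_Mapping.lookup f m) (coord_mon m * deriv_mon m p))"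

lemma normal_order_add: "normal_order (f + g) p = normal_order f p + normal_order g p"
  unfolding normal_order_def by (rule sum_keys_add) (auto simp: cpoly.scale_left_distrib)

lemma normal_order_cscale: "normal_order (cscale c f) p = cscale c (normal_order f p)"
proof -
  have "normal_order (cscale c f) p =
      (\<Sum>m\<in>Poly_Mapping.keys f. cscale (c * Poly_Mapping.lookup f m) (coord_mon m * deriv_mon m p))"
    unfolding normal_order_def by (rule sum_keys_cscale) auto
  then show ?thesis
    by (simp add: normal_order_def cpoly.scale_sum_right)
qed

lemma normal_order_mon: "normal_order (mon m) p = coord_mon m * deriv_mon m p"
  by (simp add: normal_order_def)

lemma normal_order_one [simp]: "normal_order 1 p = p"
  using normal_order_mon[of 0 p] by (simp add: coord_mon_def deriv_mon_def)

lemma normal_order_zero [simp]: "normal_order 0 p = 0"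
  by (simp add: normal_order_def)

lemma normal_order_Inl_mult: "normal_order (Var (Inl i) * f) p = Var i * normal_order f p"
proof (induction f rule: cpoly_monomial_induct)
  case (mon m)
  have "coord_mon (m + Poly_Mapping.single (Inl i) 1) = Var i * coord_mon m"
    using exhaust_2[of i] by (auto simp: coord_mon_def lookup_add lookup_single)
  moreover have "deriv_mon (m + Poly_Mapping.single (Inl i) 1) p = deriv_mon m p"
    by (simp add: deriv_mon_def lookup_add lookup_single)
  ultimately show ?case
    by (simp only: mon_add_single[symmetric] normal_order_mon mult.assoc)
qed (simp_all add: distrib_left normal_order_add normal_order_cscale cscale_mult)

lemma pderivative_funpow_commute:
  fixes p :: "'v::finite cpoly"
  shows "(pderivative u ^^ n) (pderivative v p) = pderivative v ((pderivative u ^^ n) p)"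
  by (induction n) (simp_all add: pderivative_commute[of u v])

lemma normal_order_Inr_mult: "normal_order (Var (Inr i) * f) p = normal_order f (pderivative i p)"
proof (induction f rule: cpoly_monomial_induct)
  case (mon m)
  have "coord_mon (m + Poly_Mapping.single (Inr i) 1) = coord_mon m"
    by (simp add: coord_mon_def lookup_add lookup_single)
  moreover have "deriv_mon (m + Poly_Mapping.single (Inr i) 1) p = deriv_mon m (pderivative i p)"
    using exhaust_2[of i]
    by (auto simp: deriv_mon_def lookup_add lookup_single pderivative_funpow_commute)
  ultimately show ?case
    by (simp only: mon_add_single[symmetric] normal_order_mon)
qed (simp_all add: distrib_left normal_order_add normal_order_cscale cscale_mult)

lemma normal_order_induct [case_names add scale one Inl Inr]:
  fixes f :: "('n::finite + 'n) cpoly"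
  assumes "\<And>p q. P p \<Longrightarrow> P q \<Longrightarrow> P (p + q)" "\<And>c p. P p \<Longrightarrow> P (cscale c p)" "P 1"
    "\<And>i p. P p \<Longrightarrow> P (Var (Inl i) * p)" "\<And>i p. P p \<Longrightarrow> P (Var (Inr i) * p)"
  shows "P f"
proof (induction f rule: cpoly_induct)
  case (Var v p)
  then show ?case using assms by (cases v) auto
qed (use assms in auto)

lemma normal_order_add_arg: "normal_order f (p + q) = normal_order f p + normal_order f q"
  by (induction f arbitrary: p q rule: normal_order_induct)
    (simp_all add: normal_order_add normal_order_cscale normal_order_Inl_mult normal_order_Inr_mult
      cpoly.scale_right_distrib distrib_left pderivative_add)

lemma normal_order_cscale_arg: "normal_order f (cscale c p) = cscale c (normal_order f p)"
  by (induction f arbitrary: p rule: normal_order_induct)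
    (simp_all add: normal_order_add normal_order_cscale normal_order_Inl_mult normal_order_Inr_mult
      cpoly.scale_right_distrib cscale_mult pderivative_cscale cpoly.scale_left_commute)

lemma normal_order_zero_arg [simp]: "normal_order f 0 = 0"
  using normal_order_cscale_arg[of f 0 0] by simp

text \<open>The Leibniz rule read on symbols: commuting with a derivative differentiates the symbol
  in a position, as commuting with a coordinate in \<open>normal_order_Var_mult_arg\<close>
  differentiates it in a momentum. Injectivity of the symbol map and the star products with
  variables rest on this pair.\<close>

lemma pderivative_normal_order:
  "pderivative i (normal_order f p) = normal_order (Var (Inr i) * f + pderivative (Inl i) f) p"
proof (induction f arbitrary: p rule: normal_order_induct)
  case one
  then show ?case using normal_order_Inr_mult[of i 1 p] by simp
next
  case (Inl j f)
  have "normal_order (Var (Inr i) * (Var (Inl j) * f)) p = Var j * normal_order (Var (Inr i) * f) p"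
    by (subst mult.left_commute) (rule normal_order_Inl_mult)
  then show ?case
    by (simp add: Inl normal_order_add normal_order_Inl_mult pderivative_Var_mult distrib_left)
next
  case (Inr j f)
  have "normal_order (Var (Inr i) * (Var (Inr j) * f)) p = normal_order (Var (Inr i) * f) (pderivative j p)"
    by (subst mult.left_commute) (rule normal_order_Inr_mult)
  then show ?case
    by (simp add: Inr normal_order_add normal_order_Inr_mult[of j] pderivative_Var_mult)
qed (simp_all add: normal_order_add normal_order_cscale distrib_left pderivative_add
      pderivative_cscale cscale_mult cpoly.scale_right_distrib)

lemma normal_order_Var_mult_arg:
  "normal_order f (Var i * p) = normal_order (Var (Inl i) * f + pderivative (Inr i) f) p"
proof (induction f arbitrary: p rule: normal_order_induct)
  case one
  then show ?case using normal_order_Inl_mult[of i 1 p] by simp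
next
  case (Inl j f)
  have "normal_order (Var (Inl i) * (Var (Inl j) * f)) p = Var j * normal_order (Var (Inl i) * f) p"
    by (subst mult.left_commute) (rule normal_order_Inl_mult)
  then show ?case
    by (simp add: Inl normal_order_add normal_order_Inl_mult[of j] pderivative_Var_mult distrib_left)
next
  case (Inr j f)
  have "normal_order (Var (Inl i) * (Var (Inr j) * f)) p = normal_order (Var (Inl i) * f) (pderivative j p)"
    by (subst mult.left_commute) (rule normal_order_Inr_mult)
  then show ?case
    by (simp add: Inr normal_order_add normal_order_add_arg normal_order_Inr_mult pderivative_Var_mult
        eq_commute[of i j])
qed (simp_all add: normal_order_add normal_order_cscale distrib_left pderivative_add
      pderivative_cscale cscale_mult cpoly.scale_right_distrib)

lemma ex_pdeg_le: "\<exists>n. f \<in> pdeg_le (int n)"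
proof
  have "mdeg m \<le> Max (insert 0 (mdeg ` Poly_Mapping.keys f))" if "m \<in> Poly_Mapping.keys f" for m
    using that by (intro Max_ge) auto
  then show "f \<in> pdeg_le (int (Max (insert 0 (mdeg ` Poly_Mapping.keys f))))"
    by (simp only: pdeg_le_def mem_Collect_eq of_nat_le_iff) blast
qed

text \<open>The partial derivatives of a symbol are the symbols of commutators, so a nonzero symbol of a
  zero operator could be differentiated until it is a nonzero constant.\<close>

lemma normal_order_eq_0:
  assumes "\<And>p. normal_order f p = 0"
  shows "f = 0"
proof -
  have *: "f \<in> pdeg_le (int n - 1) \<Longrightarrow> (\<And>p. normal_order f p = 0) \<Longrightarrow> f = 0" for n f
  proof (induction n arbitrary: f)
    case 0
    then show ?case using pdeg_le_neg[of "-1" f] by simp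
  next
    case (Suc n)
    have "pderivative v f = 0" for v
    proof (rule Suc.IH)
      show "pderivative v f \<in> pdeg_le (int n - 1)"
        using pderivative_pdeg_le[OF Suc.prems(1), of v] by simp
      show "normal_order (pderivative v f) p = 0" for p
      proof (cases v)
        case (Inl i)
        show ?thesis
          using pderivative_normal_order[of i f p] Suc.prems(2)
          by (simp add: Inl normal_order_add normal_order_Inr_mult)
      next
        case (Inr i)
        show ?thesis
          using normal_order_Var_mult_arg[of f i p] Suc.prems(2)
          by (simp add: Inr normal_order_add normal_order_Inl_mult)
      qed
    qed
    then obtain c where c: "f = cscale c 1" using constant_if_pderivatives_zero by blast
    then show ?case using Suc.prems(2)[of 1] by (simp add: normal_order_cscale)
  qed
  obtain n where "f \<in> pdeg_le (int n)" using ex_pdeg_le by blast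
  then show ?thesis using *[of f "Suc n"] assms by simp
qed

lemma linear_normal_order: "Vector_Spaces.linear cscale op_scale normal_order"
  by unfold_locales
    (simp_all add: normal_order_add normal_order_cscale op_scale_def fun_eq_iff)

lemma inj_normal_order: "inj normal_order"
proof -
  interpret Vector_Spaces.linear cscale op_scale normal_order by (rule linear_normal_order)
  show ?thesis
    using normal_order_eq_0 by (simp add: inj_iff_eq_0 fun_eq_iff)
qed

section \<open>The composition product by degree\<close>

definition poisson_half :: "('n::finite + 'n) cpoly \<Rightarrow> ('n + 'n) cpoly \<Rightarrow> ('n + 'n) cpoly" where
  "poisson_half f g = (\<Sum>i\<in>UNIV. pderivative (Inr i) f * pderivative (Inl i) g)"

lemma poisson_half_add_left: "poisson_half (f + f') g = poisson_half f g + poisson_half f' g"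
  by (simp add: poisson_half_def pderivative_add distrib_right sum.distrib)

lemma poisson_half_cscale_left: "poisson_half (cscale c f) g = cscale c (poisson_half f g)"
  by (simp add: poisson_half_def pderivative_cscale cscale_mult cpoly.scale_sum_right)

text \<open>Each contraction of a derivative in the left factor with a coordinate in the right one
  lowers the degree by 2. No contraction gives the product and one gives
  \<open>poisson_half\<close>; the 4 is the loss from two or more.\<close>

lemma normal_order_mon_product:
  assumes "g \<in> pdeg_le j"
  shows "\<exists>h \<in> pdeg_le (int (mdeg m) + j - 4).
    \<forall>p. normal_order (mon m) (normal_order g p) =
      normal_order (mon m * g + poisson_half (mon m) g + h) p"
  using assms
proof (induction m arbitrary: g j rule: exponent_induct)
  case zero
  then show ?case
    by (intro bexI[of _ 0]) (simp_all add: poisson_half_def pdeg_le_0)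
next
  case (add m v)
  show ?case
  proof (cases v)
    case v: (Inl i)
    from add.IH[OF add.prems] obtain h where h: "h \<in> pdeg_le (int (mdeg m) + j - 4)"
      "\<And>p. normal_order (mon m) (normal_order g p) =
        normal_order (mon m * g + poisson_half (mon m) g + h) p" by blast
    have "Var (Inl i) * h \<in> pdeg_le (1 + (int (mdeg m) + j - 4))"
      by (intro pdeg_le_mult Var_pdeg_le h)
    moreover have "poisson_half (Var (Inl i) * mon m) g = Var (Inl i) * poisson_half (mon m) g"
      by (simp add: poisson_half_def pderivative_Var_mult sum_distrib_left mult.assoc)
    moreover from this have "Var (Inl i) * mon m * g + poisson_half (Var (Inl i) * mon m) g + Var (Inl i) * h =
        Var (Inl i) * (mon m * g + poisson_half (mon m) g + h)"
      by (simp add: algebra_simps)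
    ultimately show ?thesis
      unfolding v mon_add_single
      by (intro bexI[of _ "Var (Inl i) * h"])
        (simp_all only: normal_order_Inl_mult h(2), simp_all add: mdeg_add mdeg_single algebra_simps)
  next
    case v: (Inr i)
    \<comment> \<open>A further derivative on the left meets \<open>g\<close> and splits by the
      Leibniz rule into these two symbols. This is why the induction quantifies over
      \<open>g\<close> and \<open>j\<close>.\<close>
    let ?g1 = "Var (Inr i) * g" and ?g2 = "pderivative (Inl i) g"
    have "?g1 \<in> pdeg_le (1 + j)" by (intro pdeg_le_mult Var_pdeg_le add.prems)
    from add.IH[OF this] obtain h1 where h1: "h1 \<in> pdeg_le (int (mdeg m) + (1 + j) - 4)"
      "\<And>p. normal_order (mon m) (normal_order ?g1 p) =
        normal_order (mon m * ?g1 + poisson_half (mon m) ?g1 + h1) p" by blast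
    have "?g2 \<in> pdeg_le (j - 1)" by (intro pderivative_pdeg_le add.prems)
    from add.IH[OF this] obtain h2 where h2: "h2 \<in> pdeg_le (int (mdeg m) + (j - 1) - 4)"
      "\<And>p. normal_order (mon m) (normal_order ?g2 p) =
        normal_order (mon m * ?g2 + poisson_half (mon m) ?g2 + h2) p" by blast
    \<comment> \<open>Contracting \<open>mon m\<close> with the already differentiated
      \<open>?g2\<close> is a second contraction, hence an error term; only
      \<open>mon m * ?g2\<close> belongs to the first order.\<close>
    have half2: "poisson_half (mon m) ?g2 \<in> pdeg_le (int (mdeg m) + j - 3)"
    proof -
      have "pderivative u (mon m) * pderivative u' ?g2 \<in> pdeg_le ((int (mdeg m) - 1) + (j - 1 - 1))" for u u'
        by (intro pdeg_le_mult pderivative_pdeg_le mon_pdeg_le add.prems)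
      then show ?thesis unfolding poisson_half_def
        by (intro pdeg_le_sum) (simp add: algebra_simps)
    qed
    define h where "h = poisson_half (mon m) ?g2 + h1 + h2"
    have h: "h \<in> pdeg_le (int (mdeg m) + j - 3)"
      unfolding h_def using h1(1) h2(1)
      by (intro pdeg_le_add half2) (auto intro: pdeg_le_mono[rotated])
    have "poisson_half (mon m) ?g1 = Var (Inr i) * poisson_half (mon m) g"
      by (simp add: poisson_half_def pderivative_Var_mult sum_distrib_left mult.left_commute)
    moreover have "poisson_half (Var (Inr i) * mon m) g = mon m * ?g2 + Var (Inr i) * poisson_half (mon m) g"
    proof -
      have "poisson_half (Var (Inr i) * mon m) g =
        (\<Sum>k\<in>UNIV. (if i = k then mon m * pderivative (Inl k) g else 0) +
          Var (Inr i) * (pderivative (Inr k) (mon m) * pderivative (Inl k) g))"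
        unfolding poisson_half_def
        by (rule sum.cong) (auto simp: pderivative_Var_mult algebra_simps)
      then show ?thesis by (simp add: sum.distrib poisson_half_def sum_distrib_left)
    qed
    ultimately have eq: "mon m * ?g1 + poisson_half (mon m) ?g1 + h1 + (mon m * ?g2 + poisson_half (mon m) ?g2 + h2) =
        Var (Inr i) * mon m * g + poisson_half (Var (Inr i) * mon m) g + h"
      by (simp add: h_def algebra_simps)
    have "normal_order (Var (Inr i) * mon m) (normal_order g p) =
        normal_order (Var (Inr i) * mon m * g + poisson_half (Var (Inr i) * mon m) g + h) p" for p
    proof -
      have "normal_order (Var (Inr i) * mon m) (normal_order g p) =
          normal_order (mon m) (normal_order ?g1 p) + normal_order (mon m) (normal_order ?g2 p)"
        by (simp only: normal_order_Inr_mult[of i "mon m"] pderivative_normal_order normal_order_add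
            normal_order_add_arg)
      also have "\<dots> = normal_order (mon m * ?g1 + poisson_half (mon m) ?g1 + h1 +
          (mon m * ?g2 + poisson_half (mon m) ?g2 + h2)) p"
        by (simp only: h1(2) h2(2) normal_order_add[symmetric])
      finally show ?thesis unfolding eq .
    qed
    moreover have "h \<in> pdeg_le (int (mdeg (m + Poly_Mapping.single (Inr i) 1)) + j - 4)"
      using h by (simp add: mdeg_add mdeg_single algebra_simps)
    ultimately show ?thesis unfolding v mon_add_single by blast
  qed
qed

lemma normal_order_product: "\<exists>h. normal_order h = normal_order f \<circ> normal_order g"
proof (induction f rule: cpoly_monomial_induct)
  case (mon m)
  obtain n where "g \<in> pdeg_le (int n)" using ex_pdeg_le by blast
  from normal_order_mon_product[OF this] show ?case by (auto simp: fun_eq_iff) metis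
next
  case (add p q)
  then obtain h h' where "normal_order h = normal_order p \<circ> normal_order g"
    "normal_order h' = normal_order q \<circ> normal_order g" by blast
  then have "normal_order (h + h') = normal_order (p + q) \<circ> normal_order g"
    by (simp add: fun_eq_iff normal_order_add)
  then show ?case ..
next
  case (scale c p)
  then obtain h where "normal_order h = normal_order p \<circ> normal_order g" by blast
  then have "normal_order (cscale c h) = normal_order (cscale c p) \<circ> normal_order g"
    by (simp add: fun_eq_iff normal_order_cscale)
  then show ?case ..
qed

text \<open>Composition pulled back along the injective \<open>normal_order\<close>. The closed
  series for this product is avoided: its values at variables and its first two orders carry the
  whole argument.\<close>

definition star :: "(2 + 2) cpoly \<Rightarrow> (2 + 2) cpoly \<Rightarrow> (2 + 2) cpoly" (infixl "\<star>" 70) where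
  "f \<star> g = inv_into UNIV normal_order (normal_order f \<circ> normal_order g)"

lemma normal_order_star: "normal_order (f \<star> g) = normal_order f \<circ> normal_order g"
  unfolding star_def using normal_order_product[of f g]
  by (intro f_inv_into_f) (metis rangeI)

lemma star_eqI: "(\<And>p. normal_order h p = normal_order f (normal_order g p)) \<Longrightarrow> f \<star> g = h"
  by (rule injD[OF inj_normal_order]) (simp add: normal_order_star fun_eq_iff)

lemma star_add_left: "(f + f') \<star> g = f \<star> g + f' \<star> g"
  by (rule star_eqI) (simp add: normal_order_add normal_order_star)

lemma star_add_right: "f \<star> (g + g') = f \<star> g + f \<star> g'"
  by (rule star_eqI) (simp add: normal_order_add normal_order_add_arg normal_order_star)

lemma star_cscale_left: "cscale c f \<star> g = cscale c (f \<star> g)"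
  by (rule star_eqI) (simp add: normal_order_cscale normal_order_star)

lemma star_cscale_right: "f \<star> cscale c g = cscale c (f \<star> g)"
  by (rule star_eqI) (simp add: normal_order_cscale normal_order_cscale_arg normal_order_star)

lemma star_one_left: "1 \<star> f = f"
  by (rule star_eqI) simp

lemma star_one_right: "f \<star> 1 = f"
  by (rule star_eqI) simp

lemma star_assoc: "(f \<star> g) \<star> h = f \<star> (g \<star> h)"
  by (rule star_eqI) (simp add: normal_order_star)

lemma Inl_star: "Var (Inl i) \<star> f = Var (Inl i) * f"
  using normal_order_Inl_mult[of i 1] by (intro star_eqI) (simp add: normal_order_Inl_mult)

lemma star_Inl: "f \<star> Var (Inl i) = Var (Inl i) * f + pderivative (Inr i) f"
  using normal_order_Inl_mult[of i 1] by (intro star_eqI) (simp add: normal_order_Var_mult_arg)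

lemma Inr_star: "Var (Inr i) \<star> f = Var (Inr i) * f + pderivative (Inl i) f"
  using normal_order_Inr_mult[of i 1] by (intro star_eqI) (simp add: pderivative_normal_order)

lemma star_Inr: "f \<star> Var (Inr i) = Var (Inr i) * f"
  using normal_order_Inr_mult[of i 1] by (intro star_eqI) (simp add: normal_order_Inr_mult)

lemma star_expansion:
  assumes "f \<in> pdeg_le i" "g \<in> pdeg_le j"
  shows "f \<star> g - f * g - poisson_half f g \<in> pdeg_le (i + j - 4)"
proof -
  have "f \<in> {f. f \<star> g - f * g - poisson_half f g \<in> pdeg_le (i + j - 4)}"
  proof (rule pdeg_le_in_subspace[OF _ assms(1)])
    show "cpoly.subspace {f. f \<star> g - f * g - poisson_half f g \<in> pdeg_le (i + j - 4)}"
    proof (rule cpoly.subspaceI; clarsimp)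
      show "0 \<star> g - poisson_half 0 g \<in> pdeg_le (i + j - 4)"
        using star_cscale_left[of 0 0 g] by (simp add: poisson_half_def pdeg_le_0)
    next
      fix x y
      assume "x \<star> g - x * g - poisson_half x g \<in> pdeg_le (i + j - 4)"
        "y \<star> g - y * g - poisson_half y g \<in> pdeg_le (i + j - 4)"
      from pdeg_le_add[OF this]
      show "(x + y) \<star> g - (x + y) * g - poisson_half (x + y) g \<in> pdeg_le (i + j - 4)"
        by (simp add: star_add_left distrib_right poisson_half_add_left algebra_simps)
    next
      fix c x
      assume "x \<star> g - x * g - poisson_half x g \<in> pdeg_le (i + j - 4)"
      from pdeg_le_cscale[OF this, of c]
      show "cscale c x \<star> g - cscale c x * g - poisson_half (cscale c x) g \<in> pdeg_le (i + j - 4)"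
        by (simp add: star_cscale_left cscale_mult poisson_half_cscale_left cpoly.scale_right_diff_distrib)
    qed
    fix m :: "2 + 2 \<Rightarrow>\<^sub>0 nat" assume m: "int (mdeg m) \<le> i"
    obtain h where h: "h \<in> pdeg_le (int (mdeg m) + j - 4)"
      "\<And>p. normal_order (mon m) (normal_order g p) =
        normal_order (mon m * g + poisson_half (mon m) g + h) p"
      using normal_order_mon_product[OF assms(2)] by blast
    have "mon m \<star> g = mon m * g + poisson_half (mon m) g + h"
      by (rule star_eqI) (simp add: h(2))
    then have "mon m \<star> g - mon m * g - poisson_half (mon m) g = h" by simp
    then show "mon m \<in> {f. f \<star> g - f * g - poisson_half f g \<in> pdeg_le (i + j - 4)}"
      using h(1) m by (auto intro: pdeg_le_mono[rotated])
  qed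
  then show ?thesis by simp
qed

definition star_commutator :: "(2 + 2) cpoly \<Rightarrow> (2 + 2) cpoly \<Rightarrow> (2 + 2) cpoly" where
  "star_commutator f g = f \<star> g - g \<star> f"

text \<open>The commutative products cancel and the two halves combine to minus the bracket, whence
  the plus sign. What remains has lost four degrees, two more than the bracket itself.\<close>

lemma star_commutator_expansion:
  assumes "f \<in> pdeg_le i" "g \<in> pdeg_le j"
  shows "star_commutator f g + poisson_bracket f g \<in> pdeg_le (i + j - 4)"
proof -
  have "(f \<star> g - f * g - poisson_half f g) - (g \<star> f - g * f - poisson_half g f) \<in> pdeg_le (i + j - 4)"
    by (rule pdeg_le_diff[OF star_expansion[OF assms]])
      (use star_expansion[OF assms(2,1)] in \<open>simp add: add.commute\<close>)
  moreover have "poisson_bracket f g = poisson_half g f - poisson_half f g"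
    by (simp add: poisson_bracket_def poisson_half_def sum_subtractf mult.commute)
  then have "star_commutator f g + poisson_bracket f g =
      (f \<star> g - f * g - poisson_half f g) - (g \<star> f - g * f - poisson_half g f)"
    by (simp add: star_commutator_def mult.commute)
  ultimately show ?thesis by simp
qed

text \<open>The generating rules of \<open>weyl_algebra\<close> are matched one by one; closure of
  the range under composition is the existence of the product \<open>\<star>\<close>.\<close>

lemma range_normal_order: "range normal_order = weyl_algebra"
proof (intro equalityI subsetI)
  fix D assume "D \<in> range normal_order"
  then obtain f where "D = normal_order f" by blast
  moreover have "normal_order f \<in> weyl_algebra"
  proof (induction f rule: normal_order_induct)
    case (add p q)
    have "normal_order (p + q) = (\<lambda>r. normal_order p r + normal_order q r)"
      by (simp add: fun_eq_iff normal_order_add)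
    then show ?case using add by (simp add: weyl_algebra.sum)
  next
    case (scale c p)
    have "normal_order (cscale c p) = cscale c \<circ> normal_order p"
      by (simp add: fun_eq_iff normal_order_cscale)
    then show ?case using weyl_algebra.comp[OF weyl_algebra.scalar scale] by metis
  next
    case one
    have "normal_order 1 = cscale 1" by (simp add: fun_eq_iff)
    then show ?case using weyl_algebra.scalar by metis
  next
    case (Inl i p)
    have "normal_order (Var (Inl i) * p) = (\<lambda>p. Var i * p) \<circ> normal_order p"
      by (simp add: fun_eq_iff normal_order_Inl_mult)
    then show ?case using weyl_algebra.comp[OF weyl_algebra.coordinate Inl] by metis
  next
    case (Inr i p)
    have "normal_order (Var (Inr i) * p) = normal_order p \<circ> pderivative i"
      by (simp add: fun_eq_iff normal_order_Inr_mult)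
    then show ?case using weyl_algebra.comp[OF Inr weyl_algebra.partial] by metis
  qed
  ultimately show "D \<in> weyl_algebra" by simp
next
  fix D :: "2 pop" assume "D \<in> weyl_algebra"
  then show "D \<in> range normal_order"
  proof induction
    case (scalar c)
    have "normal_order (cscale c 1) = cscale c" by (simp add: fun_eq_iff normal_order_cscale)
    then show ?case by (metis rangeI)
  next
    case (coordinate i)
    have "normal_order (Var (Inl i)) = (\<lambda>p. Var i * p)"
      using normal_order_Inl_mult[of i 1] by (simp add: fun_eq_iff)
    then show ?case by (metis rangeI)
  next
    case (partial i)
    have "normal_order (Var (Inr i)) = pderivative i"
      using normal_order_Inr_mult[of i 1] by (simp add: fun_eq_iff)
    then show ?case by (metis rangeI)
  next
    case (sum D E)
    then obtain f g where "D = normal_order f" "E = normal_order g" by blast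
    then have "normal_order (f + g) = (\<lambda>p. D p + E p)" by (simp add: fun_eq_iff normal_order_add)
    then show ?case by (metis rangeI)
  next
    case (comp D E)
    then obtain f g where "D = normal_order f" "E = normal_order g" by blast
    then have "normal_order (f \<star> g) = D \<circ> E" by (simp add: normal_order_star)
    then show ?case by (metis rangeI)
  qed
qed

subsection \<open>Equivariance\<close>

lemma act_poly_Var: "act_poly g (Var i) = (\<Sum>j\<in>UNIV. cscale (matrix_inv g $ i $ j) (Var j))"
  by (simp add: act_poly_def)

lemma act_poly_mult: "act_poly g (p * q) = act_poly g p * act_poly g q"
  by (simp add: act_poly_def poly_subst_mult)

lemma act_poly_add: "act_poly g (p + q) = act_poly g p + act_poly g q"
  by (simp add: act_poly_def poly_subst_add)

lemma act_poly_cscale: "act_poly g (cscale c p) = cscale c (act_poly g p)"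
  by (simp add: act_poly_def poly_subst_cscale)

lemma act_poly_one [simp]: "act_poly g 1 = 1"
  by (simp add: act_poly_def)

lemma act_poly_zero [simp]: "act_poly g 0 = 0"
  by (simp add: act_poly_def)

lemma act_poly_sum: "act_poly g (\<Sum>i\<in>I. f i) = (\<Sum>i\<in>I. act_poly g (f i))"
  by (simp add: act_poly_def poly_subst_sum)

lemma act_poly_inverse:
  assumes "invertible g"
  shows "act_poly g (act_poly (matrix_inv g) p) = p"
proof (induction p rule: cpoly_induct)
  case (Var v p)
  have "act_poly g (act_poly (matrix_inv g) (Var v)) =
      (\<Sum>k\<in>UNIV. \<Sum>j\<in>UNIV. cscale (g $ v $ k * matrix_inv g $ k $ j) (Var j))"
    by (simp add: act_poly_Var matrix_inv_involutive[OF assms] act_poly_sum act_poly_cscale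
        cpoly.scale_sum_right)
  also have "\<dots> = (\<Sum>j\<in>UNIV. cscale ((g ** matrix_inv g) $ v $ j) (Var j))"
    by (subst sum.swap) (simp add: matrix_matrix_mult_def cpoly.scale_sum_left)
  also have "\<dots> = Var v"
    unfolding matrix_inv_inverse(1)[OF assms] by (simp add: mat_def sum_if_cscale)
  finally show ?case by (simp add: act_poly_mult Var)
qed (simp_all add: act_poly_add act_poly_cscale)

text \<open>The chain rule: the left side differentiates along the \<open>i\<close>-th column of
  \<open>g\<close>, a direction that substituting by the inverse of \<open>g\<close> pulls back to
  the \<open>i\<close>-th basis vector.\<close>

lemma pderivative_act_poly:
  assumes "invertible g"
  shows "(\<Sum>j\<in>UNIV. cscale (g $ j $ i) (pderivative j (act_poly g p))) = act_poly g (pderivative i p)"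
proof (induction p rule: cpoly_induct)
  case (add p q)
  then show ?case
    by (simp add: act_poly_add pderivative_add cpoly.scale_right_distrib sum.distrib)
next
  case (scale c p)
  have "(\<Sum>j\<in>UNIV. cscale (g $ j $ i) (pderivative j (act_poly g (cscale c p)))) =
      cscale c (\<Sum>j\<in>UNIV. cscale (g $ j $ i) (pderivative j (act_poly g p)))"
    by (simp add: act_poly_cscale pderivative_cscale cpoly.scale_sum_right mult.commute)
  then show ?case by (simp add: scale pderivative_cscale act_poly_cscale)
next
  case (Var v p)
  have "(\<Sum>j\<in>UNIV. cscale (g $ j $ i) (pderivative j (act_poly g (Var v)))) =
      (\<Sum>j\<in>UNIV. cscale (matrix_inv g $ v $ j * g $ j $ i) 1)"
  proof (rule sum.cong)
    fix j
    have "pderivative j (act_poly g (Var v)) = (\<Sum>k\<in>UNIV. if k = j then cscale (matrix_inv g $ v $ k) 1 else 0)"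
      unfolding act_poly_Var pderivative_sum
      by (rule sum.cong) (auto simp: pderivative_cscale pderivative_Var)
    then show "cscale (g $ j $ i) (pderivative j (act_poly g (Var v))) =
        cscale (matrix_inv g $ v $ j * g $ j $ i) 1"
      by (simp add: mult.commute)
  qed simp
  also have "\<dots> = cscale ((matrix_inv g ** g) $ v $ i) 1"
    by (simp add: matrix_matrix_mult_def cpoly.scale_sum_left)
  also have "\<dots> = (if v = i then 1 else 0)"
    unfolding matrix_inv_inverse(2)[OF assms] by (simp add: mat_def)
  finally have V: "(\<Sum>j\<in>UNIV. cscale (g $ j $ i) (pderivative j (act_poly g (Var v)))) =
      (if v = i then 1 else 0)" .
  have "(\<Sum>j\<in>UNIV. cscale (g $ j $ i) (pderivative j (act_poly g (Var v * p)))) =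
      (\<Sum>j\<in>UNIV. cscale (g $ j $ i) (pderivative j (act_poly g (Var v)))) * act_poly g p +
      act_poly g (Var v) * (\<Sum>j\<in>UNIV. cscale (g $ j $ i) (pderivative j (act_poly g p)))"
    by (simp add: act_poly_mult pderivative_mult cpoly.scale_right_distrib sum.distrib
        sum_distrib_left sum_distrib_right cscale_mult)
  then show ?case
    unfolding V Var pderivative_Var_mult act_poly_add act_poly_mult by simp
qed simp

lemma normal_order_sum: "normal_order (\<Sum>i\<in>I. f i) p = (\<Sum>i\<in>I. normal_order (f i) p)"
  by (induction I rule: infinite_finite_induct) (simp_all add: normal_order_add)

lemma normal_order_sum_arg: "normal_order f (\<Sum>i\<in>I. p i) = (\<Sum>i\<in>I. normal_order f (p i))"
  by (induction I rule: infinite_finite_induct) (simp_all add: normal_order_add_arg)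

text \<open>A linear map of the base mixes positions only with positions and momenta only with
  momenta, so it respects normal ordering. Taking \<open>act_poly g p\<close> as the argument keeps
  conjugation out of the induction.\<close>

lemma normal_order_act_double:
  assumes "invertible g"
  shows "normal_order (act_double g f) (act_poly g p) = act_poly g (normal_order f p)"
proof (induction f arbitrary: p rule: normal_order_induct)
  case (Inl i f)
  then show ?case
    by (simp add: act_double_mult act_double_Var sum_distrib_right normal_order_sum cscale_mult
        normal_order_cscale normal_order_Inl_mult act_poly_mult act_poly_Var)
next
  case (Inr i f)
  have "normal_order (act_double g (Var (Inr i) * f)) (act_poly g p) =
      normal_order (act_double g f) (\<Sum>j\<in>UNIV. cscale (g $ j $ i) (pderivative j (act_poly g p)))"
    by (simp add: act_double_mult act_double_Var sum_distrib_right normal_order_sum cscale_mult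
        normal_order_cscale normal_order_Inr_mult normal_order_sum_arg normal_order_cscale_arg)
  then show ?case
    by (simp add: pderivative_act_poly[OF assms] Inr normal_order_Inr_mult)
qed (simp_all add: act_double_add act_double_cscale normal_order_add normal_order_cscale
      act_poly_add act_poly_cscale)

lemma act_op_normal_order:
  assumes "invertible g"
  shows "act_op g (normal_order f) = normal_order (act_double g f)"
  using normal_order_act_double[OF assms, of f "act_poly (matrix_inv g) p" for p]
  by (simp add: act_op_def fun_eq_iff act_poly_inverse[OF assms])

lemma act_double_star:
  assumes "invertible g"
  shows "act_double g (f \<star> h) = act_double g f \<star> act_double g h"
proof (rule star_eqI[symmetric])
  fix p
  define q where "q = act_poly (matrix_inv g) p"
  have p: "p = act_poly g q" by (simp add: q_def act_poly_inverse[OF assms])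
  show "normal_order (act_double g (f \<star> h)) p =
      normal_order (act_double g f) (normal_order (act_double g h) p)"
    by (simp add: p normal_order_act_double[OF assms] normal_order_star)
qed

lemma act_double_star_commutator:
  "invertible g \<Longrightarrow>
    act_double g (star_commutator f h) = star_commutator (act_double g f) (act_double g h)"
  by (simp add: star_commutator_def act_double_diff act_double_star)

lemma invariant_ops_eq:
  assumes "\<And>g. g \<in> W \<Longrightarrow> invertible g"
  shows "invariant_ops W = normal_order ` invariant_polys W"
  using assms inj_normal_order
  by (auto simp: invariant_ops_def invariant_polys_def range_normal_order[symmetric]
      act_op_normal_order inj_eq)

lemma commutator_span_eq:
  assumes "\<And>g. g \<in> W \<Longrightarrow> invertible g"
  shows "pop.span {(\<lambda>p. D (E p) - E (D p)) | D E. D \<in> invariant_ops W \<and> E \<in> invariant_ops W} =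
    normal_order ` bracket_span star_commutator W"
proof -
  interpret Vector_Spaces.linear cscale op_scale normal_order by (rule linear_normal_order)
  have inv: "invariant_ops W = normal_order ` invariant_polys W"
    by (rule invariant_ops_eq) (rule assms)
  have com: "normal_order (star_commutator f g) =
      (\<lambda>p. normal_order f (normal_order g p) - normal_order g (normal_order f p))" for f g
    by (simp add: star_commutator_def diff normal_order_star fun_eq_iff)
  have "{(\<lambda>p. D (E p) - E (D p)) | D E. D \<in> invariant_ops W \<and> E \<in> invariant_ops W} =
      normal_order ` {star_commutator f g | f g. f \<in> invariant_polys W \<and> g \<in> invariant_polys W}"
    (is "?L = ?R")
  proof (intro equalityI subsetI)
    fix x assume "x \<in> ?L"
    then obtain D E where x: "x = (\<lambda>p. D (E p) - E (D p))"
      and DE: "D \<in> invariant_ops W" "E \<in> invariant_ops W"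
      unfolding mem_Collect_eq by (elim exE conjE) (rule that)
    from DE[unfolded inv]
    obtain f g where fg: "f \<in> invariant_polys W" "g \<in> invariant_polys W"
      "D = normal_order f" "E = normal_order g"
      by (elim imageE) (rule that)
    have "x = normal_order (star_commutator f g)"
      unfolding x com fg(3,4) by (rule HOL.refl)
    then show "x \<in> ?R" using fg(1,2) by blast
  next
    fix x assume "x \<in> ?R"
    then obtain f g where fg: "f \<in> invariant_polys W" "g \<in> invariant_polys W"
      and x: "x = normal_order (star_commutator f g)"
      by blast
    show "x \<in> ?L"
      unfolding inv x com mem_Collect_eq
      by (intro exI conjI, rule HOL.refl) (use fg in simp_all)
  qed
  then show ?thesis by (simp add: bracket_span_def span_image)
qed

section \<open>Poisson brackets of dihedral invariants\<close>

definition swap_matrix :: "complex \<Rightarrow> complex^2^2" where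
  "swap_matrix \<zeta> = vector [vector [0, \<zeta>], vector [inverse \<zeta>, 0]]"

text \<open>Only two generating reflections, since invariance under generators is invariance under
  the group. Their product is diagonal with entries \<open>inverse \<zeta>\<close> and
  \<open>\<zeta>\<close>.\<close>

definition dihedral :: "complex \<Rightarrow> (complex^2^2) set" where
  "dihedral \<zeta> = {swap_matrix 1, swap_matrix \<zeta>}"

lemma swap_matrix_nth [simp]:
  "swap_matrix \<zeta> $ 1 $ 1 = 0" "swap_matrix \<zeta> $ 1 $ 2 = \<zeta>"
  "swap_matrix \<zeta> $ 2 $ 1 = inverse \<zeta>" "swap_matrix \<zeta> $ 2 $ 2 = 0"
  by (simp_all add: swap_matrix_def)

lemma swap_matrix_involution: "\<zeta> \<noteq> 0 \<Longrightarrow> swap_matrix \<zeta> ** swap_matrix \<zeta> = mat 1"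
  by (simp add: vec_eq_iff forall_2 matrix_matrix_mult_def sum_2 mat_def)

lemma invertible_swap_matrix: "\<zeta> \<noteq> 0 \<Longrightarrow> invertible (swap_matrix \<zeta>)"
  using swap_matrix_involution invertible_def by blast

lemma matrix_inv_swap_matrix: "\<zeta> \<noteq> 0 \<Longrightarrow> matrix_inv (swap_matrix \<zeta>) = swap_matrix \<zeta>"
  by (simp add: matrix_inv_unique swap_matrix_involution)

lemma act_double_swap_matrix_Var:
  assumes "\<zeta> \<noteq> 0"
  shows "act_double (swap_matrix \<zeta>) (Var (Inl 1)) = cscale \<zeta> (Var (Inl 2))"
    "act_double (swap_matrix \<zeta>) (Var (Inl 2)) = cscale (inverse \<zeta>) (Var (Inl 1))"
    "act_double (swap_matrix \<zeta>) (Var (Inr 1)) = cscale (inverse \<zeta>) (Var (Inr 2))"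
    "act_double (swap_matrix \<zeta>) (Var (Inr 2)) = cscale \<zeta> (Var (Inr 1))"
  using assms by (simp_all add: act_double_Var matrix_inv_swap_matrix sum_2)

text \<open>The rotations multiply \<open>Inl 1\<close> and \<open>Inr 2\<close> by one scalar, \<open>Inl 2\<close> and \<open>Inr 1\<close> by its inverse;
  hence this order of the exponents.\<close>

definition monomial4 :: "nat \<Rightarrow> nat \<Rightarrow> nat \<Rightarrow> nat \<Rightarrow> (2 + 2) cpoly" where
  "monomial4 a b c d = Var (Inl 1) ^ a * Var (Inr 2) ^ b * Var (Inl 2) ^ c * Var (Inr 1) ^ d"

definition sym_monomial :: "nat \<Rightarrow> nat \<Rightarrow> nat \<Rightarrow> nat \<Rightarrow> (2 + 2) cpoly" where
  "sym_monomial a b c d = monomial4 a b c d + monomial4 c d a b"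

lemma UNIV_2_plus_2: "(UNIV :: (2 + 2) set) = {Inl 1, Inl 2, Inr 1, Inr 2}"
  using exhaust_2 by (auto simp: UNIV_sum image_iff)

lemma mon_eq_monomial4:
  "mon m = monomial4 (Poly_Mapping.lookup m (Inl 1)) (Poly_Mapping.lookup m (Inr 2))
    (Poly_Mapping.lookup m (Inl 2)) (Poly_Mapping.lookup m (Inr 1))"
  unfolding mon_eq_prod by (simp add: UNIV_2_plus_2 monomial4_def mult_ac)

lemma mdeg_2_plus_2:
  fixes m :: "2 + 2 \<Rightarrow>\<^sub>0 nat"
  shows "mdeg m = Poly_Mapping.lookup m (Inl 1) + Poly_Mapping.lookup m (Inr 2) +
    Poly_Mapping.lookup m (Inl 2) + Poly_Mapping.lookup m (Inr 1)"
  by (simp add: mdeg_def UNIV_2_plus_2)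

lemma cscale_2: "cscale 2 p = p + p"
  using cpoly.scale_left_distrib[of 1 1 p] by simp

lemma cscale_power: "cscale c p ^ n = cscale (c ^ n) (p ^ n)"
  by (induction n) (simp_all add: cscale_mult mult.commute)

lemma act_double_swap_matrix_monomial4:
  assumes "\<zeta> \<noteq> 0"
  shows "act_double (swap_matrix \<zeta>) (monomial4 a b c d) =
    cscale (\<zeta> ^ (a + b) * inverse \<zeta> ^ (c + d)) (monomial4 c d a b)"
  by (simp add: monomial4_def act_double_mult act_double_power act_double_swap_matrix_Var[OF assms]
      cscale_power cscale_mult power_add mult_ac)

lemma monomial4_pdeg_le: "monomial4 a b c d \<in> pdeg_le (int (a + b + c + d))"
  unfolding monomial4_def of_nat_add by (intro pdeg_le_mult Var_power_pdeg_le)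

lemma sym_monomial_pdeg_le: "sym_monomial a b c d \<in> pdeg_le (int (a + b + c + d))"
  unfolding sym_monomial_def using monomial4_pdeg_le[of c d a b]
  by (intro pdeg_le_add monomial4_pdeg_le) (simp add: ac_simps)

lemma pderivative_monomial4:
  "pderivative (Inl 1) (monomial4 a b c d) = cscale (of_nat a) (monomial4 (a - 1) b c d)"
  "pderivative (Inr 2) (monomial4 a b c d) = cscale (of_nat b) (monomial4 a (b - 1) c d)"
  "pderivative (Inl 2) (monomial4 a b c d) = cscale (of_nat c) (monomial4 a b (c - 1) d)"
  "pderivative (Inr 1) (monomial4 a b c d) = cscale (of_nat d) (monomial4 a b c (d - 1))"
  by (simp_all add: monomial4_def pderivative_mult pderivative_power pderivative_Var cscale_mult)

lemma Var_mult_monomial4: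
  "Var (Inl 1) * monomial4 a b c d = monomial4 (Suc a) b c d"
  "Var (Inr 2) * monomial4 a b c d = monomial4 a (Suc b) c d"
  "Var (Inl 2) * monomial4 a b c d = monomial4 a b (Suc c) d"
  "Var (Inr 1) * monomial4 a b c d = monomial4 a b c (Suc d)"
  by (simp_all add: monomial4_def mult_ac)

text \<open>Differentiating and multiplying back leaves the exponent \<open>Suc (n - Suc 0)\<close>,
  which differs from \<open>n\<close> only at 0, where the coefficient vanishes.\<close>

lemma cscale_of_nat_Suc_pred: "cscale (of_nat n) (F (Suc (n - Suc 0))) = cscale (of_nat n) (F n)"
  by (cases n) simp_all

lemmas cscale_monomial4_Suc_pred =
  cscale_of_nat_Suc_pred[where F = "\<lambda>a. monomial4 a b c d" for b c d]
  cscale_of_nat_Suc_pred[where F = "\<lambda>b. monomial4 a b c d" for a c d]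
  cscale_of_nat_Suc_pred[where F = "\<lambda>c. monomial4 a b c d" for a b d]
  cscale_of_nat_Suc_pred[where F = "\<lambda>d. monomial4 a b c d" for a b c]

lemma monomial4_mult:
  "monomial4 a b c d * monomial4 a' b' c' d' = monomial4 (a + a') (b + b') (c + c') (d + d')"
  by (simp add: monomial4_def power_add mult_ac)

lemma poisson_bracket_2:
  fixes f g :: "(2 + 2) cpoly"
  shows "poisson_bracket f g =
    pderivative (Inl 1) f * pderivative (Inr 1) g - pderivative (Inr 1) f * pderivative (Inl 1) g +
    (pderivative (Inl 2) f * pderivative (Inr 2) g - pderivative (Inr 2) f * pderivative (Inl 2) g)"
  by (simp add: poisson_bracket_def sum_2)

text \<open>Only \<open>a + b\<close> and \<open>c + d\<close> enter, so every relation that moves a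
  factor within one of the pairs \<open>z, q\<close> and \<open>w, p\<close> preserves the
  condition.\<close>

definition rotation_invariant :: "complex \<Rightarrow> nat \<Rightarrow> nat \<Rightarrow> nat \<Rightarrow> nat \<Rightarrow> bool" where
  "rotation_invariant \<zeta> a b c d \<longleftrightarrow> \<zeta> ^ (a + b) = \<zeta> ^ (c + d)"

lemma sym_monomial_invariant:
  assumes "\<zeta> \<noteq> 0" "rotation_invariant \<zeta> a b c d"
  shows "sym_monomial a b c d \<in> invariant_polys (dihedral \<zeta>)"
proof -
  have "\<zeta> ^ (a + b) * inverse \<zeta> ^ (c + d) = 1" "\<zeta> ^ (c + d) * inverse \<zeta> ^ (a + b) = 1"
    using assms by (simp_all add: rotation_invariant_def power_inverse)
  then show ?thesis
    using assms(1)
    by (simp add: invariant_polys_def dihedral_def sym_monomial_def act_double_add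
        act_double_swap_matrix_monomial4 add.commute)
qed

text \<open>The product \<open>r\<close> of the two reflections is diagonal on monomials, so an
  invariant contains only monomials with eigenvalue 1. Adding its image under the exchange doubles
  it and symmetrizes each monomial.\<close>

lemma invariant_polys_in_span_sym_monomial:
  assumes \<zeta>: "\<zeta> \<noteq> 0" and f: "f \<in> invariant_polys (dihedral \<zeta>)" "f \<in> pdeg_le n"
  shows "f \<in> cpoly.span {sym_monomial a b c d | a b c d.
    rotation_invariant \<zeta> a b c d \<and> int (a + b + c + d) \<le> n}" (is "f \<in> cpoly.span ?S")
proof -
  define \<rho> where "\<rho> m = \<zeta> ^ (Poly_Mapping.lookup m (Inl 2) + Poly_Mapping.lookup m (Inr 1)) *
    inverse \<zeta> ^ (Poly_Mapping.lookup m (Inl 1) + Poly_Mapping.lookup m (Inr 2))"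
    for m :: "2 + 2 \<Rightarrow>\<^sub>0 nat"
  define r where "r g = act_double (swap_matrix \<zeta>) (act_double (swap_matrix 1) g)" for g
  have r_mon: "r (mon m) = cscale (\<rho> m) (mon m)" for m
    by (simp add: r_def mon_eq_monomial4 act_double_swap_matrix_monomial4 \<zeta> \<rho>_def)
  have "Poly_Mapping.lookup (r g) m = \<rho> m * Poly_Mapping.lookup g m" for g m
  proof (induction g rule: cpoly_monomial_induct)
    case (mon n)
    show ?case unfolding r_mon by (auto simp: lookup_single when_def)
  qed (simp_all add: r_def act_double_add act_double_cscale lookup_add algebra_simps)
  moreover have "r f = f" using f(1) by (simp add: r_def invariant_polys_def dihedral_def)
  ultimately have \<rho>_1: "\<rho> m = 1" if "m \<in> Poly_Mapping.keys f" for m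
    using that by (metis in_keys_iff mult_cancel_right1)
  \<comment> \<open>The condition is linear in \<open>g\<close>, so it can be tested on the
    monomials of \<open>f\<close>, which are not invariant themselves.\<close>
  let ?V = "{g. g + act_double (swap_matrix 1) g \<in> cpoly.span ?S}"
  have "f \<in> ?V"
  proof (rule cpoly_in_subspace)
    show "cpoly.subspace ?V"
    proof (rule cpoly.subspaceI; simp only: mem_Collect_eq)
      show "0 + act_double (swap_matrix 1) 0 \<in> cpoly.span ?S" by (simp add: cpoly.span_zero)
    next
      fix x y
      assume "x + act_double (swap_matrix 1) x \<in> cpoly.span ?S"
        "y + act_double (swap_matrix 1) y \<in> cpoly.span ?S"
      from cpoly.span_add[OF this]
      show "x + y + act_double (swap_matrix 1) (x + y) \<in> cpoly.span ?S"
        by (simp add: act_double_add algebra_simps)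
    next
      fix c x
      assume "x + act_double (swap_matrix 1) x \<in> cpoly.span ?S"
      from cpoly.span_scale[OF this, of c]
      show "cscale c x + act_double (swap_matrix 1) (cscale c x) \<in> cpoly.span ?S"
        by (simp add: act_double_cscale cpoly.scale_right_distrib)
    qed
    fix m assume m: "m \<in> Poly_Mapping.keys f"
    let ?a = "Poly_Mapping.lookup m (Inl 1)" and ?b = "Poly_Mapping.lookup m (Inr 2)"
      and ?c = "Poly_Mapping.lookup m (Inl 2)" and ?d = "Poly_Mapping.lookup m (Inr 1)"
    have "rotation_invariant \<zeta> ?a ?b ?c ?d"
      using \<rho>_1[OF m] \<zeta> by (simp add: \<rho>_def rotation_invariant_def power_inverse divide_simps)
    moreover have "int (?a + ?b + ?c + ?d) \<le> n"
      using f(2) m by (simp add: pdeg_le_def mdeg_2_plus_2)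
    moreover have "mon m + act_double (swap_matrix 1) (mon m) = sym_monomial ?a ?b ?c ?d"
      by (simp add: mon_eq_monomial4 act_double_swap_matrix_monomial4 sym_monomial_def)
    ultimately show "mon m \<in> ?V"
      by (auto intro!: cpoly.span_base)
  qed
  then have "cscale (1/2) (f + f) \<in> cpoly.span ?S"
    using f(1) by (auto simp: invariant_polys_def dihedral_def intro: cpoly.span_scale)
  moreover have "cscale (1/2) (f + f) = f"
    by (simp flip: cscale_2)
  ultimately show ?thesis by simp
qed

text \<open>The bound is put on the factors and not on the bracket: replacing a bracket by a
  commutator costs an error governed by the degrees of the factors, which may be large although the
  bracket is small.\<close>

definition graded_brackets :: "complex \<Rightarrow> int \<Rightarrow> (2 + 2) cpoly set" where
  "graded_brackets \<zeta> n = {poisson_bracket f g | f g i j.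
    f \<in> invariant_polys (dihedral \<zeta>) \<and> g \<in> invariant_polys (dihedral \<zeta>) \<and>
    f \<in> pdeg_le i \<and> g \<in> pdeg_le j \<and> i + j - 2 \<le> n}"

lemma graded_brackets_mono: "n \<le> n' \<Longrightarrow> graded_brackets \<zeta> n \<subseteq> graded_brackets \<zeta> n'"
  unfolding graded_brackets_def by fastforce

text \<open>These are the \<open>e\<^sub>k\<close> of the overview, namely
  \<open>z^k p^k + w^k q^k\<close>; in particular \<open>radial 0\<close> is the constant 2.\<close>

definition radial :: "nat \<Rightarrow> (2 + 2) cpoly" where
  "radial k = sym_monomial k 0 0 k"

lemma subspace_cscale_cancel:
  assumes "cpoly.subspace V" "cscale c x \<in> V" "c \<noteq> 0"
  shows "x \<in> V"
  using cpoly.subspace_scale[OF assms(1,2), of "inverse c"] assms(3) by simp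

section \<open>Relations between invariants modulo Poisson brackets\<close>

context
  fixes \<zeta> :: complex
  assumes \<zeta>: "\<zeta> \<noteq> 0"
begin

abbreviation nb :: "nat \<Rightarrow> (2 + 2) cpoly set" where
  "nb n \<equiv> cpoly.span (graded_brackets \<zeta> (int n))"

lemma bracket_sym_monomial_in_nb:
  assumes "rotation_invariant \<zeta> a b c d" "rotation_invariant \<zeta> a' b' c' d'"
    "a + b + c + d + a' + b' + c' + d' = n + 2"
  shows "poisson_bracket (sym_monomial a b c d) (sym_monomial a' b' c' d') \<in> nb n"
proof (rule cpoly.span_base)
  have "int (a + b + c + d) + int (a' + b' + c' + d') - 2 \<le> int n" using assms(3) by simp
  then show "poisson_bracket (sym_monomial a b c d) (sym_monomial a' b' c' d')
      \<in> graded_brackets \<zeta> (int n)"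
    unfolding graded_brackets_def
    using sym_monomial_invariant[OF \<zeta>] assms(1,2) sym_monomial_pdeg_le by blast
qed

text \<open>Bracketing with \<open>z p + w q\<close> multiplies a monomial by its number of momenta
  minus its number of positions. Whatever has nonzero weight is therefore a multiple of a
  bracket.\<close>

lemma sym_monomial_weight_relation:
  assumes "rotation_invariant \<zeta> a b c d" "a + c \<noteq> b + d"
  shows "sym_monomial a b c d \<in> nb (a + b + c + d)"
proof -
  have "poisson_bracket (sym_monomial 1 0 0 1) (sym_monomial a b c d) =
      cscale (of_nat b + of_nat d - of_nat a - of_nat c) (sym_monomial a b c d)"
  proof -
    have br: "poisson_bracket (sym_monomial 1 0 0 1) (monomial4 a b c d) =
        cscale (of_nat b + of_nat d - of_nat a - of_nat c) (monomial4 a b c d)" for a b c d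
      by (simp add: poisson_bracket_2 sym_monomial_def pderivative_add pderivative_monomial4
          distrib_right cscale_mult monomial4_mult cpoly.scale_left_distrib
          cpoly.scale_left_diff_distrib cscale_monomial4_Suc_pred)
    show ?thesis
      unfolding sym_monomial_def[of a] poisson_bracket_add_right br cpoly.scale_right_distrib
      by (simp add: algebra_simps)
  qed
  moreover have "of_nat b + of_nat d - of_nat a - of_nat c \<noteq> (0::complex)"
    using assms(2) by (simp add: algebra_simps flip: of_nat_add)
  moreover have "poisson_bracket (sym_monomial 1 0 0 1) (sym_monomial a b c d) \<in> nb (a + b + c + d)"
    by (rule bracket_sym_monomial_in_nb) (use assms in \<open>simp_all add: rotation_invariant_def\<close>)
  ultimately show ?thesis
    using subspace_cscale_cancel[OF cpoly.subspace_span] by metis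
qed

text \<open>Bracketing with \<open>z w\<close> turns one \<open>q\<close> into \<open>z\<close> or
  one \<open>p\<close> into \<open>w\<close>, with the exponent as coefficient. Symmetrizing
  \<open>z w\<close> doubles it, so a factor 2 is cancelled at the end.\<close>

lemma sym_monomial_raise_relation:
  assumes "rotation_invariant \<zeta> a b c d"
  shows "cscale (of_nat b) (sym_monomial (Suc a) (b - 1) c d) +
    cscale (of_nat d) (sym_monomial a b (Suc c) (d - 1)) \<in> nb (a + b + c + d)"
proof -
  have zw: "sym_monomial 1 0 1 0 = cscale 2 (monomial4 1 0 1 0)"
    unfolding sym_monomial_def cscale_2 ..
  have br: "poisson_bracket (monomial4 1 0 1 0) (monomial4 a b c d) =
      cscale (of_nat b) (monomial4 (Suc a) (b - 1) c d) +
      cscale (of_nat d) (monomial4 a b (Suc c) (d - 1))" for a b c d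
    by (simp add: poisson_bracket_2 pderivative_monomial4 cscale_mult monomial4_mult)
  have "poisson_bracket (monomial4 1 0 1 0) (sym_monomial a b c d) =
      cscale (of_nat b) (sym_monomial (Suc a) (b - 1) c d) +
      cscale (of_nat d) (sym_monomial a b (Suc c) (d - 1))"
    unfolding sym_monomial_def poisson_bracket_add_right br
    by (simp add: cpoly.scale_right_distrib algebra_simps)
  moreover have "poisson_bracket (sym_monomial 1 0 1 0) (sym_monomial a b c d) \<in> nb (a + b + c + d)"
    by (rule bracket_sym_monomial_in_nb) (use assms in \<open>simp_all add: rotation_invariant_def\<close>)
  ultimately have "cscale 2 (cscale (of_nat b) (sym_monomial (Suc a) (b - 1) c d) +
      cscale (of_nat d) (sym_monomial a b (Suc c) (d - 1))) \<in> nb (a + b + c + d)"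
    by (simp only: zw poisson_bracket_cscale_left)
  then show ?thesis
    by (rule subspace_cscale_cancel[OF cpoly.subspace_span]) simp
qed

text \<open>The opposite move, \<open>z\<close> into \<open>q\<close> or \<open>w\<close> into
  \<open>p\<close>, comes from \<open>p q\<close>; its sign disappears together with the factor
  2.\<close>

lemma sym_monomial_lower_relation:
  assumes "rotation_invariant \<zeta> a b c d"
  shows "cscale (of_nat a) (sym_monomial (a - 1) (Suc b) c d) +
    cscale (of_nat c) (sym_monomial a b (c - 1) (Suc d)) \<in> nb (a + b + c + d)"
proof -
  have pq: "sym_monomial 0 1 0 1 = cscale 2 (monomial4 0 1 0 1)"
    unfolding sym_monomial_def cscale_2 ..
  have br: "poisson_bracket (monomial4 0 1 0 1) (monomial4 a b c d) =
      - (cscale (of_nat a) (monomial4 (a - 1) (Suc b) c d) +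
      cscale (of_nat c) (monomial4 a b (c - 1) (Suc d)))" for a b c d
    by (simp add: poisson_bracket_2 pderivative_monomial4 cscale_mult monomial4_mult)
  have "poisson_bracket (monomial4 0 1 0 1) (sym_monomial a b c d) =
      - (cscale (of_nat a) (sym_monomial (a - 1) (Suc b) c d) +
      cscale (of_nat c) (sym_monomial a b (c - 1) (Suc d)))"
    unfolding sym_monomial_def poisson_bracket_add_right br
    by (simp add: cpoly.scale_right_distrib algebra_simps)
  moreover have "poisson_bracket (sym_monomial 0 1 0 1) (sym_monomial a b c d) \<in> nb (a + b + c + d)"
    by (rule bracket_sym_monomial_in_nb) (use assms in \<open>simp_all add: rotation_invariant_def\<close>)
  ultimately have "cscale (- 2) (cscale (of_nat a) (sym_monomial (a - 1) (Suc b) c d) +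
      cscale (of_nat c) (sym_monomial a b (c - 1) (Suc d))) \<in> nb (a + b + c + d)"
    by (simp only: pq poisson_bracket_cscale_left cpoly.scale_minus_left cpoly.scale_minus_right)
  then show ?thesis
    by (rule subspace_cscale_cancel[OF cpoly.subspace_span]) simp
qed

text \<open>Induction on the exponent of \<open>z\<close>: the raising relation trades a monomial
  for one with one \<open>z\<close> less. Once \<open>z\<close> is gone the lowering relation has a
  single term, so any factor \<open>p\<close> puts the monomial among the brackets. Without
  \<open>p\<close> what remains is \<open>q^b w^c\<close>, of weight 0 only for
  \<open>b = c\<close>, where it symmetrizes to \<open>radial b\<close>.\<close>

lemma sym_monomial_in_span_radial:
  assumes "rotation_invariant \<zeta> a b c d" "n = a + b + c + d"
  shows "sym_monomial a b c d \<in> cpoly.span (graded_brackets \<zeta> (int n) \<union> {radial k | k. 2 * k = n})"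
    (is "_ \<in> cpoly.span (_ \<union> ?R)")
  using assms
proof (induction a arbitrary: b c d)
  case 0
  show ?case
  proof (cases d)
    case d: 0
    show ?thesis
    proof (cases "b = c")
      case True
      have "sym_monomial 0 b b 0 = radial b"
        by (simp add: radial_def sym_monomial_def add.commute)
      then show ?thesis using 0 True d by (auto intro!: cpoly.span_base)
    next
      case False
      then have "sym_monomial 0 b c d \<in> nb n"
        using sym_monomial_weight_relation[OF 0(1)] 0 d by simp
      then show ?thesis by (meson Un_upper1 cpoly.span_mono subsetD)
    qed
  next
    case (Suc d')
    have "rotation_invariant \<zeta> 0 b (Suc c) d'" using 0 Suc by (simp add: rotation_invariant_def)
    from sym_monomial_lower_relation[OF this]
    have "cscale (of_nat (Suc c)) (sym_monomial 0 b c d) \<in> nb n"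
      using 0 Suc by simp
    from subspace_cscale_cancel[OF cpoly.subspace_span this]
    have "sym_monomial 0 b c d \<in> nb n" by (simp del: of_nat_Suc)
    then show ?thesis by (meson Un_upper1 cpoly.span_mono subsetD)
  qed
next
  case (Suc a)
  have "rotation_invariant \<zeta> a (Suc b) c d" using Suc.prems by (simp add: rotation_invariant_def)
  from sym_monomial_raise_relation[OF this]
  have rel: "cscale (of_nat (Suc b)) (sym_monomial (Suc a) b c d) +
      cscale (of_nat d) (sym_monomial a (Suc b) (Suc c) (d - 1)) \<in> nb n"
    using Suc.prems by (simp del: of_nat_Suc)
  then have rel: "cscale (of_nat (Suc b)) (sym_monomial (Suc a) b c d) +
      cscale (of_nat d) (sym_monomial a (Suc b) (Suc c) (d - 1)) \<in>
      cpoly.span (graded_brackets \<zeta> (int n) \<union> ?R)"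
    by (meson Un_upper1 cpoly.span_mono subsetD)
  have "cscale (of_nat d) (sym_monomial a (Suc b) (Suc c) (d - 1)) \<in>
      cpoly.span (graded_brackets \<zeta> (int n) \<union> ?R)"
  proof (cases d)
    case d: (Suc d')
    have "sym_monomial a (Suc b) (Suc c) d' \<in> cpoly.span (graded_brackets \<zeta> (int n) \<union> ?R)"
      using Suc.prems d by (intro Suc.IH) (auto simp: rotation_invariant_def)
    then show ?thesis unfolding d by (intro cpoly.span_scale) simp
  qed (simp add: cpoly.span_zero)
  from cpoly.span_diff[OF rel this]
  have "cscale (of_nat (Suc b)) (sym_monomial (Suc a) b c d) \<in>
      cpoly.span (graded_brackets \<zeta> (int n) \<union> ?R)" by simp
  then show ?case
    by (rule subspace_cscale_cancel[OF cpoly.subspace_span]) (simp del: of_nat_Suc)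
qed

text \<open>Along the chain \<open>z^i q^j w^j p^i\<close> with \<open>i + j\<close> fixed, raising
  ties neighbours together with coefficients \<open>j + 1\<close> and \<open>i + 1\<close> and
  opposite signs. Solving this recursion from \<open>radial (i + j)\<close> produces the sign and
  the binomial coefficient.\<close>

lemma sym_monomial_diagonal_relation:
  "cscale (of_nat ((i + j) choose j)) (sym_monomial i j j i) - cscale ((- 1) ^ j) (radial (i + j))
    \<in> nb (2 * (i + j))"
proof (induction j arbitrary: i)
  case 0
  then show ?case by (simp add: radial_def cpoly.span_zero)
next
  case (Suc j)
  let ?k = "i + Suc j"
  define u where "u = sym_monomial (Suc i) j j (Suc i)"
  define v where "v = sym_monomial i (Suc j) (Suc j) i"
  let ?C = "of_nat (?k choose j) :: complex"
  have "rotation_invariant \<zeta> i (Suc j) j (Suc i)" by (simp add: rotation_invariant_def add.commute)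
  from sym_monomial_raise_relation[OF this]
  have 1: "cscale (of_nat (Suc j)) u + cscale (of_nat (Suc i)) v \<in> nb (2 * ?k)"
    by (simp add: u_def v_def del: of_nat_Suc) (simp add: mult_2 algebra_simps)
  have 2: "cscale ?C u - cscale ((- 1) ^ j) (radial ?k) \<in> nb (2 * ?k)"
    using Suc.IH[of "Suc i"] by (simp add: u_def)
  have "(?k choose j) * Suc i = (?k choose Suc j) * Suc j"
    using binomial_absorb_comp[of ?k j] Suc_times_binomial_eq[of "i + j" j]
    by (simp add: algebra_simps)
  then have C: "?C * of_nat (Suc i) = of_nat (Suc j) * of_nat (?k choose Suc j)"
    by (metis mult.commute of_nat_mult)
  have "cscale ?C (cscale (of_nat (Suc j)) u + cscale (of_nat (Suc i)) v) -
      cscale (of_nat (Suc j)) (cscale ?C u - cscale ((- 1) ^ j) (radial ?k)) =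
      cscale (?C * of_nat (Suc i)) v + cscale (of_nat (Suc j)) (cscale ((- 1) ^ j) (radial ?k))"
    by (simp add: cpoly.scale_right_distrib cpoly.scale_right_diff_distrib mult.commute del: of_nat_Suc)
  also have "\<dots> = cscale (of_nat (Suc j))
      (cscale (of_nat (?k choose Suc j)) v - cscale ((- 1) ^ Suc j) (radial ?k))"
    unfolding C by (simp add: cpoly.scale_right_distrib del: of_nat_Suc)
  finally have "cscale (of_nat (Suc j))
      (cscale (of_nat (?k choose Suc j)) v - cscale ((- 1) ^ Suc j) (radial ?k)) \<in> nb (2 * ?k)"
    using cpoly.span_diff[OF cpoly.span_scale[OF 1] cpoly.span_scale[OF 2]] by metis
  then show ?case
    unfolding v_def by (rule subspace_cscale_cancel[OF cpoly.subspace_span]) (simp del: of_nat_Suc)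
qed

text \<open>At \<open>i = 0\<close> the chain has returned to \<open>radial k\<close>, since the
  exchange swaps its two ends. So modulo brackets \<open>radial k\<close> is (-1)^k times
  itself.\<close>

lemma radial_odd_in_nb:
  assumes "odd k"
  shows "radial k \<in> nb (2 * k)"
proof -
  have "sym_monomial 0 k k 0 = radial k"
    by (simp add: radial_def sym_monomial_def add.commute)
  then have "radial k + radial k \<in> nb (2 * k)"
    using sym_monomial_diagonal_relation[of 0 k] assms by simp
  then show ?thesis
    using subspace_cscale_cancel[OF cpoly.subspace_span, of 2 "radial k"] by (simp add: cscale_2)
qed

lemma radial_large_in_nb:
  assumes "\<zeta> ^ m = 1" "m > 0" "m \<le> k + 1"
  shows "radial k \<in> nb (2 * k)"
proof -
  \<comment> \<open>The subtraction is exact because \<open>m \<le> k + 1\<close>, and it is chosen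
    so that the bracket of the overview lands on \<open>radial k\<close>.\<close>
  define j where "j = k + 1 - m"
  have k: "k = j + m - 1" using assms by (simp add: j_def)
  have "poisson_bracket (sym_monomial m 0 0 0) (sym_monomial j 0 0 (j + m)) =
      cscale (of_nat m * of_nat (j + m)) (radial k)"
    using assms(2)
    by (simp add: poisson_bracket_2 sym_monomial_def radial_def pderivative_add pderivative_monomial4
        cscale_mult monomial4_mult k cpoly.scale_right_distrib algebra_simps)
  moreover have "poisson_bracket (sym_monomial m 0 0 0) (sym_monomial j 0 0 (j + m)) \<in> nb (2 * k)"
    using assms by (intro bracket_sym_monomial_in_nb) (simp_all add: rotation_invariant_def power_add k)
  moreover have "of_nat m * of_nat (j + m) \<noteq> (0::complex)"
    using assms(2) by (simp del: of_nat_add)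
  ultimately show ?thesis
    using subspace_cscale_cancel[OF cpoly.subspace_span] by metis
qed

text \<open>All relations used so far preserve the degree, hence the bound on \<open>2 * k\<close>.
  It is recorded because the passage to commutators is an induction on the degree.\<close>

lemma invariant_polys_in_span_radial:
  assumes m: "\<zeta> ^ m = 1" "m > 0" and f: "f \<in> invariant_polys (dihedral \<zeta>)" "f \<in> pdeg_le n"
  shows "f \<in> cpoly.span (graded_brackets \<zeta> n \<union> {radial k | k. even k \<and> k + 1 < m \<and> int (2 * k) \<le> n})"
    (is "f \<in> cpoly.span (?G \<union> ?R)")
proof -
  have G: "nb n' \<subseteq> cpoly.span (?G \<union> ?R)" if "int n' \<le> n" for n'
    using graded_brackets_mono[OF that] by (intro cpoly.span_mono) blast
  have radial: "radial k \<in> cpoly.span (?G \<union> ?R)" if k: "int (2 * k) \<le> n" for k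
  proof (cases "even k \<and> k + 1 < m")
    case True
    then have "radial k \<in> ?R" using k by blast
    then show ?thesis by (auto intro: cpoly.span_base)
  next
    case False
    then have "radial k \<in> nb (2 * k)"
      using radial_odd_in_nb[of k] radial_large_in_nb[OF m, of k] by (cases "even k") auto
    then show ?thesis using G[OF k] by blast
  qed
  have "sym_monomial a b c d \<in> cpoly.span (?G \<union> ?R)"
    if abcd: "rotation_invariant \<zeta> a b c d" "int (a + b + c + d) \<le> n" for a b c d
  proof -
    have "graded_brackets \<zeta> (int (a + b + c + d)) \<union> {radial k | k. 2 * k = a + b + c + d} \<subseteq>
        cpoly.span (?G \<union> ?R)"
      using G[OF abcd(2)] radial abcd(2) cpoly.span_superset by (auto simp flip: of_nat_add)
    from cpoly.span_minimal[OF this cpoly.subspace_span]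
    show ?thesis using sym_monomial_in_span_radial[OF abcd(1) HOL.refl] by blast
  qed
  then have "cpoly.span {sym_monomial a b c d | a b c d.
      rotation_invariant \<zeta> a b c d \<and> int (a + b + c + d) \<le> n} \<subseteq> cpoly.span (?G \<union> ?R)"
    by (intro cpoly.span_minimal cpoly.subspace_span) blast
  then show ?thesis using invariant_polys_in_span_sym_monomial[OF \<zeta> f] by blast
qed

end

section \<open>Twisted traces\<close>

text \<open>The trace of \<open>z\<^sup>a \<partial>\<^sup>a\<close> composed with \<open>z \<mapsto> \<lambda> z\<close> on \<open>\<complex>[z]\<close> is
  \<open>\<Sum>n. n (n - 1) \<dots> (n - a + 1) \<lambda>\<^sup>n\<close>, of which this is the sum as a rational function of \<open>\<lambda>\<close>.\<close>

definition trace_coeff :: "complex \<Rightarrow> nat \<Rightarrow> complex" where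
  "trace_coeff \<mu> a = fact a * \<mu> ^ a / (1 - \<mu>) ^ Suc a"

text \<open>This recursion is the twisted trace property for moving one \<open>z\<close> around
  \<open>z^a \<partial>^(a + 1)\<close>.\<close>

lemma trace_coeff_Suc:
  assumes "\<mu> \<noteq> 1"
  shows "trace_coeff \<mu> (Suc a) = \<mu> * (trace_coeff \<mu> (Suc a) + of_nat (Suc a) * trace_coeff \<mu> a)"
proof -
  have "trace_coeff \<mu> (Suc a) = \<mu> * of_nat (Suc a) * trace_coeff \<mu> a / (1 - \<mu>)"
    by (simp add: trace_coeff_def mult_ac)
  then have "(1 - \<mu>) * trace_coeff \<mu> (Suc a) = \<mu> * of_nat (Suc a) * trace_coeff \<mu> a"
    using assms by (simp del: of_nat_Suc)
  then show ?thesis by (simp add: algebra_simps)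
qed

text \<open>Only products of \<open>z^a \<partial>^a\<close> and \<open>w^c \<partial>^c\<close>
  have diagonal entries on monomials, and a rotation scales the two coordinates by inverse factors.
  The sums diverge at roots of unity, so the rational values are taken as the definition and the
  trace property is proved algebraically.\<close>

definition trace_mon :: "complex \<Rightarrow> (2 + 2 \<Rightarrow>\<^sub>0 nat) \<Rightarrow> complex" where
  "trace_mon \<mu> m =
    (if Poly_Mapping.lookup m (Inl 1) = Poly_Mapping.lookup m (Inr 1) \<and>
        Poly_Mapping.lookup m (Inl 2) = Poly_Mapping.lookup m (Inr 2)
     then trace_coeff \<mu> (Poly_Mapping.lookup m (Inl 1)) *
       trace_coeff (inverse \<mu>) (Poly_Mapping.lookup m (Inl 2))
     else 0)"

definition twisted_trace :: "complex \<Rightarrow> (2 + 2) cpoly \<Rightarrow> complex" where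
  "twisted_trace \<mu> f = (\<Sum>m\<in>Poly_Mapping.keys f. Poly_Mapping.lookup f m * trace_mon \<mu> m)"

lemma twisted_trace_add: "twisted_trace \<mu> (f + g) = twisted_trace \<mu> f + twisted_trace \<mu> g"
  unfolding twisted_trace_def by (rule sum_keys_add) (auto simp: algebra_simps)

lemma twisted_trace_cscale: "twisted_trace \<mu> (cscale c f) = c * twisted_trace \<mu> f"
proof -
  have "twisted_trace \<mu> (cscale c f) =
      (\<Sum>m\<in>Poly_Mapping.keys f. c * Poly_Mapping.lookup f m * trace_mon \<mu> m)"
    unfolding twisted_trace_def by (rule sum_keys_cscale) auto
  then show ?thesis by (simp add: twisted_trace_def sum_distrib_left mult.assoc)
qed

lemma twisted_trace_diff: "twisted_trace \<mu> (f - g) = twisted_trace \<mu> f - twisted_trace \<mu> g"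
  by (metis add_diff_cancel_right' diff_add_cancel twisted_trace_add)

lemma twisted_trace_zero [simp]: "twisted_trace \<mu> 0 = 0"
  by (simp add: twisted_trace_def)

lemma twisted_trace_sum: "twisted_trace \<mu> (\<Sum>i\<in>I. f i) = (\<Sum>i\<in>I. twisted_trace \<mu> (f i))"
  by (induction I rule: infinite_finite_induct) (simp_all add: twisted_trace_add)

lemma monomial4_eq_mon:
  "\<exists>m. monomial4 a b c d = mon m \<and> Poly_Mapping.lookup m (Inl 1) = a \<and>
    Poly_Mapping.lookup m (Inr 2) = b \<and> Poly_Mapping.lookup m (Inl 2) = c \<and>
    Poly_Mapping.lookup m (Inr 1) = d"
proof -
  define m :: "2 + 2 \<Rightarrow>\<^sub>0 nat" where "m = Poly_Mapping.single (Inl 1) a + Poly_Mapping.single (Inr 2) b +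
    Poly_Mapping.single (Inl 2) c + Poly_Mapping.single (Inr 1) d"
  have m: "Poly_Mapping.lookup m (Inl 1) = a" "Poly_Mapping.lookup m (Inr 2) = b"
    "Poly_Mapping.lookup m (Inl 2) = c" "Poly_Mapping.lookup m (Inr 1) = d"
    by (simp_all add: m_def lookup_add lookup_single)
  then have "monomial4 a b c d = mon m" by (simp add: mon_eq_monomial4)
  then show ?thesis using m by blast
qed

lemma twisted_trace_monomial4:
  "twisted_trace \<mu> (monomial4 a b c d) =
    (if a = d \<and> c = b then trace_coeff \<mu> a * trace_coeff (inverse \<mu>) b else 0)"
proof -
  obtain m where "monomial4 a b c d = mon m" "Poly_Mapping.lookup m (Inl 1) = a"
    "Poly_Mapping.lookup m (Inr 2) = b" "Poly_Mapping.lookup m (Inl 2) = c"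
    "Poly_Mapping.lookup m (Inr 1) = d" using monomial4_eq_mon by metis
  then show ?thesis by (auto simp: twisted_trace_def trace_mon_def)
qed

section \<open>The trace property twisted by a rotation\<close>

definition rotation :: "complex \<Rightarrow> (2 + 2) cpoly \<Rightarrow> (2 + 2) cpoly" where
  "rotation \<mu> f = act_double (swap_matrix 1) (act_double (swap_matrix \<mu>) f)"

lemma rotation_add: "rotation \<mu> (f + g) = rotation \<mu> f + rotation \<mu> g"
  by (simp add: rotation_def act_double_add)

lemma rotation_cscale: "rotation \<mu> (cscale c f) = cscale c (rotation \<mu> f)"
  by (simp add: rotation_def act_double_cscale)

lemma rotation_star: "\<mu> \<noteq> 0 \<Longrightarrow> rotation \<mu> (f \<star> g) = rotation \<mu> f \<star> rotation \<mu> g"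
  by (simp add: rotation_def act_double_star invertible_swap_matrix)

lemma rotation_monomial4:
  "\<mu> \<noteq> 0 \<Longrightarrow> rotation \<mu> (monomial4 a b c d) = cscale (\<mu> ^ (a + b) * inverse \<mu> ^ (c + d)) (monomial4 a b c d)"
  by (simp add: rotation_def act_double_swap_matrix_monomial4 act_double_cscale)

lemma rotation_Var:
  assumes "\<mu> \<noteq> 0"
  shows "rotation \<mu> (Var (Inl 1)) = cscale \<mu> (Var (Inl 1))"
    "rotation \<mu> (Var (Inr 2)) = cscale \<mu> (Var (Inr 2))"
    "rotation \<mu> (Var (Inl 2)) = cscale (inverse \<mu>) (Var (Inl 2))"
    "rotation \<mu> (Var (Inr 1)) = cscale (inverse \<mu>) (Var (Inr 1))"
  using rotation_monomial4[OF assms, of 1 0 0 0] rotation_monomial4[OF assms, of 0 1 0 0]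
    rotation_monomial4[OF assms, of 0 0 1 0] rotation_monomial4[OF assms, of 0 0 0 1]
  by (simp_all add: monomial4_def)

lemma rotation_mult: "\<mu> \<noteq> 0 \<Longrightarrow> \<nu> \<noteq> 0 \<Longrightarrow> rotation (\<mu> * \<nu>) f = rotation \<mu> (rotation \<nu> f)"
proof (induction f rule: cpoly_monomial_induct)
  case (mon m)
  then show ?case
    by (simp add: mon_eq_monomial4 rotation_monomial4 rotation_cscale power_mult_distrib mult_ac)
qed (simp_all add: rotation_add rotation_cscale)

lemma rotation_power_invariant:
  assumes "\<zeta> \<noteq> 0" "f \<in> invariant_polys (dihedral \<zeta>)"
  shows "rotation (\<zeta> ^ j) f = f"
proof (induction j)
  case 0
  have "act_double (swap_matrix 1) f = f" using assms(2) by (simp add: invariant_polys_def dihedral_def)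
  then show ?case by (simp add: rotation_def)
next
  case (Suc j)
  have "rotation \<zeta> f = f" using assms(2) by (simp add: rotation_def invariant_polys_def dihedral_def)
  then show ?case using rotation_mult[of \<zeta> "\<zeta> ^ j" f] assms(1) Suc by simp
qed

context
  fixes \<mu> :: complex
  assumes \<mu>: "\<mu> \<noteq> 0" "\<mu> \<noteq> 1"
begin

lemma inverse_ne_1: "inverse \<mu> \<noteq> 1"
  using \<mu> by simp

lemma trace_coeff_relation:
  "trace_coeff \<mu> (Suc a) = \<mu> * trace_coeff \<mu> (Suc a) + \<mu> * (of_nat (Suc a) * trace_coeff \<mu> a)"
  "trace_coeff (inverse \<mu>) (Suc a) = inverse \<mu> * trace_coeff (inverse \<mu>) (Suc a) +
    inverse \<mu> * (of_nat (Suc a) * trace_coeff (inverse \<mu>) a)"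
  using trace_coeff_Suc[OF \<mu>(2), of a] trace_coeff_Suc[OF inverse_ne_1, of a]
  by (simp_all only: distrib_left)

lemma trace_coeff_relation':
  "trace_coeff \<mu> (Suc a) + of_nat (Suc a) * trace_coeff \<mu> a = inverse \<mu> * trace_coeff \<mu> (Suc a)"
  "trace_coeff (inverse \<mu>) (Suc a) + of_nat (Suc a) * trace_coeff (inverse \<mu>) a =
    \<mu> * trace_coeff (inverse \<mu>) (Suc a)"
proof -
  have "inverse x * (x * y) = y" if "x \<noteq> 0" for x y :: complex using that by simp
  then show "trace_coeff \<mu> (Suc a) + of_nat (Suc a) * trace_coeff \<mu> a = inverse \<mu> * trace_coeff \<mu> (Suc a)"
    "trace_coeff (inverse \<mu>) (Suc a) + of_nat (Suc a) * trace_coeff (inverse \<mu>) a =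
      \<mu> * trace_coeff (inverse \<mu>) (Suc a)"
    using trace_coeff_Suc[OF \<mu>(2), of a] trace_coeff_Suc[OF inverse_ne_1, of a] \<mu>
    by (metis, metis inverse_inverse_eq inverse_nonzero_iff_nonzero)
qed

text \<open>Where the exponents balance, this is the recursion of \<open>trace_coeff\<close> in the
  coordinate belonging to \<open>v\<close>, times the untouched factor of the other coordinate.
  Elsewhere both sides are 0.\<close>

lemma twisted_trace_Var_monomial4:
  "twisted_trace \<mu> (Var v \<star> monomial4 a b c d) = twisted_trace \<mu> (monomial4 a b c d \<star> rotation \<mu> (Var v))"
proof -
  consider "v = Inl 1" | "v = Inl 2" | "v = Inr 1" | "v = Inr 2"
    using UNIV_2_plus_2 by blast
  then show ?thesis
  proof cases
    case 1
    show ?thesis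
      using arg_cong[OF trace_coeff_relation(1)[of a], of "\<lambda>x. x * trace_coeff (inverse \<mu>) b"]
      by (cases d)
        (auto simp: 1 rotation_Var[OF \<mu>(1)] Inl_star star_cscale_right star_Inl Var_mult_monomial4
          pderivative_monomial4 twisted_trace_add twisted_trace_cscale twisted_trace_monomial4
          algebra_simps)
  next
    case 2
    show ?thesis
      using arg_cong[OF trace_coeff_relation(2)[of c], of "\<lambda>x. x * trace_coeff \<mu> a"]
      by (cases b)
        (auto simp: 2 rotation_Var[OF \<mu>(1)] Inl_star star_cscale_right star_Inl Var_mult_monomial4
          pderivative_monomial4 twisted_trace_add twisted_trace_cscale twisted_trace_monomial4
          algebra_simps)
  next
    case 3
    show ?thesis
      using arg_cong[OF trace_coeff_relation'(1)[of d], of "\<lambda>x. x * trace_coeff (inverse \<mu>) b"]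
      by (cases a)
        (auto simp: 3 rotation_Var[OF \<mu>(1)] Inr_star star_cscale_right star_Inr Var_mult_monomial4
          pderivative_monomial4 twisted_trace_add twisted_trace_cscale twisted_trace_monomial4
          algebra_simps)
  next
    case 4
    show ?thesis
      using arg_cong[OF trace_coeff_relation'(2)[of b], of "\<lambda>x. x * trace_coeff \<mu> a"]
      by (cases c)
        (auto simp: 4 rotation_Var[OF \<mu>(1)] Inr_star star_cscale_right star_Inr Var_mult_monomial4
          pderivative_monomial4 twisted_trace_add twisted_trace_cscale twisted_trace_monomial4
          algebra_simps)
  qed
qed

lemma twisted_trace_Var:
  "twisted_trace \<mu> (Var v \<star> f) = twisted_trace \<mu> (f \<star> rotation \<mu> (Var v))"
proof (induction f rule: cpoly_monomial_induct)
  case (mon m)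
  then show ?case by (simp only: mon_eq_monomial4 twisted_trace_Var_monomial4)
qed (simp_all add: star_add_left star_add_right star_cscale_left star_cscale_right
      twisted_trace_add twisted_trace_cscale)

text \<open>Twisted cyclicity passes to products in the first factor, so variables suffice.
  Coordinates are peeled off the left of \<open>f\<close> and derivatives off the right, the sides
  on which \<open>\<star>\<close> with a variable is the plain product.\<close>

lemma twisted_trace_star: "twisted_trace \<mu> (f \<star> g) = twisted_trace \<mu> (g \<star> rotation \<mu> f)"
proof (induction f arbitrary: g rule: normal_order_induct)
  case one
  have "rotation \<mu> 1 = 1" by (simp add: rotation_def)
  then show ?case by (simp add: star_one_left star_one_right)
next
  case (Inl i f)
  have "twisted_trace \<mu> (Var (Inl i) \<star> f \<star> g) = twisted_trace \<mu> (f \<star> (g \<star> rotation \<mu> (Var (Inl i))))"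
    by (simp add: star_assoc twisted_trace_Var)
  also have "\<dots> = twisted_trace \<mu> (g \<star> rotation \<mu> (Var (Inl i) \<star> f))"
    by (simp add: Inl star_assoc rotation_star[OF \<mu>(1)])
  finally show ?case by (simp add: Inl_star)
next
  case (Inr i f)
  have "twisted_trace \<mu> (f \<star> Var (Inr i) \<star> g) = twisted_trace \<mu> (Var (Inr i) \<star> (g \<star> rotation \<mu> f))"
    by (simp add: star_assoc Inr)
  also have "\<dots> = twisted_trace \<mu> (g \<star> rotation \<mu> (f \<star> Var (Inr i)))"
    by (simp add: twisted_trace_Var star_assoc rotation_star[OF \<mu>(1)])
  finally show ?case by (simp add: star_Inr)
qed (simp_all add: star_add_left star_add_right star_cscale_left star_cscale_right
      rotation_add rotation_cscale twisted_trace_add twisted_trace_cscale)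

text \<open>Invariants are fixed by the rotation, so on them the twist is invisible and the twisted
  trace is an honest one.\<close>

lemma twisted_trace_bracket_span:
  assumes "\<zeta> \<noteq> 0" "\<mu> = \<zeta> ^ j" "x \<in> bracket_span star_commutator (dihedral \<zeta>)"
  shows "twisted_trace \<mu> x = 0"
proof -
  have sub: "cpoly.subspace {x. twisted_trace \<mu> x = 0}"
    by (simp add: cpoly.subspace_def twisted_trace_add twisted_trace_cscale)
  have "twisted_trace \<mu> (star_commutator f g) = 0"
    if "f \<in> invariant_polys (dihedral \<zeta>)" for f g
    using twisted_trace_star[of f g] rotation_power_invariant[OF assms(1) that, of j] assms(2)
    by (simp add: star_commutator_def twisted_trace_diff)
  then have "bracket_span star_commutator (dihedral \<zeta>) \<subseteq> {x. twisted_trace \<mu> x = 0}"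
    unfolding bracket_span_def by (intro cpoly.span_minimal[OF _ sub]) auto
  then show ?thesis using assms(3) by auto
qed

text \<open>Here \<open>s\<close> is \<open>\<mu> + inverse \<mu>\<close>. With
  \<open>u = \<mu> / (1 - \<mu>)\<close>, the same ratio for \<open>inverse \<mu>\<close> is
  \<open>- (1 + u)\<close>; the two have sum -1 and product \<open>\<kappa>\<close>, which is also
  the trace of 1. The trace of \<open>radial n\<close> is \<open>fact n * \<kappa>\<close> times
  their \<open>n\<close>-th power sum, a polynomial in \<open>\<kappa>\<close> by Newton's
  identities.\<close>

lemma twisted_trace_radial:
  assumes s: "\<mu>\<^sup>2 + 1 = s * \<mu>" and \<kappa>: "\<kappa> = 1 / (2 - s)"
  shows "twisted_trace \<mu> (radial 0) = 2 * \<kappa>"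
    "twisted_trace \<mu> (radial 2) = 2 * \<kappa> * (1 - 2 * \<kappa>)"
    "twisted_trace \<mu> (radial 4) = 24 * \<kappa> * (1 - 4 * \<kappa> + 2 * \<kappa>\<^sup>2)"
proof -
  define u where "u = \<mu> / (1 - \<mu>)"
  have ne: "1 - \<mu> \<noteq> 0" using \<mu> by simp
  have s2: "(2 - s) * \<mu> = - ((1 - \<mu>)\<^sup>2)"
    using s by (simp add: power2_eq_square algebra_simps)
  then have s2ne: "2 - s \<noteq> 0" using ne by auto
  have u1: "1 + u = 1 / (1 - \<mu>)" using ne by (simp add: u_def field_simps)
  have \<kappa>u: "\<kappa> = - u * (1 + u)"
  proof -
    have "- u * (1 + u) = - \<mu> / (1 - \<mu>)\<^sup>2" unfolding u1 by (simp add: u_def power2_eq_square)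
    also have "\<dots> = \<mu> / ((2 - s) * \<mu>)" unfolding s2 by simp
    also have "\<dots> = \<kappa>" using \<mu>(1) by (simp add: \<kappa>)
    finally show ?thesis by simp
  qed
  have t1: "trace_coeff \<mu> n = fact n * u ^ n * (1 + u)" for n
    unfolding u1 by (simp add: trace_coeff_def u_def power_divide)
  have iu: "inverse \<mu> / (1 - inverse \<mu>) = - (1 + u)" "1 / (1 - inverse \<mu>) = - u"
    using ne \<mu> by (simp_all add: u_def field_simps)
  have t2: "trace_coeff (inverse \<mu>) n = fact n * (- (1 + u)) ^ n * (- u)" for n
  proof -
    have "trace_coeff (inverse \<mu>) n =
        fact n * (inverse \<mu> / (1 - inverse \<mu>)) ^ n * (1 / (1 - inverse \<mu>))"
      by (simp add: trace_coeff_def power_divide)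
    then show ?thesis unfolding iu .
  qed
  have "twisted_trace \<mu> (radial n) =
      trace_coeff \<mu> n * trace_coeff (inverse \<mu>) 0 + trace_coeff \<mu> 0 * trace_coeff (inverse \<mu>) n" for n
    by (simp add: radial_def sym_monomial_def twisted_trace_add twisted_trace_monomial4)
  then have tr: "twisted_trace \<mu> (radial n) = fact n * \<kappa> * (u ^ n + (- (1 + u)) ^ n)" for n
    unfolding t1 t2 \<kappa>u by (simp add: algebra_simps)
  show "twisted_trace \<mu> (radial 0) = 2 * \<kappa>"
    unfolding tr by simp
  have "u\<^sup>2 + (- (1 + u))\<^sup>2 = 1 - 2 * \<kappa>"
    unfolding \<kappa>u by (simp add: eval_nat_numeral algebra_simps)
  then show "twisted_trace \<mu> (radial 2) = 2 * \<kappa> * (1 - 2 * \<kappa>)"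
    unfolding tr by simp
  have "u ^ 4 + (- (1 + u)) ^ 4 = 1 - 4 * \<kappa> + 2 * \<kappa>\<^sup>2"
    unfolding \<kappa>u by (simp add: eval_nat_numeral algebra_simps)
  then show "twisted_trace \<mu> (radial 4) = 24 * \<kappa> * (1 - 4 * \<kappa> + 2 * \<kappa>\<^sup>2)"
    unfolding tr by (simp add: fact_numeral)
qed

end

section \<open>Transfer between the two brackets\<close>

definition homogeneous :: "int \<Rightarrow> 'v::finite cpoly set" where
  "homogeneous d = {p. \<forall>m\<in>Poly_Mapping.keys p. int (mdeg m) = d}"

lemma subspace_homogeneous: "cpoly.subspace (homogeneous d)"
  using keys_add keys_cscale
  by (fastforce simp: cpoly.subspace_def homogeneous_def)

lemma homogeneous_mult:
  assumes "p \<in> homogeneous d" "q \<in> homogeneous e"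
  shows "p * q \<in> homogeneous (d + e)"
proof -
  have "int (mdeg (a + b)) = d + e" if "a \<in> Poly_Mapping.keys p" "b \<in> Poly_Mapping.keys q" for a b
    using assms that by (auto simp: homogeneous_def mdeg_add)
  then show ?thesis using keys_mult[of p q] by (auto simp: homogeneous_def)
qed

lemma homogeneous_pderivative:
  assumes "p \<in> homogeneous d"
  shows "pderivative v p \<in> homogeneous (d - 1)"
proof -
  have mon: "pderivative v (mon m) \<in> homogeneous (d - 1)" if "int (mdeg m) = d" for m
  proof (cases "Poly_Mapping.lookup m v = 0")
    case False
    have "mdeg m = mdeg (m - Poly_Mapping.single v 1) + 1"
      using arg_cong[OF minus_single_add[OF False], of mdeg] by (simp add: mdeg_add mdeg_single)
    then have "mon (m - Poly_Mapping.single v 1) \<in> homogeneous (d - 1)"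
      using that by (simp add: homogeneous_def)
    then show ?thesis
      unfolding pderivative_mon by (rule cpoly.subspace_scale[OF subspace_homogeneous])
  qed (simp add: pderivative_mon cpoly.subspace_0[OF subspace_homogeneous])
  have sub: "cpoly.subspace {p. pderivative v p \<in> homogeneous (d - 1)}"
    by (auto simp: cpoly.subspace_def pderivative_add pderivative_cscale
        cpoly.subspace_0[OF subspace_homogeneous]
        intro: cpoly.subspace_add[OF subspace_homogeneous] cpoly.subspace_scale[OF subspace_homogeneous])
  have "p \<in> {p. pderivative v p \<in> homogeneous (d - 1)}"
  proof (rule cpoly_in_subspace[OF sub])
    fix m assume "m \<in> Poly_Mapping.keys p"
    then have "int (mdeg m) = d" using assms by (simp add: homogeneous_def)
    then show "mon m \<in> {p. pderivative v p \<in> homogeneous (d - 1)}" using mon by simp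
  qed
  then show ?thesis by simp
qed

lemma homogeneous_poisson_bracket:
  assumes "f \<in> homogeneous i" "g \<in> homogeneous j"
  shows "poisson_bracket f g \<in> homogeneous (i + j - 2)"
proof -
  have "pderivative u f * pderivative v g \<in> homogeneous (i + j - 2)" for u v
    using homogeneous_mult[OF homogeneous_pderivative[OF assms(1)] homogeneous_pderivative[OF assms(2)]]
    by (simp add: algebra_simps)
  then show ?thesis unfolding poisson_bracket_def
    by (intro cpoly.subspace_sum[OF subspace_homogeneous] cpoly.subspace_diff[OF subspace_homogeneous])
qed

lemma homogeneous_sym_monomial: "sym_monomial a b c d \<in> homogeneous (int (a + b + c + d))"
proof -
  have "monomial4 a b c d \<in> homogeneous (int (a + b + c + d))" for a b c d
  proof -
    obtain m where "monomial4 a b c d = mon m" "Poly_Mapping.lookup m (Inl 1) = a"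
      "Poly_Mapping.lookup m (Inr 2) = b" "Poly_Mapping.lookup m (Inl 2) = c"
      "Poly_Mapping.lookup m (Inr 1) = d" using monomial4_eq_mon by metis
    then show ?thesis by (simp add: homogeneous_def mdeg_2_plus_2)
  qed
  from this[of a b c d] this[of c d a b] show ?thesis
    unfolding sym_monomial_def
    by (intro cpoly.subspace_add[OF subspace_homogeneous]) (simp_all add: ac_simps)
qed

section \<open>Homogeneous components of sums of brackets\<close>

definition hom_component :: "int \<Rightarrow> 'v::finite cpoly \<Rightarrow> 'v cpoly" where
  "hom_component d p =
    (\<Sum>m\<in>Poly_Mapping.keys p. if int (mdeg m) = d then Poly_Mapping.single m (Poly_Mapping.lookup p m) else 0)"

lemma hom_component_add: "hom_component d (p + q) = hom_component d p + hom_component d q"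
  unfolding hom_component_def by (rule sum_keys_add) (auto simp: single_add)

lemma hom_component_cscale: "hom_component d (cscale c p) = cscale c (hom_component d p)"
proof -
  have "hom_component d (cscale c p) = (\<Sum>m\<in>Poly_Mapping.keys p.
      if int (mdeg m) = d then Poly_Mapping.single m (c * Poly_Mapping.lookup p m) else 0)"
    unfolding hom_component_def by (rule sum_keys_cscale) auto
  also have "\<dots> = cscale c (hom_component d p)"
    unfolding hom_component_def cpoly.scale_sum_right
    by (rule sum.cong) (auto simp: single_eq_cscale[of _ "_ * _"] single_eq_cscale[of _ "Poly_Mapping.lookup p _"])
  finally show ?thesis .
qed

lemma hom_component_homogeneous:
  assumes "p \<in> homogeneous e"
  shows "hom_component d p = (if d = e then p else 0)"
proof (cases "d = e")
  case True
  have "hom_component d p = (\<Sum>m\<in>Poly_Mapping.keys p. cscale (Poly_Mapping.lookup p m) (mon m))"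
    unfolding hom_component_def
    by (rule sum.cong)
      (use assms True in \<open>auto simp: homogeneous_def single_eq_cscale[of _ "Poly_Mapping.lookup p _"]\<close>)
  then show ?thesis using True cpoly_eq_sum_mon[of p] by simp
next
  case False
  then show ?thesis
    using assms by (auto simp: hom_component_def homogeneous_def intro!: sum.neutral)
qed

lemma hom_component_sum:
  "hom_component d (\<Sum>i\<in>I. f i) = (\<Sum>i\<in>I. hom_component d (f i))"
  by (induction I rule: infinite_finite_induct)
    (simp_all add: hom_component_add, simp_all add: hom_component_def)

text \<open>Symmetrized monomials span the invariants and are homogeneous, so a bracket of two of
  them lies in one degree and is kept or dropped as a whole. This disposes of brackets of high
  degree that merely cancel in \<open>x\<close>.\<close>

lemma hom_component_bracket_span:
  assumes \<zeta>: "\<zeta> \<noteq> 0" and x: "x \<in> bracket_span poisson_bracket (dihedral \<zeta>)"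
  shows "hom_component n x \<in> cpoly.span (graded_brackets \<zeta> n)"
proof -
  define V where "V = {x. hom_component n x \<in> cpoly.span (graded_brackets \<zeta> n)}"
  have V: "cpoly.subspace V"
    using cpoly.span_zero[of "graded_brackets \<zeta> n"]
    by (auto simp: V_def cpoly.subspace_def hom_component_add hom_component_cscale hom_component_def[of n 0]
        intro: cpoly.span_add cpoly.span_scale)
  define S where "S = {sym_monomial a b c d | a b c d. rotation_invariant \<zeta> a b c d}"
  have Inv: "f \<in> cpoly.span S" if f: "f \<in> invariant_polys (dihedral \<zeta>)" for f
  proof -
    obtain N where "f \<in> pdeg_le (int N)" using ex_pdeg_le by blast
    note in_span = invariant_polys_in_span_sym_monomial[OF \<zeta> f this]
    have "{sym_monomial a b c d | a b c d.
        rotation_invariant \<zeta> a b c d \<and> int (a + b + c + d) \<le> int N} \<subseteq> S"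
      unfolding S_def by blast
    from subsetD[OF cpoly.span_mono[OF this] in_span] show ?thesis .
  qed
  have "poisson_bracket f g \<in> V" if fg: "f \<in> S" "g \<in> S" for f g
  proof -
    obtain a b c d where f: "f = sym_monomial a b c d" "rotation_invariant \<zeta> a b c d"
      using fg(1) unfolding S_def by blast
    obtain a' b' c' d' where g: "g = sym_monomial a' b' c' d'" "rotation_invariant \<zeta> a' b' c' d'"
      using fg(2) unfolding S_def by blast
    define i j where "i = int (a + b + c + d)" and "j = int (a' + b' + c' + d')"
    have hom: "f \<in> homogeneous i" "g \<in> homogeneous j"
      and deg: "f \<in> pdeg_le i" "g \<in> pdeg_le j"
      and inv: "f \<in> invariant_polys (dihedral \<zeta>)" "g \<in> invariant_polys (dihedral \<zeta>)"
      unfolding i_def j_def f(1) g(1)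
      by (rule homogeneous_sym_monomial sym_monomial_pdeg_le sym_monomial_invariant[OF \<zeta>] f(2) g(2))+
    have "poisson_bracket f g \<in> graded_brackets \<zeta> n" if "n = i + j - 2"
      unfolding graded_brackets_def that using deg inv by blast
    then show ?thesis
      using hom_component_homogeneous[OF homogeneous_poisson_bracket[OF hom], of n]
      by (auto simp: V_def cpoly.span_zero intro: cpoly.span_base)
  qed
  moreover have "cpoly.subspace {f. poisson_bracket f g \<in> V}" for g
    using V by (auto simp: cpoly.subspace_def poisson_bracket_add_left poisson_bracket_cscale_left)
  ultimately have "poisson_bracket f g \<in> V" if "f \<in> cpoly.span S" "g \<in> S" for f g
    using cpoly.span_minimal[of S "{f. poisson_bracket f g \<in> V}"] that by blast
  moreover have "cpoly.subspace {g. poisson_bracket f g \<in> V}" for f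
    using V by (auto simp: cpoly.subspace_def poisson_bracket_add_right poisson_bracket_cscale_right)
  ultimately have "poisson_bracket f g \<in> V" if "f \<in> cpoly.span S" "g \<in> cpoly.span S" for f g
    using cpoly.span_minimal[of S "{g. poisson_bracket f g \<in> V}"] that by blast
  then have "bracket_span poisson_bracket (dihedral \<zeta>) \<subseteq> V"
    unfolding bracket_span_def using Inv by (intro cpoly.span_minimal V) blast
  then show ?thesis using x by (auto simp: V_def)
qed

section \<open>Spanning modulo commutators, and independence carried back\<close>

lemma poisson_bracket_invariant:
  assumes "\<And>g. g \<in> W \<Longrightarrow> invertible g" "f \<in> invariant_polys W" "h \<in> invariant_polys W"
  shows "poisson_bracket f h \<in> invariant_polys W"
  using assms by (simp add: invariant_polys_def act_double_poisson_bracket)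

lemma star_commutator_invariant:
  assumes "\<And>g. g \<in> W \<Longrightarrow> invertible g" "f \<in> invariant_polys W" "h \<in> invariant_polys W"
  shows "star_commutator f h \<in> invariant_polys W"
  using assms by (simp add: invariant_polys_def act_double_star_commutator)

lemma bracket_span_subset:
  assumes "\<And>f g. f \<in> invariant_polys W \<Longrightarrow> g \<in> invariant_polys W \<Longrightarrow> \<beta> f g \<in> invariant_polys W"
  shows "bracket_span \<beta> W \<subseteq> invariant_polys W"
  unfolding bracket_span_def using assms by (intro cpoly.span_minimal subspace_invariant_polys) blast

lemma invertible_dihedral: "\<zeta> \<noteq> 0 \<Longrightarrow> g \<in> dihedral \<zeta> \<Longrightarrow> invertible g"
  by (auto simp: dihedral_def invertible_swap_matrix)

definition radials :: "nat \<Rightarrow> int \<Rightarrow> (2 + 2) cpoly set" where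
  "radials m n = {radial k | k. even k \<and> k + 1 < m \<and> int (2 * k) \<le> n}"

text \<open>A commutator is minus the Poisson bracket up to terms whose degree is lower by two.\<close>

lemma graded_brackets_in_commutator_span:
  assumes \<zeta>: "\<zeta> \<noteq> 0" and x: "x \<in> cpoly.span (graded_brackets \<zeta> n)"
    and lower: "\<And>f. f \<in> invariant_polys (dihedral \<zeta>) \<Longrightarrow> f \<in> pdeg_le (n - 2) \<Longrightarrow>
      f \<in> cpoly.span (bracket_span star_commutator (dihedral \<zeta>) \<union> R)"
  shows "x \<in> cpoly.span (bracket_span star_commutator (dihedral \<zeta>) \<union> R)"
proof -
  have "y \<in> cpoly.span (bracket_span star_commutator (dihedral \<zeta>) \<union> R)"
    if "y \<in> graded_brackets \<zeta> n" for y
  proof -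
    obtain f g i j where y: "y = poisson_bracket f g"
      and fg: "f \<in> invariant_polys (dihedral \<zeta>)" "g \<in> invariant_polys (dihedral \<zeta>)"
      and deg: "f \<in> pdeg_le i" "g \<in> pdeg_le j" "i + j - 2 \<le> n"
      using \<open>y \<in> graded_brackets \<zeta> n\<close> unfolding graded_brackets_def by blast
    let ?h = "star_commutator f g + poisson_bracket f g"
    have "?h \<in> pdeg_le (n - 2)"
      using star_commutator_expansion[OF deg(1,2)] deg(3) by (auto intro: pdeg_le_mono[rotated])
    moreover have "?h \<in> invariant_polys (dihedral \<zeta>)"
      using invertible_dihedral[OF \<zeta>] fg
      by (intro cpoly.subspace_add[OF subspace_invariant_polys] star_commutator_invariant
          poisson_bracket_invariant)
    ultimately have "?h \<in> cpoly.span (bracket_span star_commutator (dihedral \<zeta>) \<union> R)"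
      by (intro lower)
    moreover have "star_commutator f g \<in> bracket_span star_commutator (dihedral \<zeta>)"
      unfolding bracket_span_def using fg by (intro cpoly.span_base) blast
    then have "star_commutator f g \<in> cpoly.span (bracket_span star_commutator (dihedral \<zeta>) \<union> R)"
      by (intro cpoly.span_base) blast
    ultimately have "?h - star_commutator f g \<in> cpoly.span (bracket_span star_commutator (dihedral \<zeta>) \<union> R)"
      by (rule cpoly.span_diff)
    then show ?thesis by (simp add: y)
  qed
  then have "cpoly.span (graded_brackets \<zeta> n) \<subseteq>
      cpoly.span (bracket_span star_commutator (dihedral \<zeta>) \<union> R)"
    by (intro cpoly.span_minimal cpoly.subspace_span) blast
  then show ?thesis using x by blast
qed

context
  fixes \<zeta> :: complex and m :: nat
  assumes \<zeta>: "\<zeta> \<noteq> 0" "\<zeta> ^ m = 1" "m > 0"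
begin

lemma invariant_polys_in_commutator_span:
  assumes "f \<in> invariant_polys (dihedral \<zeta>)" "f \<in> pdeg_le n"
  shows "f \<in> cpoly.span (bracket_span star_commutator (dihedral \<zeta>) \<union> radials m n)"
  using assms
proof (induction "nat n" arbitrary: n f rule: less_induct)
  case less
  show ?case
  proof (cases "n < 0")
    case True
    then have "f = 0" using less.prems by (intro pdeg_le_neg)
    then show ?thesis by (simp add: cpoly.span_zero)
  next
    case False
    have lower: "g \<in> cpoly.span (bracket_span star_commutator (dihedral \<zeta>) \<union> radials m n)"
      if g: "g \<in> invariant_polys (dihedral \<zeta>)" "g \<in> pdeg_le (n - 2)" for g
    \<comment> \<open>At \<open>n = 0\<close> the measure \<open>nat n\<close> does not drop on
      passing to \<open>n - 2\<close>, so negative bounds are settled apart.\<close>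
    proof (cases "n - 2 < 0")
      case True
      then have "g = 0" using g by (intro pdeg_le_neg)
      then show ?thesis by (simp add: cpoly.span_zero)
    next
      case False
      have "g \<in> cpoly.span (bracket_span star_commutator (dihedral \<zeta>) \<union> radials m (n - 2))"
        using False g by (intro less.hyps) auto
      moreover have "radials m (n - 2) \<subseteq> radials m n"
        unfolding radials_def by auto
      ultimately show ?thesis
        using cpoly.span_mono[of "bracket_span star_commutator (dihedral \<zeta>) \<union> radials m (n - 2)"
            "bracket_span star_commutator (dihedral \<zeta>) \<union> radials m n"] by blast
    qed
    have "graded_brackets \<zeta> n \<union> radials m n \<subseteq>
        cpoly.span (bracket_span star_commutator (dihedral \<zeta>) \<union> radials m n)"
      using graded_brackets_in_commutator_span[OF \<zeta>(1) cpoly.span_base lower]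
      by (auto intro: cpoly.span_base)
    from cpoly.span_minimal[OF this cpoly.subspace_span]
    show ?thesis
      using invariant_polys_in_span_radial[OF \<zeta> less.prems] unfolding radials_def by blast
  qed
qed

lemma invariant_polys_subset_commutator_span:
  "invariant_polys (dihedral \<zeta>) \<subseteq>
    cpoly.span (bracket_span star_commutator (dihedral \<zeta>) \<union> radial ` {k. even k \<and> k + 1 < m})"
proof
  fix f assume f: "f \<in> invariant_polys (dihedral \<zeta>)"
  obtain n where n: "f \<in> pdeg_le (int n)" using ex_pdeg_le by blast
  have "radials m (int n) \<subseteq> radial ` {k. even k \<and> k + 1 < m}" by (auto simp: radials_def)
  then show "f \<in> cpoly.span (bracket_span star_commutator (dihedral \<zeta>) \<union>
      radial ` {k. even k \<and> k + 1 < m})"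
    using invariant_polys_in_commutator_span[OF f n]
      cpoly.span_mono[of "bracket_span star_commutator (dihedral \<zeta>) \<union> radials m (int n)"] by blast
qed

lemma invariant_polys_subset_bracket_span:
  "invariant_polys (dihedral \<zeta>) \<subseteq>
    cpoly.span (bracket_span poisson_bracket (dihedral \<zeta>) \<union> radial ` {k. even k \<and> k + 1 < m})"
proof
  fix f assume f: "f \<in> invariant_polys (dihedral \<zeta>)"
  obtain n where n: "f \<in> pdeg_le (int n)" using ex_pdeg_le by blast
  have "radials m (int n) \<subseteq> radial ` {k. even k \<and> k + 1 < m}" by (auto simp: radials_def)
  moreover have "graded_brackets \<zeta> (int n) \<subseteq> bracket_span poisson_bracket (dihedral \<zeta>)"
    unfolding bracket_span_def graded_brackets_def by (auto intro!: cpoly.span_base)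
  ultimately have "graded_brackets \<zeta> (int n) \<union> radials m (int n) \<subseteq>
      bracket_span poisson_bracket (dihedral \<zeta>) \<union> radial ` {k. even k \<and> k + 1 < m}" by blast
  from cpoly.span_mono[OF this]
  show "f \<in> cpoly.span (bracket_span poisson_bracket (dihedral \<zeta>) \<union>
      radial ` {k. even k \<and> k + 1 < m})"
    using invariant_polys_in_span_radial[OF \<zeta> f n] unfolding radials_def by blast
qed

text \<open>Different \<open>radial k\<close> have different degrees, so one homogeneous component
  isolates a single \<open>radial n\<close>. Replacing brackets by commutators adds only
  \<open>radial k\<close> with \<open>k < n\<close>; the coefficient of \<open>radial n\<close>
  stays 1, and the relation so obtained is nontrivial.\<close>

lemma radial_independent_mod_bracket_span:
  assumes ind: "\<And>c. (\<Sum>k\<in>{k. even k \<and> k + 1 < m}. cscale (c k) (radial k)) \<in>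
      bracket_span star_commutator (dihedral \<zeta>) \<Longrightarrow> \<forall>k\<in>{k. even k \<and> k + 1 < m}. c k = 0"
    and c: "(\<Sum>k\<in>{k. even k \<and> k + 1 < m}. cscale (c k) (radial k)) \<in>
      bracket_span poisson_bracket (dihedral \<zeta>)"
  shows "\<forall>k\<in>{k. even k \<and> k + 1 < m}. c k = 0"
proof (rule ccontr)
  let ?K = "{k. even k \<and> k + 1 < m}" and ?N = "bracket_span star_commutator (dihedral \<zeta>)"
  have fin: "finite ?K" by (rule finite_subset[of _ "{..m}"]) auto
  assume "\<not> (\<forall>k\<in>?K. c k = 0)"
  then obtain n where n: "n \<in> ?K" "c n \<noteq> 0" by blast
  have hom: "hom_component (int (2 * n)) (radial k) = (if k = n then radial k else 0)" for k
    using hom_component_homogeneous[OF homogeneous_sym_monomial[of k 0 0 k], of "int (2 * n)"]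
    by (auto simp: radial_def)
  have "hom_component (int (2 * n)) (\<Sum>k\<in>?K. cscale (c k) (radial k)) =
      (\<Sum>k\<in>?K. if k = n then cscale (c k) (radial k) else 0)"
    unfolding hom_component_sum hom_component_cscale hom by (rule sum.cong) auto
  also have "\<dots> = cscale (c n) (radial n)" using n fin by simp
  finally have "cscale (c n) (radial n) \<in> cpoly.span (graded_brackets \<zeta> (int (2 * n)))"
    using hom_component_bracket_span[OF \<zeta>(1) c, of "int (2 * n)"] by simp
  then have "radial n \<in> cpoly.span (graded_brackets \<zeta> (int (2 * n)))"
    using subspace_cscale_cancel[OF cpoly.subspace_span _ n(2)] by blast
  then have "radial n \<in> cpoly.span (?N \<union> radials m (int (2 * n) - 2))"
    by (rule graded_brackets_in_commutator_span[OF \<zeta>(1)]) (rule invariant_polys_in_commutator_span)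
  moreover have "radials m (int (2 * n) - 2) \<subseteq> radial ` {k \<in> ?K. k < n}"
    by (auto simp: radials_def)
  then have "cpoly.span (?N \<union> radials m (int (2 * n) - 2)) \<subseteq> cpoly.span (?N \<union> radial ` {k \<in> ?K. k < n})"
    by (intro cpoly.span_mono) blast
  ultimately have mem: "radial n \<in> cpoly.span (?N \<union> radial ` {k \<in> ?K. k < n})" by blast
  have sub: "cpoly.subspace ?N" by (simp add: bracket_span_def)
  have "finite {k \<in> ?K. k < n}" using fin by simp
  from cpoly.ex_coefficients_if_in_span_Un[OF sub this mem]
  obtain d where d: "radial n - (\<Sum>k\<in>{k \<in> ?K. k < n}. cscale (d k) (radial k)) \<in> ?N" ..
  let ?e = "\<lambda>k. if k = n then 1 else if k < n then - d k else 0"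
  have "(\<Sum>k\<in>?K. cscale (?e k) (radial k)) =
      cscale (?e n) (radial n) + (\<Sum>k\<in>?K - {n}. cscale (?e k) (radial k))"
    using fin n(1) by (intro sum.remove)
  also have "(\<Sum>k\<in>?K - {n}. cscale (?e k) (radial k)) =
      (\<Sum>k\<in>{k \<in> ?K. k < n}. cscale (- d k) (radial k))"
    using fin by (intro sum.mono_neutral_cong_right) auto
  finally have "(\<Sum>k\<in>?K. cscale (?e k) (radial k)) \<in> ?N"
    using d by (simp add: sum_negf)
  from ind[OF this] n(1) show False by auto
qed

lemma radial_invariant: "radial k \<in> invariant_polys (dihedral \<zeta>)"
  unfolding radial_def by (rule sym_monomial_invariant) (simp_all add: \<zeta> rotation_invariant_def)

lemma has_codim_dihedral:
  assumes "\<And>c. (\<Sum>k\<in>{k. even k \<and> k + 1 < m}. cscale (c k) (radial k)) \<in>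
      bracket_span star_commutator (dihedral \<zeta>) \<Longrightarrow> \<forall>k\<in>{k. even k \<and> k + 1 < m}. c k = 0"
  shows "has_codim cscale (invariant_polys (dihedral \<zeta>)) (bracket_span star_commutator (dihedral \<zeta>))
      (card {k. even k \<and> k + 1 < m})"
    "has_codim cscale (invariant_polys (dihedral \<zeta>)) (bracket_span poisson_bracket (dihedral \<zeta>))
      (card {k. even k \<and> k + 1 < m})"
proof -
  have fin: "finite {k. even k \<and> k + 1 < m}" by (rule finite_subset[of _ "{..m}"]) auto
  have rad: "radial ` {k. even k \<and> k + 1 < m} \<subseteq> invariant_polys (dihedral \<zeta>)"
    using radial_invariant by blast
  have 0: "0 \<in> bracket_span \<beta> (dihedral \<zeta>)" for \<beta>
    by (simp add: bracket_span_def cpoly.span_zero)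
  show "has_codim cscale (invariant_polys (dihedral \<zeta>)) (bracket_span star_commutator (dihedral \<zeta>))
      (card {k. even k \<and> k + 1 < m})"
    by (rule has_codimI[OF cpoly.vector_space_axioms fin rad invariant_polys_subset_commutator_span 0])
      (rule assms)
  show "has_codim cscale (invariant_polys (dihedral \<zeta>)) (bracket_span poisson_bracket (dihedral \<zeta>))
      (card {k. even k \<and> k + 1 < m})"
    by (rule has_codimI[OF cpoly.vector_space_axioms fin rad invariant_polys_subset_bracket_span 0])
      (rule radial_independent_mod_bracket_span[OF assms])
qed

end

section \<open>The three Weyl groups\<close>

definition coxeter_number :: "rank2_type \<Rightarrow> nat" where
  "coxeter_number X = (case X of A2 \<Rightarrow> 3 | B2 \<Rightarrow> 4 | G2 \<Rightarrow> 6)"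

text \<open>\<open>2 cos (2 \<pi> / m)\<close> for the Coxeter number \<open>m\<close>.\<close>

definition root_trace :: "rank2_type \<Rightarrow> complex" where
  "root_trace X = (case X of A2 \<Rightarrow> - 1 | B2 \<Rightarrow> 0 | G2 \<Rightarrow> 1)"

lemma ex_root: "\<exists>\<zeta>. \<zeta>\<^sup>2 + 1 = root_trace X * \<zeta>"
proof (cases X)
  case A2
  have "(Complex (- 1 / 2) (sqrt 3 / 2))\<^sup>2 + 1 = - 1 * Complex (- 1 / 2) (sqrt 3 / 2)"
    by (simp add: complex_eq_iff power2_eq_square)
  then show ?thesis by (auto simp: A2 root_trace_def)
next
  case B2
  show ?thesis by (rule exI[of _ "\<i>"]) (simp add: B2 root_trace_def)
next
  case G2
  have "(Complex (1 / 2) (sqrt 3 / 2))\<^sup>2 + 1 = 1 * Complex (1 / 2) (sqrt 3 / 2)"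
    by (simp add: complex_eq_iff power2_eq_square)
  then show ?thesis by (auto simp: G2 root_trace_def)
qed

lemma even_less_sets:
  "{k::nat. even k \<and> k + 1 < 3} = {0}"
  "{k::nat. even k \<and> k + 1 < 4} = {0, 2}"
  "{k::nat. even k \<and> k + 1 < 6} = {0, 2, 4}"
proof -
  show "{k::nat. even k \<and> k + 1 < 3} = {0}"
    by (rule Set.set_eqI, unfold mem_Collect_eq insert_iff empty_iff) presburger
  show "{k::nat. even k \<and> k + 1 < 4} = {0, 2}"
    by (rule Set.set_eqI, unfold mem_Collect_eq insert_iff empty_iff) presburger
  show "{k::nat. even k \<and> k + 1 < 6} = {0, 2, 4}"
    by (rule Set.set_eqI, unfold mem_Collect_eq insert_iff empty_iff) presburger
qed

section \<open>Roots of unity and independence for each type\<close>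

context
  fixes \<zeta> :: complex and X :: rank2_type
  assumes \<zeta>: "\<zeta>\<^sup>2 + 1 = root_trace X * \<zeta>"
begin

lemma root_ne: "\<zeta> \<noteq> 0" "\<zeta> \<noteq> 1"
  using \<zeta> by (auto simp: root_trace_def split: rank2_type.splits)

text \<open>The quadratic equation is that of the cyclotomic polynomial of order 3, 4 or 6; each
  case writes out the cofactor.\<close>

lemma root_power: "\<zeta> ^ coxeter_number X = 1"
proof (cases X)
  case A2
  then have "\<zeta>\<^sup>2 + 1 + \<zeta> = 0"
    using \<zeta> by (simp add: root_trace_def flip: eq_neg_iff_add_eq_0)
  moreover have "\<zeta> ^ 3 - 1 = (\<zeta>\<^sup>2 + 1 + \<zeta>) * (\<zeta> - 1)"
    by (simp add: eval_nat_numeral algebra_simps)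
  ultimately have "\<zeta> ^ 3 = 1" by simp
  then show ?thesis by (simp add: A2 coxeter_number_def)
next
  case B2
  then have "\<zeta>\<^sup>2 + 1 = 0" using \<zeta> by (simp add: root_trace_def)
  moreover have "\<zeta> ^ 4 - 1 = (\<zeta>\<^sup>2 + 1) * (\<zeta>\<^sup>2 - 1)"
    by (simp add: eval_nat_numeral algebra_simps)
  ultimately have "\<zeta> ^ 4 = 1" by simp
  then show ?thesis by (simp add: B2 coxeter_number_def)
next
  case G2
  then have "\<zeta>\<^sup>2 + 1 = \<zeta>" using \<zeta> by (simp add: root_trace_def)
  moreover have "\<zeta> ^ 6 - 1 = (\<zeta>\<^sup>2 + 1 - \<zeta>) * ((\<zeta> + 1) * (\<zeta> ^ 3 - 1))"
    by (simp add: eval_nat_numeral algebra_simps)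
  ultimately have "\<zeta> ^ 6 = 1" by simp
  then show ?thesis by (simp add: G2 coxeter_number_def)
qed

lemma trace_equation:
  assumes "(\<Sum>k\<in>K. cscale (c k) (radial k)) \<in> bracket_span star_commutator (dihedral \<zeta>)"
    "\<zeta> ^ j \<noteq> 1"
  shows "(\<Sum>k\<in>K. c k * twisted_trace (\<zeta> ^ j) (radial k)) = 0"
  using twisted_trace_bracket_span[OF _ assms(2) root_ne(1) HOL.refl assms(1)] root_ne
  by (simp add: twisted_trace_sum twisted_trace_cscale)

text \<open>Each \<open>\<zeta> ^ j\<close> other than 1 gives one linear equation, in which only
  \<open>s = \<zeta> ^ j + \<zeta> ^ (- j)\<close> matters through
  \<open>\<kappa> = 1 / (2 - s)\<close>. So \<open>j\<close> runs up to half the order: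
  \<open>\<kappa>\<close> is 1/3 for \<open>A2\<close>; 1/2, 1/4 for \<open>B2\<close>; 1, 1/3, 1/4
  for \<open>G2\<close>.\<close>

lemma radial_independent_mod_commutator_span:
  assumes c: "(\<Sum>k\<in>{k. even k \<and> k + 1 < coxeter_number X}. cscale (c k) (radial k)) \<in>
      bracket_span star_commutator (dihedral \<zeta>)"
  shows "\<forall>k\<in>{k. even k \<and> k + 1 < coxeter_number X}. c k = 0"
proof (cases X)
  case A2
  then have K: "{k. even k \<and> k + 1 < coxeter_number X} = {0}"
    by (simp only: coxeter_number_def rank2_type.case even_less_sets)
  note eq = trace_equation[OF c[unfolded K]]
  from A2 have z: "\<zeta>\<^sup>2 + 1 = - 1 * \<zeta>" using \<zeta> by (simp add: root_trace_def)
  have "c 0 = 0"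
    using eq[of 1] root_ne twisted_trace_radial[OF root_ne z, of "1/3"]
    by simp
  then show ?thesis unfolding K by simp
next
  case B2
  then have K: "{k. even k \<and> k + 1 < coxeter_number X} = {0, 2}"
    by (simp only: coxeter_number_def rank2_type.case even_less_sets)
  note eq = trace_equation[OF c[unfolded K]]
  from B2 have z: "\<zeta>\<^sup>2 + 1 = 0 * \<zeta>" using \<zeta> by (simp add: root_trace_def)
  then have z2: "\<zeta>\<^sup>2 = - 1" by (simp add: eq_neg_iff_add_eq_0)
  \<comment> \<open>At \<open>\<kappa> = 1/2\<close> the trace of \<open>radial 2\<close> vanishes,
    so this equation isolates \<open>c 0\<close>.\<close>
  have 1: "c 0 = 0"
    using eq[of 1] root_ne twisted_trace_radial[OF root_ne z, of "1/2"]
    by simp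
  have "c 0 * (1/2) + c 2 * (1/4) = 0"
    using eq[of 2] twisted_trace_radial[of "- 1" "- 2" "1/4"]
    by (simp add: z2)
  then show ?thesis unfolding K using 1 by simp
next
  case G2
  then have K: "{k. even k \<and> k + 1 < coxeter_number X} = {0, 2, 4}"
    by (simp only: coxeter_number_def rank2_type.case even_less_sets)
  note eq = trace_equation[OF c[unfolded K]]
  from G2 have z: "\<zeta>\<^sup>2 + 1 = 1 * \<zeta>" using \<zeta> by (simp add: root_trace_def)
  then have z2: "\<zeta>\<^sup>2 = \<zeta> - 1" by (simp add: algebra_simps)
  have z2ne: "\<zeta>\<^sup>2 \<noteq> 1"
  proof
    assume "\<zeta>\<^sup>2 = 1"
    then have "\<zeta> = 2" using z2 by (simp add: algebra_simps)
    then show False using \<open>\<zeta>\<^sup>2 = 1\<close> by simp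
  qed
  have "(\<zeta>\<^sup>2)\<^sup>2 + 1 + \<zeta>\<^sup>2 = (\<zeta>\<^sup>2 + 1 - \<zeta>) * (\<zeta>\<^sup>2 + 1 + \<zeta>)"
    by (simp add: eval_nat_numeral algebra_simps)
  then have "(\<zeta>\<^sup>2)\<^sup>2 + 1 + \<zeta>\<^sup>2 = 0" using z by simp
  then have z2': "(\<zeta>\<^sup>2)\<^sup>2 + 1 = - 1 * \<zeta>\<^sup>2" by (simp only: eq_neg_iff_add_eq_0 mult_minus1)
  have "\<zeta> ^ 3 - (- 1) = (\<zeta>\<^sup>2 + 1 - \<zeta>) * (\<zeta> + 1)"
    by (simp add: eval_nat_numeral algebra_simps)
  then have z3: "\<zeta> ^ 3 = - 1" using z by (simp add: eq_neg_iff_add_eq_0)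
  have z2n0: "\<zeta>\<^sup>2 \<noteq> 0" using root_ne by simp
  have 1: "c 0 * 2 + c 2 * (- 2) + c 4 * (- 24) = 0"
    using eq[of 1] root_ne twisted_trace_radial[OF root_ne z, of 1]
    by (simp add: algebra_simps)
  have T: "twisted_trace (\<zeta>\<^sup>2) (radial 0) = 2/3" "twisted_trace (\<zeta>\<^sup>2) (radial 2) = 2/9"
    "twisted_trace (\<zeta>\<^sup>2) (radial 4) = - 8/9"
    using twisted_trace_radial[OF z2n0 z2ne z2', of "1/3"] by (simp_all add: power2_eq_square)
  have 2: "c 0 * (2/3) + (c 2 * (2/9) + c 4 * (- 8/9)) = 0"
    using eq[of 2] z2ne by (simp add: T)
  have 3: "c 0 * (1/2) + c 2 * (1/4) + c 4 * (3/4) = 0"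
    using eq[of 3] twisted_trace_radial[of "- 1" "- 2" "1/4"]
    by (simp add: add.assoc z3 power2_eq_square)
  \<comment> \<open>These weights eliminate \<open>c 0\<close> and \<open>c 2\<close> from the three
    equations; the combination for \<open>c 2\<close> below eliminates \<open>c 0\<close> in the
    same way.\<close>
  have "c 4 = 1/24 * (c 0 * 2 + c 2 * (- 2) + c 4 * (- 24)) -
      9/8 * (c 0 * (2/3) + (c 2 * (2/9) + c 4 * (- 8/9))) + 4/3 * (c 0 * (1/2) + c 2 * (1/4) + c 4 * (3/4))"
    by (simp add: field_simps)
  then have "c 4 = 0" unfolding 1 2 3 by simp
  moreover have "c 2 = - 3/8 * (c 0 * 2 + c 2 * (- 2) + c 4 * (- 24)) +
      9/8 * (c 0 * (2/3) + (c 2 * (2/9) + c 4 * (- 8/9))) - 8 * c 4"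
    by (simp add: field_simps)
  then have "c 2 = 0" unfolding 1 2 using calculation by simp
  moreover from calculation have "c 0 = 0" using 1 by simp
  ultimately show ?thesis unfolding K by simp
qed

lemma has_codim_rank2:
  "has_codim cscale (invariant_polys (dihedral \<zeta>)) (bracket_span star_commutator (dihedral \<zeta>))
    (case X of A2 \<Rightarrow> 1 | B2 \<Rightarrow> 2 | G2 \<Rightarrow> 3)"
  "has_codim cscale (invariant_polys (dihedral \<zeta>)) (bracket_span poisson_bracket (dihedral \<zeta>))
    (case X of A2 \<Rightarrow> 1 | B2 \<Rightarrow> 2 | G2 \<Rightarrow> 3)"
proof -
  have "card {k. even k \<and> k + 1 < coxeter_number X} = (case X of A2 \<Rightarrow> 1 | B2 \<Rightarrow> 2 | G2 \<Rightarrow> 3)"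
    by (cases X) (simp_all only: coxeter_number_def rank2_type.case even_less_sets, simp_all)
  moreover have "coxeter_number X > 0" by (cases X) (simp_all add: coxeter_number_def)
  note has_codim_dihedral[OF root_ne(1) root_power this radial_independent_mod_commutator_span]
  ultimately show
    "has_codim cscale (invariant_polys (dihedral \<zeta>)) (bracket_span star_commutator (dihedral \<zeta>))
      (case X of A2 \<Rightarrow> 1 | B2 \<Rightarrow> 2 | G2 \<Rightarrow> 3)"
    "has_codim cscale (invariant_polys (dihedral \<zeta>)) (bracket_span poisson_bracket (dihedral \<zeta>))
      (case X of A2 \<Rightarrow> 1 | B2 \<Rightarrow> 2 | G2 \<Rightarrow> 3)" by simp_all
qed

end

text \<open>Two systems of roots and coroots with the same invertible pairing matrix differ by a
  linear map. From \<open>R ** C = \<Xi> ** V\<close> the matrix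
  \<open>h = matrix_inv R ** \<Xi>\<close> satisfies \<open>R ** h = \<Xi>\<close> and
  \<open>h ** V = C\<close>, so it conjugates one pair of reflections into the other. It remains to
  exhibit the two swaps as reflections with the prescribed pairings.\<close>

lemma reflections_conjugate_dihedral:
  assumes X: "realizes_cartan X \<alpha> \<alpha>v" and \<zeta>: "\<zeta>\<^sup>2 + 1 = root_trace X * \<zeta>"
  shows "\<exists>h. invertible h \<and>
    (\<lambda>g. h ** g ** matrix_inv h) ` dihedral \<zeta> = range (\<lambda>i. reflection (\<alpha> i) (\<alpha>v i))"
proof -
  have ne: "\<zeta> \<noteq> 0" "\<zeta> \<noteq> 1" using root_ne[OF \<zeta>] by auto
  \<comment> \<open>Transposed, because in \<open>R ** C\<close> the roots index the rows, while in
    the Cartan matrix they index the columns.\<close>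
  define M :: "complex^2^2" where "M = (\<chi> i j. of_int (cartan_matrix X $ j $ i))"
  define R :: "complex^2^2" where "R = (\<chi> i. \<alpha> i)"
  define C :: "complex^2^2" where "C = (\<chi> i j. \<alpha>v j $ i)"
  \<comment> \<open>A reflection determines its root only up to a scalar. The scale \<open>t\<close>
    is forced by \<open>M $ 2 $ 1 = (1 + \<zeta>) / t\<close>; the entry \<open>M $ 1 $ 2\<close>
    then comes out right since the product of both is \<open>2 + \<zeta> + 1 / \<zeta>\<close>,
    which is where \<open>root_trace\<close> comes from.\<close>
  define t where "t = (1 + \<zeta>) / M $ 2 $ 1"
  define \<Xi> :: "complex^2^2" where "\<Xi> = vector [vector [1, - 1], vector [1 / t, - \<zeta> / t]]"
  define V :: "complex^2^2" where "V = vector [vector [1, t], vector [- 1, - t / \<zeta>]]"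
  \<comment> \<open>With matrix units a reflection is the identity minus
    \<open>C ** E i ** R\<close>, which reduces the conjugation to matrix algebra.\<close>
  define E :: "2 \<Rightarrow> complex^2^2" where "E i = (\<chi> a b. if a = i \<and> b = i then 1 else 0)" for i
  have M: "M $ 1 $ 1 = 2" "M $ 2 $ 2 = 2" "M $ 2 $ 1 \<noteq> 0" "M $ 1 $ 2 * M $ 2 $ 1 = 2 + root_trace X"
    by (cases X; simp add: M_def cartan_matrix_def root_trace_def)+
  have s: "2 + root_trace X \<noteq> 0" by (cases X) (simp_all add: root_trace_def)
  have "(1 + \<zeta>)\<^sup>2 = (2 + root_trace X) * \<zeta>"
    using \<zeta> by (simp add: power2_eq_square algebra_simps)
  then have \<zeta>1: "1 + \<zeta> \<noteq> 0" using s ne by auto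
  then have t: "t \<noteq> 0" using M by (simp add: t_def)
  have RC: "R ** C = M"
    using X by (simp add: vec_eq_iff matrix_matrix_mult_def R_def C_def M_def realizes_cartan_def pairing_def)
  have \<Xi>V: "\<Xi> ** V = M"
  proof -
    have "t + t / \<zeta> = M $ 1 $ 2"
    proof -
      have "(t + t / \<zeta>) * M $ 2 $ 1 = (1 + \<zeta>)\<^sup>2 / \<zeta>"
        using M(3) ne by (simp add: t_def field_simps power2_eq_square)
      also have "\<dots> = M $ 1 $ 2 * M $ 2 $ 1"
        unfolding M(4) using \<open>(1 + \<zeta>)\<^sup>2 = (2 + root_trace X) * \<zeta>\<close> ne by simp
      finally show ?thesis using M(3) by simp
    qed
    moreover have "1 / t + \<zeta> / t = M $ 2 $ 1"
    proof -
      have "x / (x / y) = y" if "x \<noteq> 0" "y \<noteq> 0" for x y :: complex using that by simp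
      from this[OF \<zeta>1 M(3)] show ?thesis
        unfolding t_def[symmetric] by (simp only: add_divide_distrib)
    qed
    ultimately show ?thesis
      using M t ne by (simp add: vec_eq_iff forall_2 matrix_matrix_mult_def sum_2 \<Xi>_def V_def)
  qed
  have "det M \<noteq> 0"
    using M s by (cases X) (simp_all add: det_2 M_def cartan_matrix_def)
  then have det: "det R \<noteq> 0" "det C \<noteq> 0" "det \<Xi> \<noteq> 0" "det V \<noteq> 0"
    using RC \<Xi>V det_mul[of R C] det_mul[of \<Xi> V] by auto
  define h where "h = matrix_inv R ** \<Xi>"
  have invR: "invertible R" and inv\<Xi>: "invertible \<Xi>"
    using det by (simp_all add: invertible_det_nz)
  have h: "invertible h"
    unfolding h_def by (intro invertible_mult invertible_matrix_inv invR inv\<Xi>)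
  have Rh: "R ** h = \<Xi>" unfolding h_def by (simp add: matrix_mul_assoc matrix_inv_inverse[OF invR])
  have hV: "h ** V = C"
  proof -
    have "h ** V = matrix_inv R ** (\<Xi> ** V)" unfolding h_def by (simp add: matrix_mul_assoc)
    also have "\<dots> = (matrix_inv R ** R) ** C" unfolding \<Xi>V RC[symmetric] by (simp add: matrix_mul_assoc)
    finally show ?thesis by (simp add: matrix_inv_inverse[OF invR])
  qed
  have E_mult: "(P ** E i ** Q) $ a $ b = P $ a $ i * Q $ i $ b" for P Q :: "complex^2^2" and i a b
    using exhaust_2[of i] by (auto simp: matrix_matrix_mult_def sum_2 E_def)
  have refl: "reflection (\<alpha> i) (\<alpha>v i) = mat 1 - C ** E i ** R" for i
    by (simp add: vec_eq_iff reflection_def E_mult mat_def C_def R_def)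
  have swap: "swap_matrix 1 = mat 1 - V ** E 1 ** \<Xi>" "swap_matrix \<zeta> = mat 1 - V ** E 2 ** \<Xi>"
    using t ne by (simp_all add: vec_eq_iff forall_2 E_mult mat_def V_def \<Xi>_def field_simps)
  have dist: "h ** (mat 1 - Z) = h - h ** Z" "(mat 1 - Z) ** h = h - Z ** h" for Z :: "complex^2^2"
    by (simp_all add: vec_eq_iff matrix_matrix_mult_def mat_def sum_2 forall_2 algebra_simps)
  have conj: "h ** (mat 1 - V ** E i ** \<Xi>) ** matrix_inv h = reflection (\<alpha> i) (\<alpha>v i)" for i
  proof -
    have "h ** (mat 1 - V ** E i ** \<Xi>) = h - C ** E i ** \<Xi>"
      unfolding dist hV[symmetric] by (simp add: matrix_mul_assoc)
    also have "\<dots> = reflection (\<alpha> i) (\<alpha>v i) ** h"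
      unfolding refl dist Rh[symmetric] by (simp add: matrix_mul_assoc)
    finally show ?thesis
      by (simp add: matrix_mul_assoc[symmetric] matrix_inv_inverse[OF h])
  qed
  have "(\<lambda>g. h ** g ** matrix_inv h) ` dihedral \<zeta> = range (\<lambda>i. reflection (\<alpha> i) (\<alpha>v i))"
    unfolding dihedral_def swap UNIV_2 by (simp add: conj)
  then show ?thesis using h by blast
qed

section \<open>From the simple reflections to the Weyl group\<close>

lemma realizes_cartan_pairing_2:
  assumes "realizes_cartan X \<alpha> \<alpha>v"
  shows "pairing (\<alpha> i) (\<alpha>v i) = 2"
  using assms exhaust_2[of i]
  by (cases X) (auto simp: realizes_cartan_def cartan_matrix_def)

lemma invertible_weyl_group:
  assumes "realizes_cartan X \<alpha> \<alpha>v" "g \<in> weyl_group \<alpha> \<alpha>v"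
  shows "invertible g"
  using assms(2)
proof induction
  case one
  show ?case unfolding invertible_def by (intro exI[of _ "mat 1"]) simp
next
  case (refl w i)
  have "invertible (reflection (\<alpha> i) (\<alpha>v i))"
    using reflection_involution[OF realizes_cartan_pairing_2[OF assms(1)]] invertible_def by blast
  then show ?case using refl by (intro invertible_mult)
qed

text \<open>Both quotients see the group only through its invariants, so it is enough to have
  conjugated the two simple reflections.\<close>

lemma invariant_polys_weyl_group:
  assumes X: "realizes_cartan X \<alpha> \<alpha>v"
  shows "invariant_polys (weyl_group \<alpha> \<alpha>v) = invariant_polys (range (\<lambda>i. reflection (\<alpha> i) (\<alpha>v i)))"
proof (intro equalityI subsetI)
  fix f assume f: "f \<in> invariant_polys (weyl_group \<alpha> \<alpha>v)"
  have "reflection (\<alpha> i) (\<alpha>v i) \<in> weyl_group \<alpha> \<alpha>v" for i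
    using weyl_group.refl[OF weyl_group.one, of \<alpha> i \<alpha>v] by simp
  then show "f \<in> invariant_polys (range (\<lambda>i. reflection (\<alpha> i) (\<alpha>v i)))"
    using f by (auto simp: invariant_polys_def)
next
  fix f assume f: "f \<in> invariant_polys (range (\<lambda>i. reflection (\<alpha> i) (\<alpha>v i)))"
  have "act_double g f = f" if "g \<in> weyl_group \<alpha> \<alpha>v" for g
    using that
  proof induction
    case one
    show ?case by (rule act_double_mat_1)
  next
    case (refl w i)
    have "invertible (reflection (\<alpha> i) (\<alpha>v i))"
      using reflection_involution[OF realizes_cartan_pairing_2[OF X]] invertible_def by blast
    then show ?case
      using refl f invertible_weyl_group[OF X refl(1)]
      by (simp add: act_double_matrix_mult invariant_polys_def)
  qed
  then show "f \<in> invariant_polys (weyl_group \<alpha> \<alpha>v)" by (simp add: invariant_polys_def)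
qed

lemma has_codim_weyl_group:
  assumes X: "realizes_cartan X \<alpha> \<alpha>v"
  shows "has_codim cscale (invariant_polys (weyl_group \<alpha> \<alpha>v))
      (bracket_span star_commutator (weyl_group \<alpha> \<alpha>v)) (case X of A2 \<Rightarrow> 1 | B2 \<Rightarrow> 2 | G2 \<Rightarrow> 3)"
    "has_codim cscale (invariant_polys (weyl_group \<alpha> \<alpha>v))
      (bracket_span poisson_bracket (weyl_group \<alpha> \<alpha>v)) (case X of A2 \<Rightarrow> 1 | B2 \<Rightarrow> 2 | G2 \<Rightarrow> 3)"
proof -
  obtain \<zeta> where \<zeta>: "\<zeta>\<^sup>2 + 1 = root_trace X * \<zeta>" using ex_root by blast
  obtain h where h: "invertible h"
    "(\<lambda>g. h ** g ** matrix_inv h) ` dihedral \<zeta> = range (\<lambda>i. reflection (\<alpha> i) (\<alpha>v i))"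
    using reflections_conjugate_dihedral[OF X \<zeta>] by blast
  have inv: "g \<in> dihedral \<zeta> \<Longrightarrow> invertible g" for g
    using invertible_dihedral root_ne(1)[OF \<zeta>] by blast
  have W: "invariant_polys (weyl_group \<alpha> \<alpha>v) = act_double h ` invariant_polys (dihedral \<zeta>)"
    using act_double_image_invariant_polys[of h "dihedral \<zeta>", OF h(1) inv] h(2)
      invariant_polys_weyl_group[OF X] by simp
  have BW: "bracket_span \<beta> (weyl_group \<alpha> \<alpha>v) = act_double h ` bracket_span \<beta> (dihedral \<zeta>)"
    if "\<And>f g. act_double h (\<beta> f g) = \<beta> (act_double h f) (act_double h g)" for \<beta>
  proof -
    have "bracket_span \<beta> (weyl_group \<alpha> \<alpha>v) = bracket_span \<beta> (range (\<lambda>i. reflection (\<alpha> i) (\<alpha>v i)))"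
      by (simp add: bracket_span_def invariant_polys_weyl_group[OF X])
    then show ?thesis
      using act_double_image_bracket_span[of h "dihedral \<zeta>" \<beta>, OF h(1) inv that] h(2) by simp
  qed
  have BW_star: "bracket_span star_commutator (weyl_group \<alpha> \<alpha>v) =
      act_double h ` bracket_span star_commutator (dihedral \<zeta>)"
    by (rule BW) (rule act_double_star_commutator[OF h(1)])
  have BW_poisson: "bracket_span poisson_bracket (weyl_group \<alpha> \<alpha>v) =
      act_double h ` bracket_span poisson_bracket (dihedral \<zeta>)"
    by (rule BW) (rule act_double_poisson_bracket[OF h(1)])
  note image = has_codim_image[OF cpoly.vector_space_axioms cpoly.vector_space_axioms
      linear_act_double inj_act_double[OF h(1)]]
  show "has_codim cscale (invariant_polys (weyl_group \<alpha> \<alpha>v))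
      (bracket_span star_commutator (weyl_group \<alpha> \<alpha>v)) (case X of A2 \<Rightarrow> 1 | B2 \<Rightarrow> 2 | G2 \<Rightarrow> 3)"
    unfolding W BW_star by (rule image[OF has_codim_rank2(1)[OF \<zeta>]])
  show "has_codim cscale (invariant_polys (weyl_group \<alpha> \<alpha>v))
      (bracket_span poisson_bracket (weyl_group \<alpha> \<alpha>v)) (case X of A2 \<Rightarrow> 1 | B2 \<Rightarrow> 2 | G2 \<Rightarrow> 3)"
    unfolding W BW_poisson by (rule image[OF has_codim_rank2(2)[OF \<zeta>]])
qed

theorem mainTheorem1:
  fixes X :: rank2_type and \<alpha> \<alpha>v :: "2 \<Rightarrow> complex^2"
  assumes "realizes_cartan X \<alpha> \<alpha>v"
  shows "vs_dim (HP0 (weyl_group \<alpha> \<alpha>v)) = vs_dim (HH0 (weyl_group \<alpha> \<alpha>v)) \<and>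
    vs_dim (HP0 (weyl_group \<alpha> \<alpha>v)) = (case X of A2 \<Rightarrow> 1 | B2 \<Rightarrow> 2 | G2 \<Rightarrow> 3)"
proof -
  let ?W = "weyl_group \<alpha> \<alpha>v" and ?n = "case X of A2 \<Rightarrow> 1 | B2 \<Rightarrow> 2 | G2 \<Rightarrow> (3::nat)"
  interpret no: Vector_Spaces.linear cscale op_scale normal_order by (rule linear_normal_order)
  have inv: "g \<in> ?W \<Longrightarrow> invertible g" for g using invertible_weyl_group[OF assms] .
  have sub: "cpoly.subspace (bracket_span \<beta> ?W)" for \<beta> by (simp add: bracket_span_def)
  have "vs_dim (quotient_space cscale (invariant_polys ?W) (bracket_span poisson_bracket ?W)) = ?n"
    by (intro vs_dim_quotient_space cpoly.vector_space_axioms subspace_invariant_polys sub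
        bracket_span_subset poisson_bracket_invariant inv has_codim_weyl_group(2)[OF assms])
  then have HP: "vs_dim (HP0 ?W) = ?n" by (simp add: HP0_def bracket_span_def)
  \<comment> \<open>The operator quotient is the image of the quotient of symbols under the
    injective \<open>normal_order\<close>, so its codimension is inherited.\<close>
  have "vs_dim (quotient_space op_scale (normal_order ` invariant_polys ?W)
      (normal_order ` bracket_span star_commutator ?W)) = ?n"
    by (intro vs_dim_quotient_space pop.vector_space_axioms no.subspace_image subspace_invariant_polys
        sub image_mono bracket_span_subset star_commutator_invariant inv
        has_codim_image[OF cpoly.vector_space_axioms] linear_normal_order inj_normal_order
        has_codim_weyl_group(1)[OF assms])
  moreover have "invariant_ops ?W = normal_order ` invariant_polys ?W"
    by (rule invariant_ops_eq) (rule inv)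
  moreover have "pop.span {(\<lambda>p. D (E p) - E (D p)) | D E. D \<in> invariant_ops ?W \<and> E \<in> invariant_ops ?W} =
      normal_order ` bracket_span star_commutator ?W"
    by (rule commutator_span_eq) (rule inv)
  ultimately have "vs_dim (HH0 ?W) = ?n" unfolding HH0_def by (simp only:)
  then show ?thesis using HP by simp
qed

end
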